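(* Let $k\ge3$ be a fixed integer and let $p=p(N)\in(0,1)$, $t=t(N)>0$ and $m=m(N)$ (a positive integer) be such that, as $N\to\infty$, $$t\gg m\cdot\max\{1,Np^{k-1}\}\qquad\text{and}\qquad t\gg m^2p^{k-2}\cdot N^{(k-2)(m/t)^{1/(k-1)}}.$$ Then $$\log\mathbb P\big(U\subseteq\mathbf R\text{ for some }U\in\mathcal S_{N,p,k}(t)\text{ with }|U|\le m\big)\le(1-o(1))\cdot\Psi(t)\cdot\log p.$$
   Context: $\mathbf R$ is the random subset of $\{1,\dots,N\}$ obtained by including each number independently with probability $p$. $X$ is the number of $k$-term arithmetic progressions contained in $\mathbf R$, where a $k$-term arithmetic progression in $\{1,\dots,N\}$ is a $k$-element subset of the form $\{a,a+b,\dots,a+(k-1)b\}$ with $a,b$ positive integers; $\mu=\mathbb E[X]$. For $U\subseteq\{1,\dots,N\}$, $\mathbb E_U[X]=\mathbb E[X\mid U\subseteq\mathbf R]$. $\mathcal S_{N,p,k}(t)=\{U\subseteq\{1,\dots,N\}:\mathbb E_U[X]\ge\mu+t\}$ is the family of $t$-seeds, and $\Psi(t)=\Psi_{N,p,k}(t)=\min\{|U|:U\in\mathcal S_{N,p,k}(t)\}$, with $\Psi(t)=\infty$ if there are no $t$-seeds. $f\gg g$ means $g/f\to0$ as $N\to\infty$. Convention: $\log0=-\infty$. The conclusion means: for every $\varepsilon>0$, for all sufficiently large $N$, the left-hand side is at most $(1-\varepsilon)\Psi(t)\log p$. *)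

theory Defs
  imports "HOL-Probability.Probability"
begin

definition random_subset :: "nat \<Rightarrow> real \<Rightarrow> nat set pmf" where
  "random_subset N p =
     map_pmf (\<lambda>f. {x \<in> {1..N}. f x}) (Pi_pmf {1..N} False (\<lambda>_. bernoulli_pmf p))"

definition arith_progs :: "nat \<Rightarrow> nat \<Rightarrow> nat set set" where
  "arith_progs N k =
     {A. A \<subseteq> {1..N} \<and> card A = k \<and> (\<exists>a b. a > 0 \<and> b > 0 \<and> A = (\<lambda>i. a + i * b) ` {0..<k})}"

definition num_aps :: "nat \<Rightarrow> nat \<Rightarrow> nat set \<Rightarrow> real" where
  "num_aps N k R = real (card {A \<in> arith_progs N k. A \<subseteq> R})"

definition mean_aps :: "nat \<Rightarrow> real \<Rightarrow> nat \<Rightarrow> real" where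
  "mean_aps N p k = measure_pmf.expectation (random_subset N p) (num_aps N k)"

(* The conditioning event has positive probability, and hence cond_pmf is the intended
   conditional law, whenever 0 < p < 1 and U is a subset of {1..N}. *)
definition cond_mean_aps :: "nat \<Rightarrow> real \<Rightarrow> nat \<Rightarrow> nat set \<Rightarrow> real" where
  "cond_mean_aps N p k U =
     measure_pmf.expectation (cond_pmf (random_subset N p) {R. U \<subseteq> R}) (num_aps N k)"

definition seeds :: "nat \<Rightarrow> real \<Rightarrow> nat \<Rightarrow> real \<Rightarrow> nat set set" where
  "seeds N p k t = {U. U \<subseteq> {1..N} \<and> cond_mean_aps N p k U \<ge> mean_aps N p k + t}"

definition Psi :: "nat \<Rightarrow> real \<Rightarrow> nat \<Rightarrow> real \<Rightarrow> enat" where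
  "Psi N p k t =
     (if seeds N p k t = {} then \<infinity> else enat (Min (card ` seeds N p k t)))"

(* Needed because the real-valued ln maps 0 to 0, whereas here log 0 = -\<infinity>. *)
definition log_prob :: "real \<Rightarrow> ereal" where
  "log_prob x = (if x = 0 then -\<infinity> else ereal (ln x))"

end

theory Submission
  imports Defs
begin

text \<open>Write \<open>g(U) = E\<^sub>U[X] - \<mu>\<close>, let \<open>n\<^sub>i(Y)\<close> be the number of progressions with at least \<open>i\<close> points
  in \<open>Y\<close>, and let \<open>d\<^sub>i(Y, u)\<close> count those through \<open>u\<close>. Every seed \<open>U\<close> with \<open>|U| \<le> m\<close> contains a nonempty
  \<open>Y\<close> in which every vertex has, for some \<open>3 \<le> i \<le> k\<close>, so large a degree \<open>d\<^sub>i(Y, u)\<close> that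
  \<open>p n\<^sub>i\<^sub>-\<^sub>1(Y) \<le> r |Y| d\<^sub>i(Y, u)\<close> with a small \<open>r\<close>. Such sets are rare: by Chebyshev's inequality some
  \<open>F \<subseteq> Y\<close> with \<open>|F| \<le> 2 q |Y|\<close> sees a constant proportion of all degrees outside \<open>F\<close>, so the other
  vertices come from \<open>O(r |Y| / p)\<close> candidates determined by \<open>F\<close>. Hence \<open>R\<close> contains a
  set \<open>Y\<close> of this kind of size \<open>s\<close> with probability at most
  \<open>(O(1) max(1, N p / s)\<^sup>2\<^sup>q r\<^sup>1\<^sup>-\<^sup>2\<^sup>q)\<^sup>s\<close>.

  To find \<open>Y\<close>, first pass to a maximiser of \<open>g(Y) - \<epsilon> t (|Y| / m)\<^sup>b\<close>, which keeps \<open>(1 - \<epsilon>) t\<close> of the gain.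
  If \<open>|Y|\<close> is within a small negative power of \<open>p\<close> of \<open>\<surd>t\<close>, then \<open>r = p\<^sup>1\<^sup>-\<^sup>o\<^sup>(\<^sup>1\<^sup>)\<close> works because
  \<open>n\<^sub>i\<^sub>-\<^sub>1(Y) = O(|Y|\<^sup>2)\<close>, and \<open>|Y| \<ge> (1 - \<delta>) \<Psi>(t)\<close> since few additional vertices recover the lost gain. Otherwise
  either \<open>Y\<close> itself or a subset maximising a weighted count \<open>n\<^sub>i\<close> with \<open>i < k\<close> has a small \<open>r\<close>;
  this set is much larger than \<open>\<Psi>(t) = O(\<surd>t)\<close>, so the bound is negligible.\<close>

section \<open>Random subsets\<close>

text \<open>The candidate count comes from Markov's inequality: few vertices can have a degree in
  \<open>F\<close> comparable to \<open>d\<^sub>i(Y, u)\<close>, because these degrees sum to at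
  most \<open>k n\<^sub>i\<^sub>-\<^sub>1(Y)\<close>. A vertex outside \<open>F\<close> therefore
  costs a factor of order \<open>r\<close> instead of \<open>N p / s\<close>. The fingerprint has to
  be chosen among all \<open>N\<close> points; this is affordable because the first assumption
  bounds \<open>N p / s\<close> by a fixed power of \<open>1 / p\<close> or of
  \<open>1 / crit s\<close>, so that a small \<open>q\<close> makes the loss in the exponent small.

  The obstacle is that \<open>m\<close> may exceed \<open>\<Psi>(t)\<close> by a power of
  \<open>1 / p\<close>. A penalty linear in \<open>|Y|\<close> would only force every vertex of
  \<open>Y\<close> to carry weight of order \<open>t / m\<close>; the exponent \<open>b\<close>
  close to 0 raises this to almost \<open>t / |Y|\<close>. For sets far larger than
  \<open>\<surd>t\<close> the bound \<open>n\<^sub>i\<^sub>-\<^sub>1(Y) = O(|Y|\<^sup>2)\<close> is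
  too weak to give \<open>r\<close> of order \<open>p\<close>, but there it is enough that
  \<open>r\<close> is a small constant, since the size of the set alone outweighs
  \<open>\<Psi>(t) log(1/p)\<close>.\<close>

definition bernoulli_subset :: "'a set \<Rightarrow> real \<Rightarrow> 'a set pmf" where
  "bernoulli_subset A p = map_pmf (\<lambda>f. {x \<in> A. f x}) (Pi_pmf A False (\<lambda>_. bernoulli_pmf p))"

lemma random_subset_eq: "random_subset N p = bernoulli_subset {1..N} p"
  by (simp add: random_subset_def bernoulli_subset_def)

lemma set_pmf_bernoulli_subset: "set_pmf (bernoulli_subset A p) \<subseteq> Pow A"
  by (auto simp: bernoulli_subset_def)

lemma finite_set_pmf_bernoulli_subset: "finite A \<Longrightarrow> finite (set_pmf (bernoulli_subset A p))"
  using set_pmf_bernoulli_subset by (metis finite_Pow_iff finite_subset)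

lemma prob_superset_bernoulli_subset:
  assumes "finite A" "S \<subseteq> A" "0 \<le> p" "p \<le> 1"
  shows "measure_pmf.prob (bernoulli_subset A p) {R. S \<subseteq> R} = p ^ card S"
proof -
  have eq: "(\<lambda>f. {x \<in> A. f x}) -` {R. S \<subseteq> R} = Pi A (\<lambda>x. if x \<in> S then {True} else UNIV)"
    using assms(2) by (auto simp: Pi_def)
  have "measure_pmf.prob (bernoulli_subset A p) {R. S \<subseteq> R} =
      (\<Prod>x\<in>A. measure_pmf.prob (bernoulli_pmf p) (if x \<in> S then {True} else UNIV))"
    unfolding bernoulli_subset_def measure_map_pmf eq using assms(1) by (rule measure_Pi_pmf_Pi)
  also have "\<dots> = (\<Prod>x\<in>A. if x \<in> S then p else 1)"
    using assms by (intro prod.cong refl) (auto simp: measure_pmf_single)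
  also have "\<dots> = (\<Prod>x\<in>A \<inter> S. p)"
    using assms(1) by (rule prod.inter_restrict[symmetric])
  also have "\<dots> = p ^ card S"
    using assms(2) by (simp add: Int_absorb1)
  finally show ?thesis .
qed

lemma integrable_bernoulli_subset [simp]:
  fixes h :: "'a set \<Rightarrow> real"
  shows "finite A \<Longrightarrow> integrable (measure_pmf (bernoulli_subset A p)) h"
  by (intro integrable_measure_pmf_finite finite_set_pmf_bernoulli_subset)

section \<open>Weighted counts of subsets and the union bound over fingerprints\<close>

lemma sum_power_card_Pow:
  fixes x :: real
  shows "finite T \<Longrightarrow> (\<Sum>B\<in>Pow T. x ^ card B) = (1 + x) ^ card T"
proof (induction T rule: finite_induct)
  case (insert a T)
  have inj: "inj_on (insert a) (Pow T)"
    using insert(2) by (auto simp: inj_on_def)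
  have "(\<Sum>B\<in>Pow (insert a T). x ^ card B) =
      (\<Sum>B\<in>Pow T. x ^ card B) + (\<Sum>B\<in>insert a ` Pow T. x ^ card B)"
    unfolding Pow_insert using insert by (intro sum.union_disjoint) auto
  also have "(\<Sum>B\<in>insert a ` Pow T. x ^ card B) = (\<Sum>B\<in>Pow T. x ^ card (insert a B))"
    by (simp add: sum.reindex[OF inj])
  also have "\<dots> = (\<Sum>B\<in>Pow T. x * x ^ card B)"
    using insert by (intro sum.cong refl) (auto simp: finite_subset card_insert_if)
  finally show ?case
    using insert by (simp add: sum_distrib_left[symmetric] algebra_simps)
qed auto

text \<open>Chernoff's trick: every set \<open>B\<close> that is counted satisfies \<open>l powr (card B - f) \<ge> 1\<close>.\<close>
lemma sum_power_card_small:
  fixes x f l :: real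
  assumes "finite T" "0 \<le> x" "0 < l" "l \<le> 1" "\<And>B. B \<in> \<F> \<Longrightarrow> B \<subseteq> T \<and> card B \<le> f"
  shows "(\<Sum>B\<in>\<F>. x ^ card B) \<le> l powr (-f) * exp (l * x * card T)"
proof -
  have "(\<Sum>B\<in>\<F>. x ^ card B) \<le> (\<Sum>B\<in>\<F>. l powr (-f) * (l * x) ^ card B)"
  proof (rule sum_mono)
    fix B assume "B \<in> \<F>"
    then have "real (card B) \<le> f" using assms by auto
    then have "l powr f \<le> l ^ card B"
      using powr_mono'[of "real (card B)" f l] assms(3,4) by (simp add: powr_realpow)
    then have "l powr (-f) * l ^ card B \<ge> 1"
      using assms by (simp add: powr_minus divide_simps)
    then have "(l powr (-f) * l ^ card B) * x ^ card B \<ge> 1 * x ^ card B"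
      using assms by (intro mult_right_mono) auto
    then show "x ^ card B \<le> l powr (-f) * (l * x) ^ card B"
      by (simp add: power_mult_distrib mult.assoc)
  qed
  also have "\<dots> \<le> (\<Sum>B\<in>Pow T. l powr (-f) * (l * x) ^ card B)"
    using assms by (intro sum_mono2) auto
  also have "\<dots> = l powr (-f) * (1 + l * x) ^ card T"
    using assms by (simp add: sum_distrib_left[symmetric] sum_power_card_Pow)
  also have "\<dots> \<le> l powr (-f) * exp (l * x) ^ card T"
    using assms by (intro mult_left_mono power_mono exp_ge_add_one_self) auto
  finally show ?thesis
    by (simp add: exp_of_nat_mult[symmetric] mult.commute)
qed

text \<open>The opposite tilt: every counted \<open>B\<close> satisfies
  \<open>L powr (card B - b) \<ge> 1\<close>.\<close>

lemma sum_power_card_large: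
  fixes x b L :: real
  assumes "finite T" "0 \<le> x" "1 \<le> L" "\<And>B. B \<in> \<F> \<Longrightarrow> B \<subseteq> T \<and> b \<le> card B"
  shows "(\<Sum>B\<in>\<F>. x ^ card B) \<le> L powr (-b) * exp (L * x * card T)"
proof -
  have "(\<Sum>B\<in>\<F>. x ^ card B) \<le> (\<Sum>B\<in>\<F>. L powr (-b) * (L * x) ^ card B)"
  proof (rule sum_mono)
    fix B assume "B \<in> \<F>"
    then have "b \<le> real (card B)" using assms by auto
    then have "L powr b \<le> L ^ card B"
      using powr_mono[of b "real (card B)" L] assms(3) by (simp add: powr_realpow)
    then have "L powr (-b) * L ^ card B \<ge> 1"
      using assms by (simp add: powr_minus divide_simps)
    then have "(L powr (-b) * L ^ card B) * x ^ card B \<ge> 1 * x ^ card B"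
      using assms by (intro mult_right_mono) auto
    then show "x ^ card B \<le> L powr (-b) * (L * x) ^ card B"
      by (simp add: power_mult_distrib mult.assoc)
  qed
  also have "\<dots> \<le> (\<Sum>B\<in>Pow T. L powr (-b) * (L * x) ^ card B)"
    using assms by (intro sum_mono2) auto
  also have "\<dots> = L powr (-b) * (1 + L * x) ^ card T"
    using assms by (simp add: sum_distrib_left[symmetric] sum_power_card_Pow)
  also have "\<dots> \<le> L powr (-b) * exp (L * x) ^ card T"
    using assms by (intro mult_left_mono power_mono exp_ge_add_one_self) auto
  finally show ?thesis
    by (simp add: exp_of_nat_mult[symmetric] mult.commute)
qed

text \<open>The sets \<open>Y\<close> are encoded as \<open>(F, Y - F)\<close> with a small set \<open>F\<close> that determines the set \<open>T F\<close>
  of candidates for the remaining elements.\<close>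
lemma prob_contains_fingerprinted:
  fixes p f b l L M :: real and T :: "'a set \<Rightarrow> 'a set"
  assumes "finite A" "0 \<le> p" "p \<le> 1" "0 < l" "l \<le> 1" "1 \<le> L"
    and T: "\<And>F. T F \<subseteq> A" "\<And>F. F \<subseteq> A \<Longrightarrow> card (T F) \<le> M"
    and Y: "\<And>Y. Y \<in> \<Y> \<Longrightarrow>
      Y \<subseteq> A \<and> (\<exists>F\<subseteq>Y. card F \<le> f \<and> Y - F \<subseteq> T F \<and> b \<le> card (Y - F))"
  shows "measure_pmf.prob (bernoulli_subset A p) {R. \<exists>Y\<in>\<Y>. Y \<subseteq> R}
    \<le> (l powr (-f) * exp (l * p * card A)) * (L powr (-b) * exp (L * p * M))"
proof -
  define \<F> where "\<F> = {F. F \<subseteq> A \<and> real (card F) \<le> f}"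
  define \<B> where "\<B> = (\<lambda>F. {B. B \<subseteq> T F \<and> b \<le> real (card B)})"
  \<comment> \<open>Disjointness makes the probability of \<open>F \<union> B \<subseteq> R\<close>
    factor exactly; it is dropped again when the sum is enlarged to a product form.\<close>
  define \<C> where "\<C> = {(F, B). F \<in> \<F> \<and> B \<in> \<B> F \<and> F \<inter> B = {}}"
  have fT: "finite (T F)" for F using T(1) assms(1) finite_subset by blast
  have fF: "finite \<F>" unfolding \<F>_def using assms(1) by auto
  have fB: "finite (\<B> F)" for F unfolding \<B>_def using fT by auto
  have fC: "finite \<C>"
    by (rule finite_subset[of _ "SIGMA F:\<F>. \<B> F"]) (auto simp: \<C>_def fF fB)
  have sub: "F \<union> B \<subseteq> A" "finite F" "finite B" "F \<inter> B = {}" if "(F, B) \<in> \<C>" for F B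
    using that T(1) assms(1) unfolding \<C>_def \<F>_def \<B>_def
    by (auto intro: finite_subset[OF _ assms(1)]) (use fT finite_subset in blast)
  have "measure_pmf.prob (bernoulli_subset A p) {R. \<exists>Y\<in>\<Y>. Y \<subseteq> R}
      \<le> measure_pmf.prob (bernoulli_subset A p) (\<Union>(F,B)\<in>\<C>. {R. F \<union> B \<subseteq> R})"
  proof (rule measure_pmf.finite_measure_mono)
    show "{R. \<exists>Y\<in>\<Y>. Y \<subseteq> R} \<subseteq> (\<Union>(F,B)\<in>\<C>. {R. F \<union> B \<subseteq> R})"
    proof safe
      fix R Y assume "Y \<in> \<Y>" "Y \<subseteq> R"
      from Y[OF \<open>Y \<in> \<Y>\<close>] obtain F where
        "Y \<subseteq> A" "F \<subseteq> Y" "card F \<le> f" "Y - F \<subseteq> T F" "b \<le> card (Y - F)"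
        by auto
      then have "(F, Y - F) \<in> \<C>" unfolding \<C>_def \<F>_def \<B>_def by auto
      moreover have "R \<in> {R. F \<union> (Y - F) \<subseteq> R}" using \<open>F \<subseteq> Y\<close> \<open>Y \<subseteq> R\<close> by auto
      ultimately show "R \<in> (\<Union>(F,B)\<in>\<C>. {R. F \<union> B \<subseteq> R})"
        by (intro UN_I[of "(F, Y - F)"]) auto
    qed
  qed auto
  also have "\<dots> \<le> (\<Sum>(F,B)\<in>\<C>. measure_pmf.prob (bernoulli_subset A p) {R. F \<union> B \<subseteq> R})"
    using measure_pmf.finite_measure_subadditive_finite[OF fC, of "\<lambda>(F,B). {R. F \<union> B \<subseteq> R}"]
    by (simp add: case_prod_unfold)
  also have "\<dots> = (\<Sum>(F,B)\<in>\<C>. p ^ card F * p ^ card B)"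
  proof (rule sum.cong[OF refl], clarify)
    fix F B assume FB: "(F, B) \<in> \<C>"
    show "measure_pmf.prob (bernoulli_subset A p) {R. F \<union> B \<subseteq> R} = p ^ card F * p ^ card B"
      using sub[OF FB] assms(1-3)
      by (subst prob_superset_bernoulli_subset) (auto simp: card_Un_disjoint power_add)
  qed
  also have "\<dots> \<le> (\<Sum>(F,B)\<in>(SIGMA F:\<F>. \<B> F). p ^ card F * p ^ card B)"
    using assms(2) by (intro sum_mono2) (auto simp: \<C>_def fF fB)
  also have "\<dots> = (\<Sum>F\<in>\<F>. p ^ card F * (\<Sum>B\<in>\<B> F. p ^ card B))"
    using fF fB by (subst sum.Sigma[symmetric]) (auto simp: sum_distrib_left)
  also have "\<dots> \<le> (\<Sum>F\<in>\<F>. p ^ card F * (L powr (-b) * exp (L * p * M)))"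
  proof (intro sum_mono mult_left_mono)
    fix F assume "F \<in> \<F>"
    then have "real (card (T F)) \<le> M" using T(2) by (auto simp: \<F>_def)
    have "(\<Sum>B\<in>\<B> F. p ^ card B) \<le> L powr (-b) * exp (L * p * card (T F))"
      using assms fT by (intro sum_power_card_large) (auto simp: \<B>_def)
    also have "\<dots> \<le> L powr (-b) * exp (L * p * M)"
      using \<open>card (T F) \<le> M\<close> assms(2,6) by (auto intro!: mult_left_mono)
    finally show "(\<Sum>B\<in>\<B> F. p ^ card B) \<le> L powr (-b) * exp (L * p * M)" .
  qed (use assms(2) in auto)
  also have "\<dots> = (\<Sum>F\<in>\<F>. p ^ card F) * (L powr (-b) * exp (L * p * M))"
    by (simp add: sum_distrib_right)
  also have "\<dots> \<le> (l powr (-f) * exp (l * p * card A)) * (L powr (-b) * exp (L * p * M))"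
    using assms(1-6) by (intro mult_right_mono sum_power_card_small) (auto simp: \<F>_def)
  finally show ?thesis .
qed

text \<open>By Chebyshev's inequality; the covariances vanish except for the few intersecting pairs.\<close>
lemma prob_few_subsets:
  fixes q :: real
  assumes A: "finite A" and I: "finite I" and q: "0 < q" "q \<le> 1"
    and S: "\<And>a. a \<in> I \<Longrightarrow> S a \<subseteq> A \<and> card (S a) \<le> k"
    and B: "\<And>v. v \<in> A \<Longrightarrow> card {a\<in>I. v \<in> S a} \<le> B"
    and I0: "I \<noteq> {}"
  shows "measure_pmf.prob (bernoulli_subset A q)
      {W. card {a\<in>I. S a \<subseteq> W} < q ^ k * card I / 2} \<le> 4 * k * B / (card I * q ^ (2 * k))"
proof -
  let ?P = "measure_pmf (bernoulli_subset A q)"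
  define X where "X = (\<lambda>W. real (card {a\<in>I. S a \<subseteq> W}))"
  define \<mu> where "\<mu> = (\<Sum>a\<in>I. q ^ card (S a))"
  have Xs: "X W = (\<Sum>a\<in>I. indicator {W. S a \<subseteq> W} W)" for W
    using I by (simp add: X_def indicator_def sum.If_cases Int_def)
  have int[simp]: "integrable ?P h" for h :: "'a set \<Rightarrow> real" using A by simp
  have EX: "measure_pmf.expectation (bernoulli_subset A q) X = \<mu>"
    unfolding Xs \<mu>_def using S A q
    by (subst Bochner_Integration.integral_sum)
       (auto intro!: sum.cong simp: prob_superset_bernoulli_subset)
  have fS: "finite (S a)" if "a \<in> I" for a using S[OF that] A finite_subset by blast
  have EX2: "measure_pmf.expectation (bernoulli_subset A q) (\<lambda>W. (X W)\<^sup>2) =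
      (\<Sum>a\<in>I. \<Sum>b\<in>I. q ^ card (S a \<union> S b))"
  proof -
    have "measure_pmf.expectation (bernoulli_subset A q) (\<lambda>W. (X W)\<^sup>2) =
      measure_pmf.expectation (bernoulli_subset A q)
        (\<lambda>W. \<Sum>a\<in>I. \<Sum>b\<in>I. indicator {W. S a \<union> S b \<subseteq> W} W)"
      unfolding Xs power2_eq_square sum_product
      by (intro Bochner_Integration.integral_cong sum.cong refl) (auto simp: indicator_def)
    also have "\<dots> = (\<Sum>a\<in>I. \<Sum>b\<in>I. q ^ card (S a \<union> S b))"
      using S A q
      by (subst Bochner_Integration.integral_sum, simp,
          intro sum.cong refl, subst Bochner_Integration.integral_sum, simp)
         (intro sum.cong refl, subst Bochner_Integration.integral_indicator,
          auto simp: prob_superset_bernoulli_subset simp del: Un_subset_iff)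
    finally show ?thesis .
  qed
  have var: "measure_pmf.variance (bernoulli_subset A q) X \<le> card I * (k * B)"
  proof -
    have "measure_pmf.variance (bernoulli_subset A q) X =
        (\<Sum>a\<in>I. \<Sum>b\<in>I. q ^ card (S a \<union> S b) - q ^ card (S a) * q ^ card (S b))"
      by (subst measure_pmf.variance_eq)
         (auto simp: EX EX2 \<mu>_def power2_eq_square[of "sum _ _"] sum_product sum_subtractf)
    also have "\<dots> \<le> (\<Sum>a\<in>I. \<Sum>b\<in>I. if S a \<inter> S b = {} then 0 else 1)"
    proof (intro sum_mono)
      fix a b assume ab: "a \<in> I" "b \<in> I"
      show "q ^ card (S a \<union> S b) - q ^ card (S a) * q ^ card (S b)
          \<le> (if S a \<inter> S b = {} then 0 else 1)"
      proof (cases "S a \<inter> S b = {}")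
        case True
        then show ?thesis using fS ab by (simp add: card_Un_disjoint power_add)
      next
        case False
        have "q ^ card (S a \<union> S b) \<le> 1" "0 \<le> q ^ card (S a) * q ^ card (S b)"
          using q by (auto intro: power_le_one)
        then show ?thesis using False by auto
      qed
    qed
    also have "\<dots> \<le> (\<Sum>a\<in>I. real (k * B))"
    proof (intro sum_mono)
      fix a assume a: "a \<in> I"
      \<comment> \<open>A set \<open>S b\<close> that meets \<open>S a\<close> contains one of the
        at most \<open>k\<close> points of \<open>S a\<close>, and each point lies in at most
        \<open>B\<close> of the sets.\<close>
      have "(\<Sum>b\<in>I. if S a \<inter> S b = {} then 0 else (1::real)) = card {b\<in>I. S a \<inter> S b \<noteq> {}}"
        using I by (simp add: sum.If_cases Int_def)
      also have "{b\<in>I. S a \<inter> S b \<noteq> {}} = (\<Union>v\<in>S a. {b\<in>I. v \<in> S b})" by auto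
      also have "card \<dots> \<le> (\<Sum>v\<in>S a. card {b\<in>I. v \<in> S b})" using fS[OF a] by (rule card_UN_le)
      also have "\<dots> \<le> (\<Sum>v\<in>S a. B)" using S[OF a] B by (intro sum_mono) auto
      also have "\<dots> \<le> k * B" using S[OF a] by simp
      finally show "(\<Sum>b\<in>I. if S a \<inter> S b = {} then 0 else (1::real)) \<le> real (k * B)" by simp
    qed
    finally show ?thesis by simp
  qed
  have c: "card I > 0" using I I0 by auto
  have mu: "\<mu> \<ge> card I * q ^ k"
  proof -
    have "(\<Sum>a\<in>I. q ^ k) \<le> \<mu>" unfolding \<mu>_def
      using S q by (intro sum_mono power_decreasing) auto
    then show ?thesis by simp
  qed
  \<comment> \<open>Half of the lower bound for the mean, so that \<open>X W < e\<close> is a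
    deviation of at least \<open>e\<close>.\<close>
  define e where "e = q ^ k * card I / 2"
  have e: "e > 0" using c q by (simp add: e_def)
  have "measure_pmf.prob (bernoulli_subset A q) {W. X W < e}
      \<le> measure_pmf.prob (bernoulli_subset A q) {W \<in> space ?P. e \<le> \<bar>X W - \<mu>\<bar>}"
    using mu by (intro measure_pmf.finite_measure_mono) (auto simp: e_def abs_if field_simps)
  also have "\<dots> \<le> measure_pmf.variance (bernoulli_subset A q) X / e\<^sup>2"
    using measure_pmf.Chebyshev_inequality[of X "bernoulli_subset A q" e] e EX by simp
  also have "\<dots> \<le> card I * (k * B) / e\<^sup>2"
    using var e by (intro divide_right_mono) auto
  also have "\<dots> = 4 * k * B / (card I * q ^ (2 * k))"
    using c q by (simp add: e_def power2_eq_square power_mult field_simps power_mult_distrib)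
  finally show ?thesis by (simp add: X_def e_def)
qed

text \<open>Take a \<open>q\<close>-random subset \<open>W\<close> of \<open>A\<close> and add every
  vertex for which \<open>W\<close> is bad. The threshold \<open>4 * k * B / q ^ (2 * k + 1)\<close>
  makes each failure probability at most \<open>q\<close>, so \<open>W\<close> and the bad vertices
  contribute at most \<open>q * card A\<close> each in expectation, and some outcome does no worse
  than the mean.\<close>

lemma fingerprint_exists:
  fixes q :: real and I :: "'a \<Rightarrow> 'b set" and S :: "'a \<Rightarrow> 'b \<Rightarrow> 'a set"
  assumes A: "finite A" and q: "0 < q" "q \<le> 1"
    and I: "\<And>u. u \<in> A \<Longrightarrow> finite (I u) \<and> card (I u) > 0 \<and> card (I u) \<ge> 4 * k * B / q ^ (2 * k + 1)"
    and S: "\<And>u a. u \<in> A \<Longrightarrow> a \<in> I u \<Longrightarrow> S u a \<subseteq> A \<and> card (S u a) \<le> k"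
    and B: "\<And>u v. u \<in> A \<Longrightarrow> v \<in> A \<Longrightarrow> card {a\<in>I u. v \<in> S u a} \<le> B"
  shows "\<exists>F\<subseteq>A. card F \<le> 2 * q * card A \<and>
    (\<forall>u\<in>A - F. q ^ k * card (I u) / 2 \<le> card {a\<in>I u. S u a \<subseteq> F})"
proof -
  let ?P = "bernoulli_subset A q"
  define bad where "bad = (\<lambda>u. {W. card {a\<in>I u. S u a \<subseteq> W} < q ^ k * card (I u) / 2})"
  have bad: "measure_pmf.prob ?P (bad u) \<le> q" if u: "u \<in> A" for u
  proof -
    have "measure_pmf.prob ?P (bad u) \<le> 4 * real k * real B / (real (card (I u)) * q ^ (2 * k))"
      unfolding bad_def using I[OF u] S[OF u] B[OF u] A q
      by (intro prob_few_subsets) auto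
    also have "\<dots> \<le> q" using I[OF u] q by (simp add: field_simps)
    finally show ?thesis .
  qed
  define h where "h = (\<lambda>W. \<Sum>u\<in>A. indicator {W. {u} \<subseteq> W} W + indicator (bad u) W :: real)"
  have "measure_pmf.expectation ?P h =
     (\<Sum>u\<in>A. measure_pmf.prob ?P {W. {u} \<subseteq> W} + measure_pmf.prob ?P (bad u))"
    unfolding h_def using A
    by (subst Bochner_Integration.integral_sum) (auto simp: Bochner_Integration.integral_add)
  also have "\<dots> = (\<Sum>u\<in>A. q + measure_pmf.prob ?P (bad u))"
    using A q by (intro sum.cong refl) (subst prob_superset_bernoulli_subset, auto)
  also have "\<dots> \<le> (\<Sum>u\<in>A. q + q)" using bad by (intro sum_mono) auto
  finally have Eh: "measure_pmf.expectation ?P h \<le> 2 * q * card A" by (simp add: mult.commute)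
  have "\<exists>W\<in>set_pmf ?P. h W \<le> 2 * q * card A"
  proof (rule ccontr)
    assume "\<not> ?thesis"
    then have gt: "\<And>W. W \<in> set_pmf ?P \<Longrightarrow> h W > 2 * q * card A" by force
    have "measure_pmf.expectation ?P h > 2 * q * card A"
      using A gt by (intro measure_pmf.expectation_greater)
        (auto simp: AE_measure_pmf_iff)
    then show False using Eh by simp
  qed
  then obtain W where W: "W \<subseteq> A" "h W \<le> 2 * q * card A"
    using set_pmf_bernoulli_subset by blast
  define F where "F = W \<union> {u\<in>A. W \<in> bad u}"
  have fW: "finite W" using W A finite_subset by blast
  have "real (card F) \<le> card W + card {u\<in>A. W \<in> bad u}"
    unfolding F_def using card_Un_le by (metis of_nat_add of_nat_le_iff)
  also have "\<dots> = h W"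
  proof -
    have "h W = card (A \<inter> W) + card {u\<in>A. W \<in> bad u}"
      unfolding h_def using A
      by (simp add: sum.distrib indicator_def sum.If_cases Int_def)
    then show ?thesis using W by (simp add: Int_absorb1)
  qed
  finally have "card F \<le> 2 * q * card A" using W by simp
  moreover have "q ^ k * card (I u) / 2 \<le> card {a\<in>I u. S u a \<subseteq> F}" if u: "u \<in> A - F" for u
  proof -
    have "q ^ k * card (I u) / 2 \<le> card {a\<in>I u. S u a \<subseteq> W}"
      using u by (auto simp: F_def bad_def)
    also have "\<dots> \<le> card {a\<in>I u. S u a \<subseteq> F}"
      using I u by (auto simp: F_def intro!: card_mono)
    finally show ?thesis by simp
  qed
  moreover have "F \<subseteq> A" using W by (auto simp: F_def)
  ultimately show ?thesis by blast
qed

section \<open>Arithmetic progressions\<close>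

definition aps_meeting :: "nat \<Rightarrow> nat \<Rightarrow> nat \<Rightarrow> nat set \<Rightarrow> nat set set" where
  "aps_meeting N k i Y = {A \<in> arith_progs N k. i \<le> card (A \<inter> Y)}"

definition aps_at :: "nat \<Rightarrow> nat \<Rightarrow> nat \<Rightarrow> nat set \<Rightarrow> nat \<Rightarrow> nat set set" where
  "aps_at N k i Y u = {A \<in> aps_meeting N k i Y. u \<in> A}"

text \<open>Given \<open>U \<subseteq> R\<close>, a progression \<open>A\<close> lies in
  \<open>R\<close> with probability \<open>p ^ card (A - U)\<close>; this is the conditional mean
  minus the mean as a polynomial in \<open>p\<close>, and \<open>seeds_eq\<close> makes the
  translation.\<close>

definition gain :: "nat \<Rightarrow> nat \<Rightarrow> real \<Rightarrow> nat set \<Rightarrow> real" where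
  "gain N k p U = (\<Sum>A\<in>arith_progs N k. p ^ card (A - U) - p ^ k)"

section \<open>Progressions through one or two given points\<close>

lemma arith_progsD:
  assumes "A \<in> arith_progs N k"
  shows "A \<subseteq> {1..N}" "card A = k" "finite A"
  using assms by (auto simp: arith_progs_def intro: finite_subset)

lemma finite_arith_progs [simp]: "finite (arith_progs N k)"
  by (rule finite_subset[of _ "Pow {1..N}"]) (use arith_progsD(1) in blast, simp)

lemma finite_aps_meeting [simp]: "finite (aps_meeting N k i Y)"
  by (simp add: aps_meeting_def)

lemma finite_aps_at [simp]: "finite (aps_at N k i Y u)"
  by (simp add: aps_at_def)

lemma card_Int_add_card_Diff:
  "A \<in> arith_progs N k \<Longrightarrow> card (A \<inter> U) + card (A - U) = k"
  using arith_progsD[of A N k] by (metis card_Int_Diff)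

text \<open>The position of \<open>u\<close> and the difference determine the progression.\<close>

lemma card_aps_containing:
  assumes "2 \<le> k"
  shows "card {A \<in> arith_progs N k. u \<in> A} \<le> k * N"
proof -
  have "{A \<in> arith_progs N k. u \<in> A}
      \<subseteq> (\<lambda>(j, b). (\<lambda>i. (u - j * b) + i * b) ` {0..<k}) ` ({0..<k} \<times> {1..N})"
  proof
    fix A assume "A \<in> {A \<in> arith_progs N k. u \<in> A}"
    then obtain a b where A: "A \<subseteq> {1..N}" "b > 0" "A = (\<lambda>i. a + i * b) ` {0..<k}" "u \<in> A"
      by (auto simp: arith_progs_def)
    then obtain j where j: "j < k" "u = a + j * b" by auto
    have "a + 1 * b \<in> A" unfolding A(3) using assms by (intro imageI) auto
    then have "b \<le> N" using A(1) by auto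
    moreover have "A = (\<lambda>i. (u - j * b) + i * b) ` {0..<k}" using A(3) j by simp
    ultimately show "A \<in> (\<lambda>(j, b). (\<lambda>i. (u - j * b) + i * b) ` {0..<k}) ` ({0..<k} \<times> {1..N})"
      using j A(2) by (intro image_eqI[of _ _ "(j, b)"]) auto
  qed
  then have "card {A \<in> arith_progs N k. u \<in> A} \<le> card ({0..<k} \<times> {1..N})"
    by (rule surj_card_le[rotated]) auto
  then show ?thesis by simp
qed

text \<open>The positions of two distinct points fix the difference, and with it the
  progression.\<close>

lemma card_aps_containing2:
  assumes "u \<noteq> v"
  shows "card {A \<in> arith_progs N k. u \<in> A \<and> v \<in> A} \<le> k\<^sup>2"
proof -
  \<comment> \<open>Absolute values over the integers, since either point may come first.\<close>
  define d where "d = (\<lambda>i j. nat (\<bar>int v - int u\<bar> div \<bar>int j - int i\<bar>))"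
  have "{A \<in> arith_progs N k. u \<in> A \<and> v \<in> A}
      \<subseteq> (\<lambda>(i, j). (\<lambda>l. (u - i * d i j) + l * d i j) ` {0..<k}) ` ({0..<k} \<times> {0..<k})"
  proof
    fix A assume "A \<in> {A \<in> arith_progs N k. u \<in> A \<and> v \<in> A}"
    then obtain a b where A: "A = (\<lambda>i. a + i * b) ` {0..<k}" "u \<in> A" "v \<in> A"
      by (auto simp: arith_progs_def)
    then obtain i j where ij: "i < k" "u = a + i * b" "j < k" "v = a + j * b" by auto
    with assms have "i \<noteq> j" by auto
    have "\<bar>int v - int u\<bar> = \<bar>(int j - int i) * int b\<bar>"
      using ij by (simp add: algebra_simps)
    also have "\<dots> = \<bar>int j - int i\<bar> * int b" by (simp add: abs_mult)
    finally have "d i j = b" using \<open>i \<noteq> j\<close> by (simp add: d_def)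
    then have "A = (\<lambda>l. (u - i * d i j) + l * d i j) ` {0..<k}" using A(1) ij by simp
    then show "A \<in> (\<lambda>(i, j). (\<lambda>l. (u - i * d i j) + l * d i j) ` {0..<k}) ` ({0..<k} \<times> {0..<k})"
      using ij by (intro image_eqI[of _ _ "(i, j)"]) auto
  qed
  then have "card {A \<in> arith_progs N k. u \<in> A \<and> v \<in> A} \<le> card ({0..<k} \<times> {0..<k})"
    by (rule surj_card_le[rotated]) auto
  then show ?thesis by (simp add: power2_eq_square)
qed

text \<open>Differences up to \<open>n div (2 * k)\<close> fit on at least one side of
  \<open>u\<close>, which is then taken as the first or as the last term.\<close>

lemma card_aps_in_interval:
  assumes k: "2 \<le> k" and n: "n \<le> N" "4 * k \<le> n" and u: "u \<in> {1..n}"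
  shows "real n / (4 * k) \<le> card {A \<in> arith_progs N k. A \<subseteq> {1..n} \<and> u \<in> A}"
proof -
  define D where "D = n div (2 * k)"
  have kD: "2 * (k * D) \<le> n"
    using div_times_less_eq_dividend[of n "2*k"] by (simp add: D_def ac_simps)
  have inj_prog: "inj_on (\<lambda>i. a + i * b) {0..<k}" if "b > 0" for a b :: nat
    using that by (auto simp: inj_on_def)
  let ?T = "{A \<in> arith_progs N k. A \<subseteq> {1..n} \<and> u \<in> A}"
  have "D \<le> card ?T"
  proof (cases "u + (k - 1) * D \<le> n")
    case True
    define F where "F = (\<lambda>b. (\<lambda>i. u + i * b) ` {0..<k})"
    have le: "i * b \<le> (k - 1) * D" if "i < k" "b \<le> D" for i b
      using that by (intro mult_le_mono) auto
    have F: "F b \<in> ?T" if "b \<in> {1..D}" for b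
    proof -
      have "F b \<subseteq> {1..n}" using that u True le[of _ b] by (force simp: F_def)
      moreover have "card (F b) = k" unfolding F_def using that inj_prog by (simp add: card_image)
      moreover have "u \<in> F b" unfolding F_def using k by (intro image_eqI[of _ _ 0]) auto
      moreover have "F b \<subseteq> {1..N}" using calculation(1) n(1) by auto
      moreover have "0 < u" "0 < b" using u that by auto
      ultimately show ?thesis unfolding arith_progs_def F_def by blast
    qed
    \<comment> \<open>The extreme term of \<open>F b\<close> has to occur in \<open>F b'\<close>;
      used in both directions, this gives injectivity.\<close>
    have ord: "b \<le> b'" if "F b = F b'" "b' > 0" for b b'
    proof -
      have "u + (k - 1) * b \<in> F b" unfolding F_def using k by (intro imageI) auto
      with that(1) have "u + (k - 1) * b \<in> F b'" by simp
      then obtain i where "i < k" "(k - 1) * b = i * b'" unfolding F_def by fastforce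
      then have "(k - 1) * b \<le> (k - 1) * b'" using mult_le_mono1[of i "k - 1" b'] by linarith
      then show ?thesis using k by simp
    qed
    have "inj_on F {1..D}" by (intro inj_onI antisym) (auto intro: ord)
    then have "card {1..D} \<le> card ?T"
      by (rule card_inj_on_le) (use F in blast, simp)
    then show ?thesis by simp
  next
    case False
    have "(k - 1) * D \<le> k * D" by simp
    then have u': "(k - 1) * D < u" using False kD by linarith
    define F where "F = (\<lambda>b. (\<lambda>i. (u - (k - 1) * b) + i * b) ` {0..<k})"
    have F: "F b \<in> ?T" if b: "b \<in> {1..D}" for b
    proof -
      have le: "(k - 1) * b \<le> (k - 1) * D" using b by simp
      have i: "i * b \<le> (k - 1) * b" if "i < k" for i using that by (intro mult_le_mono1) auto
      have "F b \<subseteq> {1..u}"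
      proof
        fix x assume "x \<in> F b"
        then obtain j where "j < k" "x = (u - (k - 1) * b) + j * b" by (auto simp: F_def)
        then have "1 \<le> x" "x \<le> u" using i[of j] le u' by linarith+
        then show "x \<in> {1..u}" by simp
      qed
      then have "F b \<subseteq> {1..n}" using u by auto
      moreover have "card (F b) = k" unfolding F_def using b inj_prog by (simp add: card_image)
      moreover have "u \<in> F b" unfolding F_def
      proof (rule image_eqI[of _ _ "k - 1"])
        show "u = u - (k - 1) * b + (k - 1) * b" using le u' by linarith
      qed (use k in auto)
      moreover have "F b \<subseteq> {1..N}" using calculation(1) n(1) by auto
      moreover have "0 < u - (k - 1) * b" using le u' by linarith
      moreover have "0 < b" using b by simp
      ultimately show ?thesis unfolding arith_progs_def F_def by blast
    qed
    have ord: "b \<le> b'" if "F b = F b'" "b \<in> {1..D}" "b' \<in> {1..D}" for b b'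
    proof -
      have le: "(k - 1) * b \<le> (k - 1) * D" "(k - 1) * b' \<le> (k - 1) * D" using that by auto
      have "u - (k - 1) * b \<in> F b" unfolding F_def using k by (intro image_eqI[of _ _ 0]) auto
      with that(1) have "u - (k - 1) * b \<in> F b'" by simp
      then obtain i where "u - (k - 1) * b = u - (k - 1) * b' + i * b'"
        unfolding F_def by auto
      then have "(k - 1) * b \<le> (k - 1) * b'" using le u' by linarith
      then show ?thesis using k by simp
    qed
    have "inj_on F {1..D}" by (intro inj_onI antisym) (auto intro: ord)
    then have "card {1..D} \<le> card ?T"
      by (rule card_inj_on_le) (use F in blast, simp)
    then show ?thesis by simp
  qed
  moreover have "real n / (4 * k) \<le> D"
  proof -
    have "n < 2 * k * (D + 1)"
      unfolding D_def using k dividend_less_div_times[of "2 * k" n] by (simp add: algebra_simps)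
    then have "real n < real (2 * k * (D + 1))" by (simp only: of_nat_less_iff)
    moreover have "real (4 * k) \<le> n" using n(2) by (simp only: of_nat_le_iff)
    ultimately show ?thesis using k by (simp add: field_simps)
  qed
  ultimately show ?thesis by linarith
qed

section \<open>Progressions that meet a set in several points\<close>

lemma aps_meeting_mono: "Y \<subseteq> Z \<Longrightarrow> aps_meeting N k i Y \<subseteq> aps_meeting N k i Z"
proof -
  assume YZ: "Y \<subseteq> Z"
  have "card (A \<inter> Y) \<le> card (A \<inter> Z)" if "A \<in> arith_progs N k" for A
    using YZ arith_progsD(3)[OF that] by (intro card_mono) auto
  then show ?thesis unfolding aps_meeting_def by (blast intro: le_trans)
qed

lemma aps_meeting_antimono: "i \<le> j \<Longrightarrow> aps_meeting N k j Y \<subseteq> aps_meeting N k i Y"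
  by (auto simp: aps_meeting_def)

lemma card_aps_meeting_mono:
  "Y \<subseteq> Z \<Longrightarrow> card (aps_meeting N k i Y) \<le> card (aps_meeting N k i Z)"
  by (intro card_mono aps_meeting_mono) auto

lemma card_aps_meeting_2:
  assumes "finite Y"
  shows "card (aps_meeting N k 2 Y) \<le> k\<^sup>2 * (card Y)\<^sup>2"
proof -
  define P where "P = {z \<in> Y \<times> Y. fst z \<noteq> snd z}"
  let ?E = "\<lambda>z. {A \<in> arith_progs N k. fst z \<in> A \<and> snd z \<in> A}"
  have P: "finite P" "P \<subseteq> Y \<times> Y" using assms by (auto simp: P_def)
  have "aps_meeting N k 2 Y \<subseteq> (\<Union>z\<in>P. ?E z)"
  proof
    fix A assume A: "A \<in> aps_meeting N k 2 Y"
    then have "2 \<le> card (A \<inter> Y)" by (auto simp: aps_meeting_def)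
    then obtain T where T: "T \<subseteq> A \<inter> Y" "card T = 2" by (rule obtain_subset_with_card_n)
    then obtain u v where "T = {u, v}" "u \<noteq> v" by (auto simp: card_2_iff)
    then have "(u, v) \<in> P" "A \<in> ?E (u, v)" using A T by (auto simp: aps_meeting_def P_def)
    then show "A \<in> (\<Union>z\<in>P. ?E z)" by blast
  qed
  then have "card (aps_meeting N k 2 Y) \<le> card (\<Union>z\<in>P. ?E z)"
    by (intro card_mono) (simp_all add: P)
  also have "\<dots> \<le> (\<Sum>z\<in>P. card (?E z))"
    by (rule card_UN_le[OF P(1)])
  also have "\<dots> \<le> (\<Sum>z\<in>P. k\<^sup>2)"
    by (intro sum_mono card_aps_containing2) (simp add: P_def)
  also have "\<dots> \<le> (\<Sum>z\<in>Y \<times> Y. k\<^sup>2)"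
    using assms P by (intro sum_mono2) auto
  also have "\<dots> = k\<^sup>2 * (card Y)\<^sup>2"
    by (simp add: card_cartesian_product power2_eq_square)
  finally show ?thesis .
qed

lemma card_aps_meeting_le:
  assumes "finite Y" "2 \<le> i"
  shows "card (aps_meeting N k i Y) \<le> k\<^sup>2 * (card Y)\<^sup>2"
  by (rule le_trans[OF card_mono[OF finite_aps_meeting aps_meeting_antimono[OF assms(2)]]
      card_aps_meeting_2[OF assms(1)]])

lemma card_aps_at_other:
  assumes "finite Y" "u \<in> Y"
  shows "card (aps_at N k 2 Y u) \<le> k\<^sup>2 * card Y"
proof -
  have "aps_at N k 2 Y u \<subseteq> (\<Union>v\<in>Y - {u}. {A \<in> arith_progs N k. u \<in> A \<and> v \<in> A})"
  proof
    fix A assume A: "A \<in> aps_at N k 2 Y u"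
    then have "card (A \<inter> Y) \<ge> 2" by (auto simp: aps_meeting_def aps_at_def)
    then have "\<not> A \<inter> Y \<subseteq> {u}" using card_mono[of "{u}" "A \<inter> Y"] by auto
    then show "A \<in> (\<Union>v\<in>Y - {u}. {A \<in> arith_progs N k. u \<in> A \<and> v \<in> A})"
      using A by (auto simp: aps_meeting_def aps_at_def)
  qed
  then have "card (aps_at N k 2 Y u) \<le> card (\<Union>v\<in>Y - {u}. {A \<in> arith_progs N k. u \<in> A \<and> v \<in> A})"
    using assms by (intro card_mono) auto
  also have "\<dots> \<le> (\<Sum>v\<in>Y - {u}. card {A \<in> arith_progs N k. u \<in> A \<and> v \<in> A})"
    using assms by (intro card_UN_le) auto
  also have "\<dots> \<le> (\<Sum>v\<in>Y - {u}. k\<^sup>2)" by (intro sum_mono card_aps_containing2) auto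
  also have "\<dots> \<le> k\<^sup>2 * card Y" by (simp add: card_Diff1_le)
  finally show ?thesis .
qed

text \<open>Incidences are counted over all points of \<open>{1..N}\<close>, including those outside
  \<open>F\<close>: these are the potential candidates.\<close>

lemma sum_card_aps_at:
  "(\<Sum>v\<in>{1..N}. card (aps_at N k i F v)) = k * card (aps_meeting N k i F)"
proof -
  have "(\<Sum>v\<in>{1..N}. card (aps_at N k i F v))
      = (\<Sum>v\<in>{1..N}. \<Sum>A\<in>aps_meeting N k i F. if v \<in> A then 1 else 0)"
    by (intro sum.cong refl) (auto simp: aps_at_def sum.If_cases Int_def)
  also have "\<dots> = (\<Sum>A\<in>aps_meeting N k i F. \<Sum>v\<in>{1..N}. if v \<in> A then 1 else 0)"
    by (rule sum.swap)
  also have "\<dots> = (\<Sum>A\<in>aps_meeting N k i F. k)"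
  proof (intro sum.cong refl)
    fix A assume "A \<in> aps_meeting N k i F"
    then have "A \<in> arith_progs N k" by (simp add: aps_meeting_def)
    note arith_progsD[OF this]
    then have "{1..N} \<inter> A = A" by auto
    then show "(\<Sum>v\<in>{1..N}. if v \<in> A then 1 else 0) = k" using \<open>card A = k\<close>
      by (simp add: sum.If_cases)
  qed
  finally show ?thesis by simp
qed

section \<open>The gain as a sum over progressions, and bounds for it\<close>

lemma cond_mean_eq:
  fixes p :: real
  assumes "0 < p" "p < 1" "U \<subseteq> {1..N}"
  shows "cond_mean_aps N p k U = (\<Sum>A\<in>arith_progs N k. p ^ card (A - U))"
proof -
  let ?P = "bernoulli_subset {1..N} p"
  have prob: "measure_pmf.prob ?P {R. S \<subseteq> R} = p ^ card S" if "S \<subseteq> {1..N}" for S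
    using that assms by (intro prob_superset_bernoulli_subset) auto
  have pos: "measure_pmf.prob ?P {R. U \<subseteq> R} > 0" using prob[OF assms(3)] assms by simp
  then have ne: "set_pmf ?P \<inter> {R. U \<subseteq> R} \<noteq> {}"
    unfolding measure_pmf_zero_iff[symmetric] by simp
  have fin: "finite (set_pmf (cond_pmf ?P {R. U \<subseteq> R}))"
    using finite_set_pmf_bernoulli_subset[of "{1..N}" p] by (subst set_cond_pmf[OF ne]) simp
  have "cond_mean_aps N p k U = measure_pmf.expectation (cond_pmf ?P {R. U \<subseteq> R})
      (\<lambda>R. \<Sum>A\<in>arith_progs N k. indicator {R. A \<subseteq> R} R)"
    unfolding cond_mean_aps_def random_subset_eq
    by (intro Bochner_Integration.integral_cong refl)
       (simp add: num_aps_def indicator_def sum.If_cases Int_def)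
  also have "\<dots> = (\<Sum>A\<in>arith_progs N k. measure_pmf.prob (cond_pmf ?P {R. U \<subseteq> R}) {R. A \<subseteq> R})"
    using fin by (subst Bochner_Integration.integral_sum) (auto intro: integrable_measure_pmf_finite)
  also have "\<dots> = (\<Sum>A\<in>arith_progs N k. p ^ card (A - U))"
  proof (intro sum.cong refl)
    fix A assume A: "A \<in> arith_progs N k"
    have fU: "finite U" using assms(3) finite_subset by blast
    have "measure_pmf.prob (cond_pmf ?P {R. U \<subseteq> R}) {R. A \<subseteq> R} =
        measure_pmf.prob ?P ({R. U \<subseteq> R} \<inter> {R. A \<subseteq> R}) / measure_pmf.prob ?P {R. U \<subseteq> R}"
      unfolding cond_pmf.rep_eq[OF ne] using pos
      by (subst measure_uniform_measure) (auto simp: measure_pmf.emeasure_eq_measure)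
    also have "{R. U \<subseteq> R} \<inter> {R. A \<subseteq> R} = {R. U \<union> (A - U) \<subseteq> R}" by auto
    also have "measure_pmf.prob ?P \<dots> = p ^ card U * p ^ card (A - U)"
      using assms arith_progsD[OF A] fU
      by (subst prob) (auto simp: card_Un_disjoint power_add[symmetric] simp del: Un_Diff_cancel)
    also have "measure_pmf.prob ?P {R. U \<subseteq> R} = p ^ card U" using assms by (intro prob)
    finally show "measure_pmf.prob (cond_pmf ?P {R. U \<subseteq> R}) {R. A \<subseteq> R} = p ^ card (A - U)"
      using assms by simp
  qed
  finally show ?thesis .
qed

text \<open>The case \<open>U = {}\<close> of the previous formula, where the conditioning event is
  certain.\<close>

lemma mean_eq:
  fixes p :: real
  assumes "0 < p" "p < 1"
  shows "mean_aps N p k = (\<Sum>A\<in>arith_progs N k. p ^ k)"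
proof -
  have UNIV: "{R. {} \<subseteq> R} = UNIV" by simp
  have "cond_pmf (random_subset N p) {R. {} \<subseteq> R} = random_subset N p"
    unfolding UNIV by (intro pmf_eqI, subst pmf_cond) (simp_all add: set_pmf_not_empty)
  then have "mean_aps N p k = cond_mean_aps N p k {}"
    by (simp add: mean_aps_def cond_mean_aps_def)
  also have "\<dots> = (\<Sum>A\<in>arith_progs N k. p ^ card (A - {}))"
    using assms by (intro cond_mean_eq) auto
  finally show ?thesis by (simp add: arith_progsD)
qed

lemma seeds_eq:
  fixes p :: real
  assumes "0 < p" "p < 1"
  shows "seeds N p k t = {U. U \<subseteq> {1..N} \<and> t \<le> gain N k p U}"
  using assms by (auto simp: seeds_def gain_def cond_mean_eq mean_eq sum_subtractf)

lemma gain_mono: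
  fixes p :: real
  assumes "0 < p" "p < 1" "U \<subseteq> V"
  shows "gain N k p U \<le> gain N k p V"
  unfolding gain_def using assms
  by (intro sum_mono diff_right_mono power_decreasing card_mono) (auto dest: arith_progsD)

text \<open>A progression with one point in \<open>U\<close> gains at most
  \<open>p ^ (k - 1)\<close>, one with two or more gains at most 1, and few progressions are of
  either kind. This is the source of all lower bounds on the size of sets with large gain.\<close>

lemma gain_le:
  fixes p :: real
  assumes p: "0 < p" "p < 1" and U: "finite U" and k: "2 \<le> k"
  shows "gain N k p U \<le> real (card U * (k * N)) * p ^ (k - 1) + real (k\<^sup>2 * (card U)\<^sup>2)"
proof -
  let ?S1 = "\<Union>u\<in>U. {A \<in> arith_progs N k. u \<in> A}"
  have "gain N k p U \<le> (\<Sum>A\<in>arith_progs N k.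
      (if A \<in> ?S1 then p ^ (k - 1) else 0) + (if A \<in> aps_meeting N k 2 U then 1 else 0))"
    unfolding gain_def
  proof (intro sum_mono)
    fix A assume A: "A \<in> arith_progs N k"
    have c: "card (A \<inter> U) + card (A - U) = k" using card_Int_add_card_Diff[OF A] .
    have pk: "0 \<le> p ^ k" "p ^ card (A - U) \<le> 1" "0 \<le> p ^ (k - 1)" using p by (auto intro: power_le_one)
    consider "card (A \<inter> U) = 0" | "card (A \<inter> U) = 1" | "2 \<le> card (A \<inter> U)" by linarith
    then show "p ^ card (A - U) - p ^ k \<le>
      (if A \<in> ?S1 then p ^ (k - 1) else 0) + (if A \<in> aps_meeting N k 2 U then 1 else 0)"
    proof cases
      case 1
      then have "card (A - U) = k" using c by simp
      then show ?thesis using pk by auto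
    next
      case 2
      then have "card (A - U) = k - 1" using c by simp
      moreover have "A \<in> ?S1" using 2 A by (auto simp: card_1_singleton_iff)
      ultimately show ?thesis using pk by auto
    next
      case 3
      then have "A \<in> aps_meeting N k 2 U" using A by (simp add: aps_meeting_def)
      then show ?thesis using pk by auto
    qed
  qed
  also have "\<dots> = card ?S1 * p ^ (k - 1) + card (aps_meeting N k 2 U)"
  proof -
    have "arith_progs N k \<inter> {A. A \<in> ?S1} = ?S1"
      "arith_progs N k \<inter> {A. A \<in> aps_meeting N k 2 U} = aps_meeting N k 2 U"
      by (auto simp: aps_meeting_def)
    then show ?thesis by (simp only: sum.distrib sum.If_cases finite_arith_progs) simp
  qed
  also have "\<dots> \<le> real (card U * (k * N)) * p ^ (k - 1) + real (k\<^sup>2 * (card U)\<^sup>2)"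
  proof (intro add_mono mult_right_mono)
    have "card ?S1 \<le> (\<Sum>u\<in>U. card {A \<in> arith_progs N k. u \<in> A})"
      using U by (rule card_UN_le)
    also have "\<dots> \<le> (\<Sum>u\<in>U. k * N)" using k by (intro sum_mono card_aps_containing)
    also have "\<dots> = card U * (k * N)" by simp
    finally show "real (card ?S1) \<le> real (card U * (k * N))" by (simp only: of_nat_le_iff)
    show "real (card (aps_meeting N k 2 U)) \<le> real (k\<^sup>2 * (card U)\<^sup>2)"
      using card_aps_meeting_2[OF U, of N k] by (simp only: of_nat_le_iff)
  qed (use p in auto)
  finally show ?thesis .
qed

lemma gain_remove_le:
  fixes p :: real
  assumes p: "0 < p" "p < 1" and u: "u \<in> U"
  shows "gain N k p U - gain N k p (U - {u}) \<le> (\<Sum>A\<in>{A \<in> arith_progs N k. u \<in> A}. p ^ card (A - U))"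
proof -
  have "gain N k p U - gain N k p (U - {u}) =
      (\<Sum>A\<in>arith_progs N k. p ^ card (A - U) - p ^ card (A - (U - {u})))"
    by (simp add: gain_def sum_subtractf)
  also have "\<dots> \<le> (\<Sum>A\<in>arith_progs N k. if u \<in> A then p ^ card (A - U) else 0)"
  proof (intro sum_mono)
    fix A assume A: "A \<in> arith_progs N k"
    have "A - (U - {u}) = A - U" if "u \<notin> A" using that by auto
    then show "p ^ card (A - U) - p ^ card (A - (U - {u})) \<le> (if u \<in> A then p ^ card (A - U) else 0)"
      using p by auto
  qed
  also have "\<dots> = (\<Sum>A\<in>{A \<in> arith_progs N k. u \<in> A}. p ^ card (A - U))"
    by (simp add: sum.If_cases Int_def)
  finally show ?thesis .
qed

text \<open>Split by \<open>card (A \<inter> Y)\<close>, which is at least 1. The values 1 and 2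
  give terms that will be negligible; a value \<open>j \<ge> 3\<close> is covered by the summand
  \<open>i = j\<close>, so the remaining weight is expressed through the degrees.\<close>

lemma sum_weights_at_le:
  fixes p :: real
  assumes p: "0 < p" "p < 1" and Y: "finite Y" "u \<in> Y" and k: "2 \<le> k"
  shows "(\<Sum>A\<in>{A \<in> arith_progs N k. u \<in> A}. p ^ card (A - Y)) \<le>
    (k * N) * p ^ (k - 1) + (k\<^sup>2 * card Y) * p ^ (k - 2)
      + (\<Sum>i\<in>{3..k}. p ^ (k - i) * card (aps_at N k i Y u))"
proof -
  let ?S = "{A \<in> arith_progs N k. u \<in> A}"
  have "(\<Sum>A\<in>?S. p ^ card (A - Y)) \<le> (\<Sum>A\<in>?S. p ^ (k - 1) +
     (if 2 \<le> card (A \<inter> Y) then p ^ (k - 2) else 0) +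
     (\<Sum>i\<in>{3..k}. if i \<le> card (A \<inter> Y) then p ^ (k - i) else 0))"
  proof (intro sum_mono)
    fix A assume A: "A \<in> ?S"
    define j where "j = card (A \<inter> Y)"
    have c: "j + card (A - Y) = k" using card_Int_add_card_Diff[of A N k Y] A by (simp add: j_def)
    have "j \<noteq> 0" using A Y by (auto simp: j_def)
    have nn: "0 \<le> (\<Sum>i\<in>{3..k}. if i \<le> j then p ^ (k - i) else 0)"
      using p by (intro sum_nonneg) auto
    have cj: "card (A - Y) = k - j" using c by simp
    consider "j = 1" | "j = 2" | "3 \<le> j" using \<open>j \<noteq> 0\<close> by linarith
    then show "p ^ card (A - Y) \<le> p ^ (k - 1) +
     (if 2 \<le> card (A \<inter> Y) then p ^ (k - 2) else 0) +
     (\<Sum>i\<in>{3..k}. if i \<le> card (A \<inter> Y) then p ^ (k - i) else 0)"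
      unfolding j_def[symmetric] cj
    proof cases
      case 3
      have "p ^ (k - j) \<le> (\<Sum>i\<in>{3..k}. if i \<le> j then p ^ (k - i) else 0)"
        using p 3 c member_le_sum[of j "{3..k}" "\<lambda>i. if i \<le> j then p ^ (k - i) else 0"]
        by simp
      then show "p ^ (k - j) \<le> p ^ (k - 1) + (if 2 \<le> j then p ^ (k - 2) else 0) +
        (\<Sum>i\<in>{3..k}. if i \<le> j then p ^ (k - i) else 0)"
        using p by (intro add_increasing) auto
    qed (use p nn in auto)
  qed
  also have "\<dots> = card ?S * p ^ (k - 1) + card (aps_at N k 2 Y u) * p ^ (k - 2)
      + (\<Sum>i\<in>{3..k}. p ^ (k - i) * card (aps_at N k i Y u))"
  proof -
    have eq: "(\<Sum>A\<in>?S. if i \<le> card (A \<inter> Y) then x else 0) = real (card (aps_at N k i Y u)) * x" for i x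
    proof -
      have "?S \<inter> {A. i \<le> card (A \<inter> Y)} = aps_at N k i Y u" by (auto simp: aps_at_def aps_meeting_def)
      then show ?thesis by (simp add: sum.If_cases)
    qed
    show ?thesis
      by (simp only: sum.distrib eq sum.swap[of _ _ ?S]) (simp add: mult.commute)
  qed
  also have "\<dots> \<le> (k * N) * p ^ (k - 1) + (k\<^sup>2 * card Y) * p ^ (k - 2)
      + (\<Sum>i\<in>{3..k}. p ^ (k - i) * card (aps_at N k i Y u))"
    using card_aps_containing[OF k, of N u] card_aps_at_other[OF Y, of N k] p
    by (intro add_mono mult_right_mono) (auto simp flip: of_nat_mult of_nat_power)
  finally show ?thesis by simp
qed

section \<open>Counting spread sets\<close>

text \<open>The index \<open>i\<close> may differ from vertex to vertex. The bound \<open>D\<close>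
  makes the degrees large enough for the second moment argument; the ratio \<open>r\<close> controls
  how many vertices can have a comparable degree at level \<open>i - 1\<close>.\<close>

definition spread :: "nat \<Rightarrow> nat \<Rightarrow> real \<Rightarrow> real \<Rightarrow> real \<Rightarrow> nat set \<Rightarrow> bool" where
  "spread N k p r D Y \<longleftrightarrow> Y \<subseteq> {1..N} \<and>
     (\<forall>u\<in>Y. \<exists>i\<in>{3..k}. D \<le> card (aps_at N k i Y u) \<and>
        p * card (aps_meeting N k (i - 1) Y) \<le> r * card Y * card (aps_at N k i Y u))"

text \<open>By nestedness the union is a single level set, the one with the least admissible
  threshold.\<close>

lemma card_Union_nested_le:
  fixes L :: "nat \<Rightarrow> 'a set" and M :: real
  assumes anti: "\<And>d e. d \<le> e \<Longrightarrow> L e \<subseteq> L d" and M: "0 \<le> M"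
  shows "card (\<Union>{L d |d. real (card (L d)) \<le> M}) \<le> M"
proof (cases "\<exists>d. real (card (L d)) \<le> M")
  case True
  define d0 where "d0 = (LEAST d. real (card (L d)) \<le> M)"
  have d0: "real (card (L d0)) \<le> M" unfolding d0_def using True by (rule LeastI_ex)
  have "\<Union>{L d |d. real (card (L d)) \<le> M} = L d0"
  proof
    show "\<Union>{L d |d. real (card (L d)) \<le> M} \<subseteq> L d0"
    proof (rule Union_least)
      fix X assume "X \<in> {L d |d. real (card (L d)) \<le> M}"
      then obtain d where d: "X = L d" "real (card (L d)) \<le> M" by auto
      then have "d0 \<le> d" unfolding d0_def by (intro Least_le)
      then show "X \<subseteq> L d0" using anti d(1) by simp
    qed
  qed (use d0 in blast)
  then show ?thesis using d0 by simp
next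
  case False
  then have "{L d |d. real (card (L d)) \<le> M} = {}" by blast
  then show ?thesis using M by (simp only: Union_empty card.empty of_nat_0)
qed

text \<open>The degree threshold \<open>d\<close> that is relevant for \<open>Y\<close> is not determined by \<open>F\<close>; since the level sets
  are nested, all thresholds with small level sets can be admitted at once.\<close>
definition candidates :: "nat \<Rightarrow> nat \<Rightarrow> real \<Rightarrow> nat set \<Rightarrow> nat set" where
  "candidates N k M F = (\<Union>i\<in>{3..k}.
     \<Union>{{v\<in>{1..N}. d \<le> card (aps_at N k (i - 1) F v)} |d.
        real (card {v\<in>{1..N}. d \<le> card (aps_at N k (i - 1) F v)}) \<le> M})"

lemma candidates_subset: "candidates N k M F \<subseteq> {1..N}"
  by (auto simp: candidates_def)

lemma card_candidates_le:
  fixes M :: real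
  assumes "0 \<le> M"
  shows "card (candidates N k M F) \<le> k * M"
proof -
  let ?L = "\<lambda>i d. {v\<in>{1..N}. d \<le> card (aps_at N k (i - 1) F v)}"
  have "card (candidates N k M F) \<le> (\<Sum>i\<in>{3..k}. card (\<Union>{?L i d |d. real (card (?L i d)) \<le> M}))"
    unfolding candidates_def by (rule card_UN_le) simp
  then have "real (card (candidates N k M F)) \<le> (\<Sum>i\<in>{3..k}. real (card (\<Union>{?L i d |d. real (card (?L i d)) \<le> M})))"
    by (simp only: of_nat_sum[symmetric] of_nat_le_iff)
  also have "\<dots> \<le> (\<Sum>i\<in>{3..k}. M)"
    using assms by (intro sum_mono card_Union_nested_le) auto
  also have "\<dots> \<le> k * M" using assms by (auto intro!: mult_right_mono)
  finally show ?thesis .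
qed

text \<open>For \<open>u\<close> outside \<open>F\<close>, a fraction \<open>q ^ k / 2\<close> of
  the progressions counted at level \<open>i\<close> through \<open>u\<close> has at least
  \<open>i - 1\<close> points in \<open>F\<close>. So \<open>u\<close> has large degree at level
  \<open>i - 1\<close> with respect to \<open>F\<close>, and by Markov's inequality only few
  vertices do.\<close>

lemma spread_fingerprint:
  fixes p q r D :: real
  assumes k: "3 \<le> k" and p: "0 < p" "p < 1" and q: "0 < q" "q \<le> 1" and r: "0 < r"
    and D: "0 < D" "4 * real k * (real k)\<^sup>2 / q ^ (2 * k + 1) \<le> D"
    and Y: "spread N k p r D Y"
  shows "\<exists>F\<subseteq>Y. card F \<le> 2 * q * card Y \<and>
    Y - F \<subseteq> candidates N k (2 * real k * r * card Y / (p * q ^ k)) F"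
proof -
  have fY: "finite Y" using Y by (auto simp: spread_def intro: finite_subset)
  have "\<forall>u\<in>Y. \<exists>i. i \<in> {3..k} \<and> D \<le> card (aps_at N k i Y u) \<and>
        p * card (aps_meeting N k (i - 1) Y) \<le> r * card Y * card (aps_at N k i Y u)"
    using Y unfolding spread_def Bex_def by simp
  then obtain i where i_all: "\<forall>u\<in>Y. i u \<in> {3..k} \<and> D \<le> card (aps_at N k (i u) Y u) \<and>
        p * card (aps_meeting N k (i u - 1) Y) \<le> r * card Y * card (aps_at N k (i u) Y u)"
    by (rule bchoice[THEN exE])
  have i: "3 \<le> i u \<and> i u \<le> k \<and> D \<le> card (aps_at N k (i u) Y u) \<and>
        p * card (aps_meeting N k (i u - 1) Y) \<le> r * card Y * card (aps_at N k (i u) Y u)"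
    if "u \<in> Y" for u
    using bspec[OF i_all that] by simp
  have "\<exists>S. S \<subseteq> A \<inter> Y - {u} \<and> card S = i u - 1" if "u \<in> Y" "A \<in> aps_at N k (i u) Y u" for u A
  proof -
    have "finite (A \<inter> Y)" using fY by simp
    then have "card (A \<inter> Y - {u}) = card (A \<inter> Y) - 1" using that
      by (intro card_Diff_singleton) (auto simp: aps_at_def)
    moreover have "i u \<le> card (A \<inter> Y)" using that by (auto simp: aps_at_def aps_meeting_def)
    ultimately have "i u - 1 \<le> card (A \<inter> Y - {u})" by simp
    then obtain S where "S \<subseteq> A \<inter> Y - {u}" "card S = i u - 1" by (rule obtain_subset_with_card_n)
    then show ?thesis by blast
  qed
  note ex = this
  \<comment> \<open>\<open>u\<close> itself must not be used, since it may lie outside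
    \<open>F\<close>; this is why the level drops by one.\<close>
  define S where "S = (\<lambda>u A. SOME S. S \<subseteq> A \<inter> Y - {u} \<and> card S = i u - 1)"
  have S: "S u A \<subseteq> A \<inter> Y - {u} \<and> card (S u A) = i u - 1"
    if "u \<in> Y" "A \<in> aps_at N k (i u) Y u" for u A
    unfolding S_def by (rule someI_ex[OF ex[OF that]])
  have "\<exists>F\<subseteq>Y. card F \<le> 2 * q * card Y \<and>
    (\<forall>u\<in>Y - F. q ^ k * card (aps_at N k (i u) Y u) / 2 \<le> card {A\<in>aps_at N k (i u) Y u. S u A \<subseteq> F})"
  \<comment> \<open>A point \<open>v\<close> in some \<open>S u A\<close> differs from
    \<open>u\<close>, so at most \<open>k\<^sup>2\<close> progressions \<open>A\<close> contain
    both.\<close>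
  proof (rule fingerprint_exists[where B = "k\<^sup>2"])
    fix u assume u: "u \<in> Y"
    have "4 * real k * real (k\<^sup>2) / q ^ (2 * k + 1) \<le> card (aps_at N k (i u) Y u)"
      using i[OF u] D by simp
    moreover have "card (aps_at N k (i u) Y u) > 0" using i[OF u] D(1) by linarith
    ultimately show "finite (aps_at N k (i u) Y u) \<and> 0 < card (aps_at N k (i u) Y u) \<and>
        4 * real k * real (k\<^sup>2) / q ^ (2 * k + 1) \<le> card (aps_at N k (i u) Y u)" by simp
    show "S u A \<subseteq> Y \<and> card (S u A) \<le> k" if "A \<in> aps_at N k (i u) Y u" for A
      using S[OF u that] i[OF u] by auto
    show "card {A \<in> aps_at N k (i u) Y u. v \<in> S u A} \<le> k\<^sup>2" if "v \<in> Y" for v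
    proof (cases "v = u")
      case True
      then have "{A \<in> aps_at N k (i u) Y u. v \<in> S u A} = {}" using S[OF u] by blast
      then show ?thesis by (simp only: card.empty)
    next
      case False
      have "{A \<in> aps_at N k (i u) Y u. v \<in> S u A} \<subseteq> {A \<in> arith_progs N k. u \<in> A \<and> v \<in> A}"
        using S[OF u] by (auto simp: aps_at_def aps_meeting_def)
      then have "card {A \<in> aps_at N k (i u) Y u. v \<in> S u A} \<le> card {A \<in> arith_progs N k. u \<in> A \<and> v \<in> A}"
        by (intro card_mono) auto
      then show ?thesis using card_aps_containing2[of u v N k] False by auto
    qed
  qed (use fY q in auto)
  then obtain F where F: "F \<subseteq> Y" "card F \<le> 2 * q * card Y" and
    deg: "\<And>u. u \<in> Y - F \<Longrightarrow> q ^ k * card (aps_at N k (i u) Y u) / 2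
       \<le> card {A\<in>aps_at N k (i u) Y u. S u A \<subseteq> F}"
    by blast
  have "Y - F \<subseteq> candidates N k (2 * real k * r * card Y / (p * q ^ k)) F"
  proof
    fix u assume uF: "u \<in> Y - F"
    then have u: "u \<in> Y" by simp
    define j where "j = i u"
    define d where "d = card (aps_at N k (j - 1) F u)"
    let ?L = "{v\<in>{1..N}. d \<le> card (aps_at N k (j - 1) F v)}"
    have "{A\<in>aps_at N k j Y u. S u A \<subseteq> F} \<subseteq> aps_at N k (j - 1) F u"
    proof
      fix A assume A: "A \<in> {A\<in>aps_at N k j Y u. S u A \<subseteq> F}"
      then have "S u A \<subseteq> A \<inter> F" "card (S u A) = j - 1" using S[OF u, of A] by (auto simp: j_def)
      moreover have "finite (A \<inter> F)" using F fY finite_subset by blast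
      ultimately have "j - 1 \<le> card (A \<inter> F)" using card_mono[of "A \<inter> F" "S u A"] by simp
      then show "A \<in> aps_at N k (j - 1) F u" using A by (auto simp: aps_at_def aps_meeting_def)
    qed
    then have "card {A\<in>aps_at N k j Y u. S u A \<subseteq> F} \<le> d"
      unfolding d_def by (intro card_mono) auto
    then have dY: "q ^ k * card (aps_at N k j Y u) / 2 \<le> d" using deg[OF uF] by (simp add: j_def)
    moreover have "0 < q ^ k * card (aps_at N k j Y u) / 2" using i[OF u] D(1) q by (simp add: j_def)
    ultimately have d0: "0 < real d" by linarith
    \<comment> \<open>Markov's inequality for the degrees at level \<open>j - 1\<close>.\<close>
    have "card ?L * d \<le> (\<Sum>v\<in>?L. card (aps_at N k (j - 1) F v))"
      using sum_mono[of ?L "\<lambda>_. d" "\<lambda>v. card (aps_at N k (j - 1) F v)"] by simp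
    also have "\<dots> \<le> (\<Sum>v\<in>{1..N}. card (aps_at N k (j - 1) F v))" by (intro sum_mono2) auto
    also have "\<dots> = k * card (aps_meeting N k (j - 1) F)" by (rule sum_card_aps_at)
    also have "\<dots> \<le> k * card (aps_meeting N k (j - 1) Y)"
      using F by (intro mult_left_mono card_aps_meeting_mono) auto
    finally have "real (card ?L * d) \<le> real (k * card (aps_meeting N k (j - 1) Y))"
      by (simp only: of_nat_le_iff)
    then have "card ?L * real d \<le> k * (p * card (aps_meeting N k (j - 1) Y)) / p"
      using p by simp
    also have "\<dots> \<le> k * (r * card Y * card (aps_at N k j Y u)) / p"
      using i[OF u] p by (intro divide_right_mono mult_left_mono) (auto simp: j_def)
    also have "\<dots> = 2 * real k * r * card Y / (p * q ^ k) * (q ^ k * card (aps_at N k j Y u) / 2)"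
      using q by simp
    also have "\<dots> \<le> 2 * real k * r * card Y / (p * q ^ k) * d"
      using dY p q r by (intro mult_left_mono) auto
    finally have "card ?L \<le> 2 * real k * r * card Y / (p * q ^ k)"
      using d0 by (simp only: mult_le_cancel_right)
    moreover have "j \<in> {3..k}" using i[OF u] by (simp add: j_def)
    moreover have "u \<in> ?L" using u Y by (auto simp: d_def spread_def)
    ultimately show "u \<in> candidates N k (2 * real k * r * card Y / (p * q ^ k)) F"
      unfolding candidates_def by (intro UN_I[of j] UnionI[of ?L]) (simp_all, intro exI[of _ d], simp)
  qed
  with F show ?thesis by (intro exI[of _ F] conjI)
qed

text \<open>The tilts \<open>1 / h\<close> and \<open>1 / c\<close> are chosen to make both
  exponential factors at most \<open>exp s\<close>: the first because
  \<open>N * p / s \<le> h\<close>, the second because at most \<open>k * M\<close> candidates exist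
  and \<open>p * (k * M) / c = s\<close>. The assumption \<open>Cr\<close> says that the second tilt
  is at least 1.\<close>

lemma prob_contains_spread:
  fixes p q r D :: real
  assumes k: "3 \<le> k" and p: "0 < p" "p < 1" and q: "0 < q" "q \<le> 1 / 2" and r: "0 < r"
    and D: "0 < D" "4 * real k * (real k)\<^sup>2 / q ^ (2 * k + 1) \<le> D"
    and Cr: "2 * (real k)\<^sup>2 / q ^ k * r \<le> 1" and s: "0 < s"
  shows "measure_pmf.prob (bernoulli_subset {1..N} p) {R. \<exists>Y. spread N k p r D Y \<and> card Y = s \<and> Y \<subseteq> R}
    \<le> (exp 2 * max 1 (N * p / s) powr (2 * q) * (2 * (real k)\<^sup>2 / q ^ k * r) powr (1 - 2 * q)) ^ s"
proof -
  define M where "M = 2 * real k * r * s / (p * q ^ k)"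
  define c where "c = 2 * (real k)\<^sup>2 / q ^ k * r"
  define h where "h = max 1 (N * p / s)"
  have c: "0 < c" "c \<le> 1" using k q r Cr by (auto simp: c_def)
  have h: "1 \<le> h" by (simp add: h_def)
  have M: "0 \<le> M" using p q r by (simp add: M_def)
  have "measure_pmf.prob (bernoulli_subset {1..N} p) {R. \<exists>Y\<in>{Y. spread N k p r D Y \<and> card Y = s}. Y \<subseteq> R}
    \<le> ((1 / h) powr (-(2 * q * s)) * exp (1 / h * p * card {1..N})) *
      ((1 / c) powr (-((1 - 2 * q) * s)) * exp (1 / c * p * (k * M)))"
  proof (rule prob_contains_fingerprinted[where T = "candidates N k M"])
    fix Y assume "Y \<in> {Y. spread N k p r D Y \<and> card Y = s}"
    then have Y: "spread N k p r D Y" "card Y = s" by auto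
    have fY: "finite Y" using Y by (auto simp: spread_def intro: finite_subset)
    obtain F where F: "F \<subseteq> Y" "card F \<le> 2 * q * s" "Y - F \<subseteq> candidates N k M F"
      using spread_fingerprint[OF k p _ _ r D Y(1)] q Y(2) by (auto simp: M_def)
    have "card (Y - F) = s - card F" "card F \<le> s"
      using F(1) fY Y(2) card_mono by (auto simp: card_Diff_subset finite_subset)
    then have "real (card (Y - F)) = s - real (card F)" by simp
    also have "\<dots> \<ge> (1 - 2 * q) * s" using F(2) by (simp add: algebra_simps)
    finally show "Y \<subseteq> {1..N} \<and>
      (\<exists>F\<subseteq>Y. card F \<le> 2 * q * s \<and> Y - F \<subseteq> candidates N k M F \<and> (1 - 2 * q) * s \<le> card (Y - F))"
      using F Y by (auto simp: spread_def)
  next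
    show "candidates N k M F \<subseteq> {1..N}" for F by (rule candidates_subset)
    show "card (candidates N k M F) \<le> k * M" for F using M by (rule card_candidates_le)
  qed (use p h c in auto)
  also have "(1 / h) powr (-(2 * q * s)) = (h powr (2 * q)) ^ s"
    using h by (simp add: powr_divide powr_minus powr_powr[symmetric] powr_realpow)
  also have "(1 / c) powr (-((1 - 2 * q) * s)) = (c powr (1 - 2 * q)) ^ s"
    using c by (simp add: powr_divide powr_minus powr_powr[symmetric] powr_realpow)
  also have "1 / c * p * (k * M) = s"
    using p q r k by (simp add: c_def M_def power2_eq_square)
  also have "exp (1 / h * p * card {1..N}) \<le> exp s"
  proof -
    have "N * p / s \<le> h" by (simp add: h_def)
    then have "1 / h * p * card {1..N} \<le> s" using h s by (simp add: field_simps)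
    then show ?thesis by simp
  qed
  finally have "measure_pmf.prob (bernoulli_subset {1..N} p) {R. \<exists>Y\<in>{Y. spread N k p r D Y \<and> card Y = s}. Y \<subseteq> R}
    \<le> ((h powr (2 * q)) ^ s * exp s) * ((c powr (1 - 2 * q)) ^ s * exp s)"
    using h c by (simp add: mult_left_mono mult_right_mono)
  also have "\<dots> = (exp 2 * h powr (2 * q) * c powr (1 - 2 * q)) ^ s"
  proof -
    have "exp (real s) * exp (real s) = exp 2 ^ s"
      by (simp add: exp_add[symmetric] exp_of_nat_mult[symmetric])
    then show ?thesis by (simp add: power_mult_distrib)
  qed
  finally show ?thesis by (simp add: h_def c_def Bex_def conj_assoc)
qed

section \<open>Cores and dense subsets\<close>

lemma powr_one_minus_le:
  fixes x b :: real
  assumes "0 \<le> x" "x \<le> 1" "0 < b" "b \<le> 1"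
  shows "(1 - x) powr b \<le> 1 - b * x"
proof (cases "x = 1")
  case False
  \<comment> \<open>The weighted inequality of arithmetic and geometric means for
    \<open>1 - x\<close> and \<open>1\<close>.\<close>
  then have "(1 - x) powr b * 1 powr (1 - b) \<le> b * (1 - x) + (1 - b) * 1"
    using assms by (intro Youngs_inequality_0) auto
  then show ?thesis by (simp add: algebra_simps)
qed (use assms in auto)

lemma powr_diff_pred_ge:
  fixes b :: real
  assumes "1 \<le> s" "0 < b" "b \<le> 1"
  shows "real s powr b - real (s - 1) powr b \<ge> b * real s powr b / s"
proof -
  have "real (s - 1) = s * (1 - 1 / s)" using assms by (simp add: field_simps of_nat_diff)
  then have "real (s - 1) powr b = s powr b * (1 - 1 / s) powr b"
    using assms by (simp add: powr_mult)
  also have "\<dots> \<le> s powr b * (1 - b * (1 / s))"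
    using assms by (intro mult_left_mono powr_one_minus_le) (auto simp: field_simps)
  finally show ?thesis by (simp add: algebra_simps)
qed

lemma finite_maximizer:
  fixes f :: "'a \<Rightarrow> real"
  assumes "finite S" "S \<noteq> {}"
  obtains x where "x \<in> S" "\<And>y. y \<in> S \<Longrightarrow> f y \<le> f x"
proof -
  have "Max (f ` S) \<in> f ` S" using assms by (intro Max_in) auto
  then obtain x where x: "x \<in> S" "f x = Max (f ` S)" by auto
  show ?thesis using that[OF x(1)] x(2) assms by simp
qed

text \<open>Comparing the maximiser with \<open>U\<close> costs at most the full penalty
  \<open>e * t\<close>; comparing it with \<open>Y - {u}\<close> shows that \<open>u\<close>
  contributes at least the increment of the penalty. For small \<open>b\<close> that increment is
  close to \<open>e * b * t / card Y\<close>, with only \<open>(card Y / m) powr b\<close>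
  lost.\<close>

lemma core_exists:
  fixes p t e b :: real and m :: nat
  assumes p: "0 < p" "p < 1" and U: "finite U" "card U \<le> m" "t \<le> gain N k p U"
    and t: "0 < t" and e: "0 < e" and b: "0 < b" "b \<le> 1" and m: "0 < m"
  obtains Y where "Y \<subseteq> U" "(1 - e) * t \<le> gain N k p Y"
    "\<And>u. u \<in> Y \<Longrightarrow> e * b * (t / card Y) * (card Y / m) powr b
        \<le> (\<Sum>A\<in>{A \<in> arith_progs N k. u \<in> A}. p ^ card (A - Y))"
proof -
  define h where "h = (\<lambda>Y. gain N k p Y - e * t * (card Y / m) powr b)"
  obtain Y where Y: "Y \<in> Pow U" and max: "\<And>Z. Z \<in> Pow U \<Longrightarrow> h Z \<le> h Y"
    using finite_maximizer[of "Pow U" h] U(1) by auto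
  have fY: "finite Y" using Y U(1) finite_subset by blast
  show ?thesis
  proof (rule that[of Y])
    show "Y \<subseteq> U" using Y by simp
    have "(card U / m) powr b \<le> 1 powr b"
      using U(2) m b by (intro powr_mono2) auto
    then have "e * t * (card U / m) powr b \<le> e * t"
      using e t by (simp add: mult_left_le)
    moreover have "0 \<le> e * t * (card Y / m) powr b" using e t by simp
    moreover have "h U \<le> h Y" by (rule max) simp
    ultimately show "(1 - e) * t \<le> gain N k p Y"
      using U(3) by (simp add: h_def algebra_simps)
  next
    fix u assume u: "u \<in> Y"
    then have s: "1 \<le> card Y" using fY card_gt_0_iff[of Y] by auto
    have "h (Y - {u}) \<le> h Y" using Y by (intro max) auto
    moreover have "card (Y - {u}) = card Y - 1" using u fY by simp
    ultimately have "e * t * ((card Y / m) powr b - (real (card Y - 1) / m) powr b)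
        \<le> gain N k p Y - gain N k p (Y - {u})"
      by (simp add: h_def algebra_simps)
    moreover have "e * b * (t / card Y) * (card Y / m) powr b
        \<le> e * t * ((card Y / m) powr b - (real (card Y - 1) / m) powr b)"
    proof -
      have "e * t / m powr b * (b * card Y powr b / card Y)
          \<le> e * t / m powr b * (real (card Y) powr b - real (card Y - 1) powr b)"
        using powr_diff_pred_ge[OF s b] e t by (intro mult_left_mono) auto
      then show ?thesis using m by (simp add: powr_divide field_simps)
    qed
    ultimately show "e * b * (t / card Y) * (card Y / m) powr b
        \<le> (\<Sum>A\<in>{A \<in> arith_progs N k. u \<in> A}. p ^ card (A - Y))"
      using gain_remove_le[OF p u, of N k] by linarith
  qed
qed

text \<open>Progressions with one or two points in \<open>Y\<close> account for at most a quarter of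
  \<open>f\<close> each, so half of \<open>f\<close> is left for fewer than \<open>k\<close>
  levels.\<close>

lemma degree_pigeonhole:
  fixes p f :: real
  assumes p: "0 < p" "p < 1" and Y: "finite Y" "u \<in> Y" and k: "3 \<le> k"
    and f: "0 < f" "f \<le> (\<Sum>A\<in>{A \<in> arith_progs N k. u \<in> A}. p ^ card (A - Y))"
    and small: "4 * (k * N * p ^ (k - 1)) \<le> f" "4 * ((real k)\<^sup>2 * card Y * p ^ (k - 2)) \<le> f"
  shows "\<exists>i\<in>{3..k}. f / (2 * real k) \<le> p ^ (k - i) * card (aps_at N k i Y u)"
proof (rule ccontr)
  assume "\<not> ?thesis"
  then have lt: "\<And>i. i \<in> {3..k} \<Longrightarrow> p ^ (k - i) * card (aps_at N k i Y u) < f / (2 * real k)" by force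
  have "(\<Sum>i\<in>{3..k}. p ^ (k - i) * card (aps_at N k i Y u)) < (\<Sum>i\<in>{3..k}. f / (2 * real k))"
    using lt k by (intro sum_strict_mono) auto
  also have "\<dots> = real (k - 2) * (f / (2 * real k))" using k by (simp add: of_nat_diff)
  also have "\<dots> \<le> k * (f / (2 * real k))" using f by (intro mult_right_mono) auto
  also have "\<dots> = f / 2" using k by simp
  finally have "(\<Sum>i\<in>{3..k}. p ^ (k - i) * card (aps_at N k i Y u)) < f / 2" .
  moreover have "f \<le> (k * N) * p ^ (k - 1) + ((real k)\<^sup>2 * card Y) * p ^ (k - 2)
      + (\<Sum>i\<in>{3..k}. p ^ (k - i) * card (aps_at N k i Y u))"
    using sum_weights_at_le[OF p Y, of k N] k f(2) by simp
  ultimately show False using small by simp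
qed

text \<open>Level \<open>i - 1 \<ge> 2\<close> is bounded by the number of pairs, and
  \<open>p ^ (k - i)\<close> is simply dropped. The ratio is of order \<open>p * card Y / f\<close>,
  which is near \<open>p\<close> when \<open>f\<close> is near \<open>t / card Y\<close> and
  \<open>card Y\<close> near \<open>sqrt t\<close>.\<close>

lemma spread_small:
  fixes p f r D :: real
  assumes p: "0 < p" "p < 1" and Y: "Y \<subseteq> {1..N}" and k: "3 \<le> k" and f: "0 < f"
    and deg: "\<And>u. u \<in> Y \<Longrightarrow> \<exists>i\<in>{3..k}. f / (2 * real k) \<le> p ^ (k - i) * card (aps_at N k i Y u)"
    and D: "D \<le> f / (2 * real k)" and r: "0 \<le> r" "2 * real k ^ 3 * p * card Y \<le> r * f"
  shows "spread N k p r D Y"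
  unfolding spread_def
proof (intro conjI ballI Y)
  fix u assume u: "u \<in> Y"
  from deg[OF u] obtain i
    where i: "i \<in> {3..k}" "f / (2 * real k) \<le> p ^ (k - i) * card (aps_at N k i Y u)"
    by (rule bexE)
  have "p ^ (k - i) * card (aps_at N k i Y u) \<le> 1 * real (card (aps_at N k i Y u))"
    using p by (intro mult_right_mono power_le_one) auto
  then have d: "f / (2 * real k) \<le> card (aps_at N k i Y u)" using i by simp
  have fY: "finite Y" using Y finite_subset by blast
  have "2 \<le> i - 1" using i(1) by auto
  from card_aps_meeting_le[OF fY this, of N k]
  have "real (card (aps_meeting N k (i - 1) Y)) \<le> real (k\<^sup>2 * (card Y)\<^sup>2)" by (simp only: of_nat_le_iff)
  then have "p * card (aps_meeting N k (i - 1) Y) \<le> p * real (k\<^sup>2 * (card Y)\<^sup>2)"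
    using p by (intro mult_left_mono) auto
  also have "\<dots> = (2 * real k ^ 3 * p * card Y) * card Y / (2 * real k)"
    using k by (simp add: power2_eq_square power3_eq_cube)
  also have "\<dots> \<le> (r * f) * card Y / (2 * real k)"
    using r by (intro divide_right_mono mult_right_mono) auto
  also have "\<dots> = r * card Y * (f / (2 * real k))" by simp
  also have "\<dots> \<le> r * card Y * card (aps_at N k i Y u)"
    using d r by (intro mult_left_mono) auto
  finally show "\<exists>i\<in>{3..k}. D \<le> card (aps_at N k i Y u) \<and>
        p * card (aps_meeting N k (i - 1) Y) \<le> r * card Y * card (aps_at N k i Y u)"
    using i(1) d D by (intro bexI[of _ i]) auto
qed

text \<open>Going from level \<open>i\<close> to \<open>i - 1\<close> produces one more factor
  \<open>p\<close>, so the common factor \<open>p ^ (k - i)\<close> cancels between degree and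
  count; of the sparseness bound a single factor \<open>x\<close> is kept.\<close>

lemma spread_large:
  fixes p f r D t x :: real
  assumes p: "0 < p" "p < 1" and Y: "Y \<subseteq> {1..N}" and k: "3 \<le> k" and f: "0 < f" and t: "0 < t"
    and deg: "\<And>u. u \<in> Y \<Longrightarrow> \<exists>i\<in>{3..k}. f / (2 * real k) \<le> p ^ (k - i) * card (aps_at N k i Y u)"
    and x: "0 < x" "x \<le> 1"
    and sparse: "\<And>j. 2 \<le> j \<Longrightarrow> j < k \<Longrightarrow> p ^ (k - j) * card (aps_meeting N k j Y) \<le> t * x ^ (k - j)"
    and D: "D \<le> f / (2 * real k)" and r: "0 \<le> r" "2 * real k * t * x \<le> r * card Y * f"
  shows "spread N k p r D Y"
  unfolding spread_def
proof (intro conjI ballI Y)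
  fix u assume u: "u \<in> Y"
  from deg[OF u] obtain i
    where i: "i \<in> {3..k}" "f / (2 * real k) \<le> p ^ (k - i) * card (aps_at N k i Y u)"
    by (rule bexE)
  have "p ^ (k - i) * card (aps_at N k i Y u) \<le> 1 * real (card (aps_at N k i Y u))"
    using p by (intro mult_right_mono power_le_one) auto
  then have d: "f / (2 * real k) \<le> card (aps_at N k i Y u)" using i by simp
  have ki: "k - (i - 1) = Suc (k - i)" using i by auto
  have "p ^ (k - i) * (p * card (aps_meeting N k (i - 1) Y))
      = p ^ (k - (i - 1)) * card (aps_meeting N k (i - 1) Y)" unfolding ki by simp
  also have "\<dots> \<le> t * x ^ Suc (k - i)" using sparse[of "i - 1"] i unfolding ki by auto
  also have "\<dots> \<le> t * x"
    using x t power_decreasing[of 1 "Suc (k - i)" x] by (intro mult_left_mono) auto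
  also have "\<dots> = (2 * real k * t * x) / (2 * real k)" using k by simp
  also have "\<dots> \<le> (r * card Y * f) / (2 * real k)" using r by (intro divide_right_mono) auto
  also have "\<dots> = r * card Y * (f / (2 * real k))" by simp
  also have "\<dots> \<le> r * card Y * (p ^ (k - i) * card (aps_at N k i Y u))"
    using i r by (intro mult_left_mono) auto
  also have "\<dots> = p ^ (k - i) * (r * card Y * card (aps_at N k i Y u))" by simp
  finally have "p * card (aps_meeting N k (i - 1) Y) \<le> r * card Y * card (aps_at N k i Y u)"
    using p by (simp only: mult_le_cancel_left) auto
  then show "\<exists>i\<in>{3..k}. D \<le> card (aps_at N k i Y u) \<and>
        p * card (aps_meeting N k (i - 1) Y) \<le> r * card Y * card (aps_at N k i Y u)"
    using i(1) d D by (intro bexI[of _ i]) auto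
qed

section \<open>Dense subsets of sets that are not sparse\<close>

lemma card_aps_at_ge_diff:
  assumes "finite Y"
  shows "card (aps_meeting N k i Y) \<le> card (aps_meeting N k i (Y - {u})) + card (aps_at N k i Y u)"
proof -
  have "aps_meeting N k i Y \<subseteq> aps_meeting N k i (Y - {u}) \<union> aps_at N k i Y u"
  proof
    fix A assume A: "A \<in> aps_meeting N k i Y"
    have "A \<inter> (Y - {u}) = A \<inter> Y" if "u \<notin> A" using that by auto
    then show "A \<in> aps_meeting N k i (Y - {u}) \<union> aps_at N k i Y u"
      using A by (cases "u \<in> A") (auto simp: aps_meeting_def aps_at_def)
  qed
  then have "card (aps_meeting N k i Y) \<le> card (aps_meeting N k i (Y - {u}) \<union> aps_at N k i Y u)"
    by (intro card_mono) auto
  also have "\<dots> \<le> card (aps_meeting N k i (Y - {u})) + card (aps_at N k i Y u)"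
    by (rule card_Un_le)
  finally show ?thesis .
qed

lemma aps_meeting_empty: "1 \<le> i \<Longrightarrow> aps_meeting N k i {} = {}"
  by (auto simp: aps_meeting_def)

text \<open>The maximiser of \<open>n\<^sub>i(Y) w(|Y|) ^ (k - i)\<close> over \<open>Y\<close> and \<open>i\<close>, where \<open>n\<^sub>i(Y)\<close> is the number
  of progressions meeting \<open>Y\<close> in at least \<open>i\<close> points, is stable both under deleting
  a vertex and under passing from \<open>i\<close> to \<open>i - 1\<close>.\<close>
lemma dense_subset:
  fixes t :: real and w :: "nat \<Rightarrow> real"
  assumes U: "finite U" "card U \<le> m" and t: "0 < t" and m: "0 < m"
    and Y0: "Y0 \<subseteq> U" and i0: "3 \<le> i0" "i0 < k"
    and w_def: "w = (\<lambda>y::nat. (t / ((real k)\<^sup>2 * m * y)) powr (1 / real (k - 2)))"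
    and dense: "t < card (aps_meeting N k i0 Y0) * w (card Y0) ^ (k - i0)"
  obtains Y i where "Y \<subseteq> U" "3 \<le> i" "i < k"
    "t < card (aps_meeting N k i Y) * w (card Y) ^ (k - i)"
    "\<And>u. u \<in> Y \<Longrightarrow> card (aps_meeting N k i Y) \<le> real (k - 2) * card Y * card (aps_at N k i Y u)"
    "card (aps_meeting N k (i - 1) Y) * w (card Y) \<le> card (aps_meeting N k i Y)"
proof -
  define \<Phi> where "\<Phi> = (\<lambda>(Y, i). card (aps_meeting N k i Y) * w (card Y) ^ (k - i))"
  define \<theta> where "\<theta> = 1 / real (k - 2)"
  have th: "0 < \<theta>" "\<theta> \<le> 1" using i0 by (auto simp: \<theta>_def)
  have w: "w y = (t / ((real k)\<^sup>2 * m * y)) powr \<theta>" for y by (simp add: w_def \<theta>_def)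
  have fin: "finite (Pow U \<times> {3..<k})" and ne: "Pow U \<times> {3..<k} \<noteq> {}"
    using U(1) i0 by auto
  obtain z where z: "z \<in> Pow U \<times> {3..<k}" and max: "\<And>z'. z' \<in> Pow U \<times> {3..<k} \<Longrightarrow> \<Phi> z' \<le> \<Phi> z"
    by (rule finite_maximizer[OF fin ne, of \<Phi>]) blast
  obtain Y i where Yi: "z = (Y, i)" by (cases z)
  have YU: "Y \<subseteq> U" and i: "3 \<le> i" "i < k" using z Yi by auto
  define n where "n = real (card (aps_meeting N k i Y))"
  have fY: "finite Y" using YU U(1) finite_subset by blast
  have big: "t < n * w (card Y) ^ (k - i)"
    using max[of "(Y0, i0)"] Y0 i0 dense by (simp add: \<Phi>_def Yi n_def)
  have "Y \<noteq> {}"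
  proof
    assume "Y = {}"
    then have "n = 0" using i by (simp add: n_def aps_meeting_empty)
    then show False using big t by simp
  qed
  then have y: "1 \<le> card Y" using fY by (simp add: Suc_leI card_gt_0_iff)
  have wpos: "0 < w y" if "1 \<le> y" for y using that t m i by (simp add: w)
  have ym: "card Y \<le> m" using card_mono[OF U(1) YU] U(2) by linarith
  have deg: "n \<le> real (k - 2) * card Y * card (aps_at N k i Y u)" if u: "u \<in> Y" for u
  proof -
    define y where "y = card Y"
    define n' where "n' = real (card (aps_meeting N k i (Y - {u})))"
    have cy: "card (Y - {u}) = y - 1" using u fY by (simp add: y_def)
    have n0: "0 \<le> n" by (simp add: n_def)
    have "n' \<le> n * (1 - \<theta> * (1 / y))"
    \<comment> \<open>Here \<open>w (y - 1)\<close> would be \<open>w 0\<close>, which is 0 by the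
      convention for division and cannot be cancelled.\<close>
    proof (cases "y = 1")
      case True
      then have "Y - {u} = {}" using cy fY by (metis card_0_eq diff_self_eq_0 finite_Diff)
      then have "n' = 0" unfolding n'_def using i by (simp only: aps_meeting_empty) simp
      then show ?thesis using True th n0 by simp
    next
      case False
      then have y2: "2 \<le> y" using y by (simp add: y_def)
      define v where "v = (1 - 1 / real y) powr \<theta>"
      have "1 / real y \<le> 1" using y2 by simp
      then have v: "0 \<le> v" "v \<le> 1 - \<theta> * (1 / y)"
        using powr_one_minus_le[of "1 / y" \<theta>] th by (auto simp: v_def)
      have "\<theta> * (1 / y) \<ge> 0" using th by simp
      with v have v1: "v \<le> 1" by linarith
      have wy: "t / ((real k)\<^sup>2 * m * y) = t / ((real k)\<^sup>2 * m * real (y - 1)) * (1 - 1 / real y)"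
        using y2 by (simp add: of_nat_diff divide_simps)
      \<comment> \<open>Deleting a vertex raises the weight by the factor \<open>1 / v\<close>.
        Maximality then forces the count down by \<open>v ^ (k - i)\<close>, of which one factor
        \<open>v\<close> suffices.\<close>
      have wv: "w y = w (y - 1) * v"
        unfolding w v_def wy by (rule powr_mult)
      have "n' * w (y - 1) ^ (k - i) \<le> n * w y ^ (k - i)"
        using max[of "(Y - {u}, i)"] YU i by (auto simp: \<Phi>_def Yi n_def n'_def cy y_def)
      also have "\<dots> = (n * v ^ (k - i)) * w (y - 1) ^ (k - i)"
        by (simp add: wv power_mult_distrib)
      finally have "n' \<le> n * v ^ (k - i)"
        using wpos[of "y - 1"] y2 by (simp add: mult_le_cancel_right)
      also have "v ^ (k - i) \<le> v ^ 1" using v v1 i by (intro power_decreasing) auto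
      then have "n * v ^ (k - i) \<le> n * (1 - \<theta> * (1 / y))"
        using v n0 by (intro mult_left_mono) auto
      finally show ?thesis .
    qed
    moreover have "n \<le> n' + card (aps_at N k i Y u)"
      using card_aps_at_ge_diff[OF fY, of N k i u] by (simp add: n_def n'_def)
    ultimately have "n * \<theta> / y \<le> card (aps_at N k i Y u)" by (simp add: algebra_simps)
    then show ?thesis using y i by (simp add: \<theta>_def y_def field_simps)
  qed
  have desc: "card (aps_meeting N k (i - 1) Y) * w (card Y) \<le> n"
  proof -
    have ki: "k - (i - 1) = Suc (k - i)" using i by auto
    have "card (aps_meeting N k (i - 1) Y) * w (card Y) ^ (k - (i - 1)) \<le> n * w (card Y) ^ (k - i)"
    \<comment> \<open>Level 2 is outside the range of the maximisation. The normalisation of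
      \<open>w\<close> is made for it: the pair bound gives a weighted count of at most
      \<open>t * card Y / m \<le> t\<close>, which is below the maximum.\<close>
    proof (cases "i = 3")
      case True
      have n2: "real (card (aps_meeting N k 2 Y)) \<le> real (k\<^sup>2 * (card Y)\<^sup>2)"
        using card_aps_meeting_2[OF fY, of N k] by (simp only: of_nat_le_iff)
      have "w (card Y) ^ (k - 2) = w (card Y) powr real (k - 2)"
        using wpos[OF y] by (rule powr_realpow[symmetric])
      also have "\<dots> = t / ((real k)\<^sup>2 * m * card Y)"
        using t m y i by (simp add: w_def powr_powr)
      finally have "card (aps_meeting N k 2 Y) * w (card Y) ^ (k - 2)
          = card (aps_meeting N k 2 Y) * (t / ((real k)\<^sup>2 * m * card Y))" by simp
      also have "\<dots> \<le> real (k\<^sup>2 * (card Y)\<^sup>2) * (t / ((real k)\<^sup>2 * m * card Y))"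
        by (intro mult_right_mono n2) (use t in simp)
      also have "\<dots> = t * (card Y / m)" using y i by (simp add: power2_eq_square)
      also have "\<dots> \<le> t" using ym m t by (simp add: field_simps)
      finally show ?thesis using big True by simp
    next
      case False
      then have "(Y, i - 1) \<in> Pow U \<times> {3..<k}" using YU i by auto
      from max[OF this] show ?thesis by (simp add: \<Phi>_def Yi n_def)
    qed
    then have "(card (aps_meeting N k (i - 1) Y) * w (card Y)) * w (card Y) ^ (k - i)
        \<le> n * w (card Y) ^ (k - i)"
      unfolding ki by (simp add: mult.assoc)
    then show ?thesis using wpos[OF y] by (simp add: mult_le_cancel_right)
  qed
  show ?thesis
    using that[OF YU i] big deg desc by (simp add: n_def)
qed

section \<open>Intervals as seeds, and the completion of near-seeds\<close>

lemma card_aps_hitting_ge: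
  assumes k: "2 \<le> k" and n: "n \<le> N" "4 * k \<le> n" and I: "I \<subseteq> {1..n}"
  shows "real (card I) * n / (4 * (real k)\<^sup>2) \<le> card {A \<in> arith_progs N k. A \<subseteq> {1..n} \<and> A \<inter> I \<noteq> {}}"
proof -
  let ?T = "{A \<in> arith_progs N k. A \<subseteq> {1..n} \<and> A \<inter> I \<noteq> {}}"
  have fI: "finite I" using I finite_subset by blast
  have "real (card I) * (n / (4 * real k)) = (\<Sum>u\<in>I. n / (4 * real k))" by simp
  also have "\<dots> \<le> (\<Sum>u\<in>I. real (card {A \<in> arith_progs N k. A \<subseteq> {1..n} \<and> u \<in> A}))"
    using card_aps_in_interval[OF k n] I by (intro sum_mono) auto
  also have "\<dots> = (\<Sum>u\<in>I. \<Sum>A\<in>?T. if u \<in> A then 1 else 0)"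
    by (intro sum.cong refl) (auto simp: sum.If_cases intro!: arg_cong[where f=card])
  also have "\<dots> = (\<Sum>A\<in>?T. \<Sum>u\<in>I. if u \<in> A then 1 else 0)" by (rule sum.swap)
  also have "\<dots> \<le> (\<Sum>A\<in>?T. real k)"
  proof (intro sum_mono)
    fix A assume "A \<in> ?T"
    then have A: "A \<in> arith_progs N k" by simp
    have "card (I \<inter> A) \<le> card A" using arith_progsD[OF A] by (intro card_mono) auto
    then show "(\<Sum>u\<in>I. if u \<in> A then 1 else (0::real)) \<le> real k"
      using fI arith_progsD[OF A] by (simp add: sum.If_cases)
  qed
  finally have "real (card I) * (n / (4 * real k)) \<le> card ?T * real k" by simp
  then show ?thesis using k by (simp add: field_simps power2_eq_square)
qed

text \<open>Every progression inside the interval gains \<open>1 - p ^ k \<ge> 1 / 2\<close>. Hence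
  an interval with length of order \<open>sqrt t\<close>, if it fits, is a seed.\<close>

lemma gain_interval:
  fixes p :: real
  assumes p: "0 < p" "p \<le> 1 / 2" and k: "2 \<le> k" and n: "n \<le> N" "4 * k \<le> n"
  shows "(real n)\<^sup>2 / (8 * (real k)\<^sup>2) \<le> gain N k p {1..n}"
proof -
  let ?T = "{A \<in> arith_progs N k. A \<subseteq> {1..n} \<and> A \<inter> {1..n} \<noteq> {}}"
  have "(real n)\<^sup>2 / (8 * (real k)\<^sup>2) = real (card {1..n}) * n / (4 * (real k)\<^sup>2) * (1 / 2)"
    by (simp add: power2_eq_square)
  also have "\<dots> \<le> card ?T * (1 / 2)"
    using card_aps_hitting_ge[OF k n, of "{1..n}"] by (intro mult_right_mono) auto
  also have "\<dots> = (\<Sum>A\<in>?T. 1 / 2)" by simp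
  also have "\<dots> \<le> (\<Sum>A\<in>?T. p ^ card (A - {1..n}) - p ^ k)"
  proof (intro sum_mono)
    fix A assume "A \<in> ?T"
    then have e: "A - {1..n} = {}" by auto
    have "p ^ k \<le> p ^ 1" using p k by (intro power_decreasing) auto
    then show "1 / 2 \<le> p ^ card (A - {1..n}) - p ^ k" unfolding e using p by simp
  qed
  also have "\<dots> \<le> gain N k p {1..n}" unfolding gain_def
  proof (intro sum_mono2)
    fix A assume "A \<in> arith_progs N k - ?T"
    then have "card (A - {1..n}) \<le> k" using arith_progsD[of A N k] card_mono[of A "A - {1..n}"] by auto
    then show "0 \<le> p ^ card (A - {1..n}) - p ^ k" using p by (simp add: power_decreasing)
  qed auto
  finally show ?thesis .
qed

lemma card_residue_class_le:
  assumes "0 < (r::nat)"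
  shows "card {x \<in> {1..n}. x mod r = c} \<le> n div r + 1"
proof -
  have "inj_on (\<lambda>x. x div r) {x \<in> {1..n}. x mod r = c}"
    by (intro inj_onI) (metis (mono_tags, lifting) mem_Collect_eq mod_div_decomp)
  then have "card {x \<in> {1..n}. x mod r = c} \<le> card {0..n div r}"
    by (rule card_inj_on_le) (auto intro: div_le_mono)
  then show ?thesis by simp
qed

text \<open>Colour \<open>{1..n}\<close> by residues modulo \<open>r\<close>. Each progression not
  inside \<open>V\<close> has one of at most \<open>2 ^ r\<close> colour sets, so some set
  \<open>C\<close> of at most \<open>k\<close> colours occurs for a fraction
  \<open>1 / 2 ^ r\<close> of them. Adding all points with colours in \<open>C\<close> completes
  these progressions, at the cost of about a fraction \<open>k / r\<close> of the interval.\<close>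

lemma seed_completion:
  fixes p :: real
  assumes p: "0 < p" "p \<le> 1 / 2" and k: "2 \<le> k" and n: "n \<le> N" "4 * k \<le> n"
    and V: "V \<subseteq> {1..N}" and r: "0 < r"
  shows "\<exists>V'\<subseteq>{1..N}. card V' \<le> card V + k * (n div r + 1) \<and>
    gain N k p V + (real n - card V) * n / (8 * (real k)\<^sup>2 * 2 ^ r) \<le> gain N k p V'"
proof -
  define I where "I = {1..n} - V"
  define T where "T = {A \<in> arith_progs N k. A \<subseteq> {1..n} \<and> A \<inter> I \<noteq> {}}"
  define col where "col = (\<lambda>A. (\<lambda>x. x mod r) ` A)"
  have fT: "finite T" by (simp add: T_def)
  have fV: "finite V" using V finite_subset by blast
  have "real n - card V \<le> card I"
    using diff_card_le_card_Diff[OF fV, of "{1..n}"] by (simp add: I_def)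
  then have "(real n - card V) * n / (4 * (real k)\<^sup>2) \<le> real (card I) * n / (4 * (real k)\<^sup>2)"
    by (intro divide_right_mono mult_right_mono) auto
  also have "\<dots> \<le> card T" unfolding T_def using k n by (intro card_aps_hitting_ge) (auto simp: I_def)
  finally have "(real n - card V) * n / (4 * (real k)\<^sup>2) \<le> card T" .
  then obtain X where X: "X = (real n - card V) * n / (4 * (real k)\<^sup>2)" and T: "X \<le> card T"
    by blast
  have goal: "(real n - card V) * n / (8 * (real k)\<^sup>2 * 2 ^ r) = X / 2 ^ r * (1 / 2)"
    by (simp add: X)
  show ?thesis
  proof (cases "T = {}")
    case True
    then have "(real n - card V) * n / (8 * (real k)\<^sup>2 * 2 ^ r) \<le> 0"
      unfolding goal using T by (simp add: divide_nonpos_pos)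
    then show ?thesis using V by (intro exI[of _ V]) auto
  next
    case False
    have "\<exists>C\<in>col ` T. card T \<le> card {A \<in> T. col A = C} * 2 ^ r"
    proof (rule ccontr)
      assume "\<not> ?thesis"
      then have lt: "\<And>C. C \<in> col ` T \<Longrightarrow> card {A \<in> T. col A = C} * 2 ^ r < card T" by force
      have sub: "col ` T \<subseteq> Pow {..<r}" using r by (auto simp: col_def)
      have "card T * 2 ^ r = (\<Sum>C\<in>col ` T. card {A \<in> T. col A = C}) * 2 ^ r"
      proof -
        have "card T = (\<Sum>A\<in>T. 1)" by simp
        also have "\<dots> = (\<Sum>C\<in>col ` T. \<Sum>A\<in>{A \<in> T. col A = C}. 1)" using fT by (rule sum.image_gen)
        finally show ?thesis by simp
      qed
      also have "\<dots> < (\<Sum>C\<in>col ` T. card T)"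
        unfolding sum_distrib_right using lt False fT by (intro sum_strict_mono) auto
      also have "\<dots> \<le> 2 ^ r * card T"
        using card_mono[OF _ sub] by (simp add: card_Pow)
      finally show False by simp
    qed
    then obtain C where C: "C \<in> col ` T" "card T \<le> card {A \<in> T. col A = C} * 2 ^ r" by blast
    define B where "B = (\<Union>c\<in>C. {x \<in> {1..n}. x mod r = c})"
    let ?K = "{A \<in> T. col A = C}"
    have cC: "card C \<le> k" "finite C"
    proof -
      obtain A where A: "A \<in> T" "C = col A" using C(1) by blast
      then have "finite A" "card A = k" using arith_progsD[of A N k] by (auto simp: T_def)
      then show "card C \<le> k" "finite C" using A card_image_le[of A] by (auto simp: col_def)
    qed
    have "card B \<le> (\<Sum>c\<in>C. card {x \<in> {1..n}. x mod r = c})"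
      unfolding B_def using cC(2) by (rule card_UN_le)
    also have "\<dots> \<le> (\<Sum>c\<in>C. n div r + 1)" using r by (intro sum_mono card_residue_class_le)
    also have "\<dots> \<le> k * (n div r + 1)" using cC(1) by (simp only: sum_constant of_nat_id mult_le_mono1)
    finally have B: "card B \<le> k * (n div r + 1)" .
    have "(real n - card V) * n / (8 * (real k)\<^sup>2 * 2 ^ r) \<le> card T / 2 ^ r * (1 / 2)"
      unfolding goal using T by (intro mult_right_mono divide_right_mono) auto
    also have "\<dots> \<le> card ?K * (1 / 2)"
    proof -
      have "real (card T) \<le> real (card ?K * 2 ^ r)" using C(2) by (simp only: of_nat_le_iff)
      then show ?thesis by (simp add: field_simps)
    qed
    also have "\<dots> = (\<Sum>A\<in>?K. 1 / 2)" by simp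
    also have "\<dots> \<le> (\<Sum>A\<in>?K. p ^ card (A - (V \<union> B)) - p ^ card (A - V))"
    proof (intro sum_mono)
      fix A assume A: "A \<in> ?K"
      have "A \<subseteq> B"
      proof
        fix x assume "x \<in> A"
        then have "x mod r \<in> C" "x \<in> {1..n}" using A by (auto simp: col_def T_def)
        then show "x \<in> B" by (auto simp: B_def)
      qed
      then have 1: "A - (V \<union> B) = {}" by auto
      have "finite (A - V)" "A - V \<noteq> {}" using A arith_progsD[of A N k] by (auto simp: T_def I_def)
      then have "1 \<le> card (A - V)" by (simp add: Suc_leI card_gt_0_iff)
      then have "p ^ card (A - V) \<le> p ^ 1" using p by (intro power_decreasing) auto
      then show "1 / 2 \<le> p ^ card (A - (V \<union> B)) - p ^ card (A - V)" unfolding 1 using p by simp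
    qed
    also have "\<dots> \<le> (\<Sum>A\<in>arith_progs N k. p ^ card (A - (V \<union> B)) - p ^ card (A - V))"
    proof (intro sum_mono2)
      fix A assume A: "A \<in> arith_progs N k - ?K"
      then have "card (A - (V \<union> B)) \<le> card (A - V)"
        using arith_progsD(3)[of A N k] by (intro card_mono) auto
      then show "0 \<le> p ^ card (A - (V \<union> B)) - p ^ card (A - V)" using p by (simp add: power_decreasing)
    qed (auto simp: T_def)
    also have "\<dots> = gain N k p (V \<union> B) - gain N k p V"
      by (simp add: gain_def sum_subtractf)
    finally have "gain N k p V + (real n - card V) * n / (8 * (real k)\<^sup>2 * 2 ^ r) \<le> gain N k p (V \<union> B)"
      by simp
    moreover have "card (V \<union> B) \<le> card V + k * (n div r + 1)"
      using B card_Un_le[of V B] by linarith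
    moreover have "V \<union> B \<subseteq> {1..N}" using V n by (auto simp: B_def)
    ultimately show ?thesis by blast
  qed
qed

section \<open>Spread subsets of seeds\<close>

text \<open>Collects the fingerprint cost \<open>h\<close> and the candidate cost \<open>c\<close>
  into one power of \<open>x\<close>; since \<open>K\<close> and \<open>A\<close> are at least 1,
  their fractional powers are rounded up to 1.\<close>

lemma exponent_bookkeeping:
  fixes x h c K A a d q e :: real
  assumes x: "0 < x" "x \<le> 1" and h: "0 \<le> h" "h \<le> K * x powr (-a)" and K: "1 \<le> K"
    and c: "0 \<le> c" "c \<le> A * x powr d" and A: "1 \<le> A" and q: "0 < q" "q \<le> 1 / 2"
    and e: "e \<le> d * (1 - 2 * q) - 2 * a * q"
  shows "h powr (2 * q) * c powr (1 - 2 * q) \<le> K * A * x powr e"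
proof -
  have "h powr (2 * q) \<le> (K * x powr (-a)) powr (2 * q)"
    using h q by (intro powr_mono2) auto
  also have "\<dots> = K powr (2 * q) * x powr (- 2 * a * q)"
    using K x by (simp add: powr_mult powr_powr algebra_simps)
  also have "\<dots> \<le> K powr 1 * x powr (- 2 * a * q)"
    using K q by (intro mult_right_mono powr_mono) auto
  finally have 1: "h powr (2 * q) \<le> K * x powr (- 2 * a * q)" using K by simp
  have "c powr (1 - 2 * q) \<le> (A * x powr d) powr (1 - 2 * q)"
    using c q by (intro powr_mono2) auto
  also have "\<dots> = A powr (1 - 2 * q) * x powr (d * (1 - 2 * q))"
    using A x by (simp add: powr_mult powr_powr)
  also have "\<dots> \<le> A powr 1 * x powr (d * (1 - 2 * q))"
    using A q by (intro mult_right_mono powr_mono) auto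
  finally have 2: "c powr (1 - 2 * q) \<le> A * x powr (d * (1 - 2 * q))" using A by simp
  have "h powr (2 * q) * c powr (1 - 2 * q) \<le> (K * x powr (- 2 * a * q)) * (A * x powr (d * (1 - 2 * q)))"
    using 1 2 K by (intro mult_mono) auto
  also have "\<dots> = K * A * x powr (d * (1 - 2 * q) - 2 * a * q)"
    using x by (simp add: powr_add[symmetric])
  also have "\<dots> \<le> K * A * x powr e"
    using K A x e by (intro mult_left_mono powr_mono') auto
  finally show ?thesis .
qed

lemma power2_powr: "0 < x \<Longrightarrow> ((x::real) powr a)\<^sup>2 = x powr (2 * a)"
  by (simp add: power2_eq_square powr_add[symmetric])

text \<open>The asymptotic assumptions at one fixed \<open>N\<close>, with "much larger" read as
  larger by the factor \<open>w\<close>. The value of \<open>w\<close> is fixed at the end,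
  depending only on \<open>k\<close> and the accuracy.\<close>

locale sparse_regime =
  fixes N k m :: nat and p t w :: real
  assumes k: "3 \<le> k" and p: "0 < p" "p < 1" and t: "0 < t" and m: "0 < m" and w: "4 * (real k)\<^sup>2 \<le> w"
    and tm: "w * m \<le> t" and tN: "w * (m * (N * p ^ (k - 1))) \<le> t" and tmm: "w * ((real m)\<^sup>2 * p ^ (k - 2)) \<le> t"
begin

definition \<theta> :: real where "\<theta> = 1 / real (k - 2)"

text \<open>Large sets of size \<open>s\<close> turn out to be spread with a ratio \<open>r\<close> of order \<open>crit s powr (1 / 2)\<close>. This
  tends to 0 because \<open>crit m = (k\<^sup>2 m\<^sup>2 p\<^sup>k\<^sup>-\<^sup>2 / t) powr \<theta>\<close>.\<close>
definition crit :: "nat \<Rightarrow> real" where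
  "crit s = p * ((real k)\<^sup>2 * m * s / t) powr \<theta>"

lemma theta: "0 < \<theta>" "\<theta> \<le> 1" "real (k - 2) * \<theta> = 1"
  using k by (auto simp: \<theta>_def)

lemma w_ge: "1 \<le> w" "4 * real k \<le> w" "(real k)\<^sup>2 \<le> w"
proof -
  have "real k \<le> (real k)\<^sup>2" using k by (simp add: power2_eq_square)
  moreover have "3 \<le> real k" using k by simp
  ultimately show "1 \<le> w" "4 * real k \<le> w" "(real k)\<^sup>2 \<le> w" using w by linarith+
qed

lemma w_le_t: "w \<le> t"
proof -
  have "w * 1 \<le> w * m" using m w_ge by (intro mult_left_mono) auto
  then show ?thesis using tm by simp
qed

lemma gain_le_card:
  assumes U: "finite U" "card U \<le> m"
  shows "gain N k p U \<le> t / 4 + (real k)\<^sup>2 * (real (card U))\<^sup>2"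
proof -
  have "gain N k p U \<le> real (card U * (k * N)) * p ^ (k - 1) + real (k\<^sup>2 * (card U)\<^sup>2)"
    using gain_le[OF p U(1), of k N] k by simp
  moreover have "real (card U * (k * N)) * p ^ (k - 1) \<le> t / 4"
  proof -
    have "real (card U * (k * N)) * p ^ (k - 1) = real (card U) * (k * (N * p ^ (k - 1)))" by simp
    also have "\<dots> \<le> m * (k * (N * p ^ (k - 1)))"
      using U p by (intro mult_right_mono) auto
    also have "\<dots> = (4 * k) * (m * (N * p ^ (k - 1))) / 4" by simp
    also have "\<dots> \<le> w * (m * (N * p ^ (k - 1))) / 4"
      using w_ge p by (intro divide_right_mono mult_right_mono) auto
    finally show ?thesis using tN by simp
  qed
  ultimately show ?thesis by simp
qed

text \<open>Progressions with a single point in \<open>U\<close> supply at most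
  \<open>t / 4\<close>; the remaining \<open>t / 2\<close> must come from pairs.\<close>

lemma gain_large_imp_card:
  assumes "finite U" "card U \<le> m" "3 / 4 * t \<le> gain N k p U"
  shows "t \<le> 2 * (real k)\<^sup>2 * (real (card U))\<^sup>2"
  using gain_le_card[OF assms(1,2)] assms(3) by simp

text \<open>Bounds the price per vertex of choosing the fingerprint in \<open>{1..N}\<close>, using
  \<open>tN\<close>.\<close>

lemma free_ratio:
  assumes "0 < s"
  shows "N * p / s \<le> t / (m * s * p ^ (k - 2))"
proof -
  have kk: "k - 1 = Suc (k - 2)" using k by simp
  have "1 * (m * (N * p ^ (k - 1))) \<le> w * (m * (N * p ^ (k - 1)))"
    using w_ge p by (intro mult_right_mono) auto
  then have "m * (N * p ^ (k - 1)) \<le> t" using tN by simp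
  then have "N * p \<le> t / (m * p ^ (k - 2))"
    using m p unfolding kk by (simp add: field_simps)
  then have "N * p / s \<le> t / (m * p ^ (k - 2)) / s" by (intro divide_right_mono) auto
  then show ?thesis by (simp add: field_simps)
qed

lemma mm_le: "(real k)\<^sup>2 * ((real m)\<^sup>2 * p ^ (k - 2)) \<le> t"
proof -
  have "(real k)\<^sup>2 * ((real m)\<^sup>2 * p ^ (k - 2)) \<le> w * ((real m)\<^sup>2 * p ^ (k - 2))"
    using w_ge p by (intro mult_right_mono) auto
  then show ?thesis using tmm by simp
qed

lemma crit_pos: "1 \<le> s \<Longrightarrow> 0 < crit s"
  using p t m k by (simp add: crit_def)

lemma crit_power: "1 \<le> s \<Longrightarrow> crit s ^ (k - 2) = p ^ (k - 2) * ((real k)\<^sup>2 * m * s / t)"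
proof -
  assume s: "1 \<le> s"
  let ?z = "(real k)\<^sup>2 * m * s / t"
  have z: "0 < ?z" using s k t m by simp
  have "(?z powr \<theta>) ^ (k - 2) = (?z powr \<theta>) powr real (k - 2)"
    using z by (intro powr_realpow[symmetric]) (simp only: powr_gt_zero)
  also have "\<dots> = ?z powr (real (k - 2) * \<theta>)" by (simp only: powr_powr mult.commute)
  also have "\<dots> = ?z" unfolding theta(3) using z by (intro powr_one) (rule less_imp_le)
  finally show ?thesis by (simp add: crit_def power_mult_distrib)
qed

lemma crit_power_le:
  assumes s: "1 \<le> s" "s \<le> m"
  shows "crit s ^ (k - 2) \<le> (real k)\<^sup>2 / w" "crit s ^ (k - 2) \<le> s / m" "crit s \<le> 1"
proof -
  have e: "crit s ^ (k - 2) = (real k)\<^sup>2 * ((real m)\<^sup>2 * p ^ (k - 2)) / t * (s / m)"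
    using crit_power[OF s(1)] m by (simp add: power2_eq_square)
  also have "\<dots> \<le> 1 * (s / m)"
    using mm_le t by (intro mult_right_mono) auto
  finally show 1: "crit s ^ (k - 2) \<le> s / m" by simp
  also have "s / m \<le> 1" using s by (simp add: field_simps)
  finally have "crit s ^ (k - 2) \<le> 1" .
  then show "crit s \<le> 1"
    using crit_pos[OF s(1)] k by (metis one_less_power not_le zero_less_diff less_le_trans numeral_less_iff semiring_norm(77) less_numeral_extra(1) lessI numeral_3_eq_3 numeral_2_eq_2)
  have "(real k)\<^sup>2 * ((real m)\<^sup>2 * p ^ (k - 2)) / t * (s / m) \<le> (real k)\<^sup>2 / w * 1"
  proof (intro mult_mono)
    have "(real k)\<^sup>2 * (w * ((real m)\<^sup>2 * p ^ (k - 2))) \<le> (real k)\<^sup>2 * t"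
      using tmm by (intro mult_left_mono) auto
    then show "(real k)\<^sup>2 * ((real m)\<^sup>2 * p ^ (k - 2)) / t \<le> (real k)\<^sup>2 / w"
      using t w_ge by (simp add: field_simps)
  qed (use s w_ge in \<open>auto simp: field_simps\<close>)
  then show "crit s ^ (k - 2) \<le> (real k)\<^sup>2 / w" using e by simp
qed

text \<open>Both the fingerprint cost \<open>N * p / s\<close> and the penalty loss
  \<open>m / s\<close> are at most a fixed negative power of \<open>crit s\<close>, up to a
  constant; small exponents \<open>q\<close> and \<open>b\<close> therefore cost only a small power
  of \<open>crit s\<close>.\<close>

lemma crit_ratio:
  assumes s: "1 \<le> s" "s \<le> m"
  shows "N * p / s \<le> (real k)\<^sup>2 * crit s powr (- real (k - 2))" "m / s \<le> crit s powr (- real (k - 2))"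
proof -
  have e: "crit s powr (- real (k - 2)) = 1 / crit s ^ (k - 2)"
    using crit_pos[OF s(1)] by (simp add: powr_minus powr_realpow divide_inverse)
  have "t / (m * s * p ^ (k - 2)) = (real k)\<^sup>2 / crit s ^ (k - 2)"
    using t k p unfolding crit_power[OF s(1)] by (simp add: field_simps)
  then show "N * p / s \<le> (real k)\<^sup>2 * crit s powr (- real (k - 2))"
    using free_ratio[of s] s unfolding e by simp
  show "m / s \<le> crit s powr (- real (k - 2))"
    using crit_power_le(2)[OF s] crit_pos[OF s(1)] s m unfolding e by (simp add: field_simps)
qed

text \<open>Let \<open>s\<close> be the size of the core. Up to \<open>p powr (- g) * sqrt t\<close>
  the pair bound yields the first alternative. Beyond that, the core satisfies the second one if
  every weighted count \<open>p ^ (k - j) * card (aps_meeting N k j Y)\<close> is at most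
  \<open>t * crit s ^ (k - j)\<close>; a violated bound is exactly the input of
  \<open>dense_subset\<close>. Passing to that subset may reduce the exponent \<open>g\<close> in
  the size bound to \<open>g * \<theta>\<close>.\<close>

lemma spread_in_seed:
  fixes e b g D :: real
  assumes U: "U \<subseteq> {1..N}" "card U \<le> m" "t \<le> gain N k p U"
    and e: "0 < e" "e \<le> 1 / 4" and b: "0 < b" "real k * b \<le> 1 / 2" and g: "0 < g"
    and D: "0 < D" "2 * real k * D / (e * b) \<le> w" "(real k * D) ^ (k - 2) \<le> w"
    and w': "4 * (real k)\<^sup>2 / (e * b) \<le> w"
  obtains Y where "Y \<subseteq> U" "Y \<noteq> {}"
    "((1 - e) * t \<le> gain N k p Y \<and>
        spread N k p (4 * real k ^ 5 / (e * b) * p powr (1 - 2 * g - real k * b)) D Y) \<or>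
     (t * p powr (- g * \<theta>) \<le> (real k)\<^sup>2 * (real (card Y))\<^sup>2 \<and>
        spread N k p (2 * real k / (e * b) * crit (card Y) powr (1 / 2)) D Y)"
proof -
  have fU: "finite U" using U(1) finite_subset by blast
  have "1 * b \<le> real k * b" using k b by (intro mult_right_mono) auto
  then have b1: "b \<le> 1" using b(2) by linarith
  have eb: "0 < e * b" "e * b \<le> 1" using e b b1 by (auto intro: mult_le_one)
  obtain Y where Y: "Y \<subseteq> U" "(1 - e) * t \<le> gain N k p Y"
    and core: "\<And>u. u \<in> Y \<Longrightarrow> e * b * (t / card Y) * (card Y / m) powr b
        \<le> (\<Sum>A\<in>{A \<in> arith_progs N k. u \<in> A}. p ^ card (A - Y))"
    by (rule core_exists[OF p fU U(2,3) t e(1) b(1) b1 m]) blast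
  define s where "s = card Y"
  define f where "f = e * b * (t / s) * (s / m) powr b"
  have fY: "finite Y" using Y fU finite_subset by blast
  have YN: "Y \<subseteq> {1..N}" using Y U by blast
  have sm: "s \<le> m" using card_mono[OF fU Y(1)] U(2) by (simp add: s_def)
  have "(3 / 4) * t \<le> (1 - e) * t" using e t by (intro mult_right_mono) auto
  then have gY: "3 / 4 * t \<le> gain N k p Y" using Y(2) by simp
  have ts: "t \<le> 2 * (real k)\<^sup>2 * (real s)\<^sup>2"
    using gain_large_imp_card[OF fY _ gY] sm by (simp add: s_def)
  have "s \<noteq> 0"
  proof
    assume "s = 0" then show False using ts t by simp
  qed
  then have s: "1 \<le> s" by simp
  have Yne: "Y \<noteq> {}" using s by (auto simp: s_def)
  \<comment> \<open>A crude bound on \<open>f\<close> that does not involve \<open>s\<close>; it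
    suffices for all comparisons with \<open>w\<close>.\<close>
  have "s / m \<le> (s / m) powr b"
    using powr_mono'[of b 1 "s / m"] b b1 s sm m by simp
  then have "e * b * (t / s) * (s / m) \<le> f"
    unfolding f_def using eb t by (intro mult_left_mono) auto
  then have f_ge: "e * b * (t / m) \<le> f" using s by simp
  have tmw: "w \<le> t / m" using tm m by (simp add: field_simps)
  have f_w: "e * b * w \<le> f"
    using mult_left_mono[OF tmw, of "e * b"] eb f_ge by simp
  have fpos: "0 < f" using f_w eb w_ge by (meson less_le_trans mult_pos_pos zero_less_one)
  have ebw: "4 * (real k)\<^sup>2 \<le> e * b * w" using w' eb by (simp add: field_simps)
  have D_f: "D \<le> f / (2 * real k)"
  proof -
    have "2 * real k * D \<le> e * b * w" using D(2) eb by (simp add: field_simps)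
    then show ?thesis using f_w k by (simp add: field_simps)
  qed
  have deg: "\<exists>i\<in>{3..k}. f / (2 * real k) \<le> p ^ (k - i) * card (aps_at N k i Y u)" if u: "u \<in> Y" for u
  proof (rule degree_pigeonhole[OF p fY u k fpos])
    show "f \<le> (\<Sum>A\<in>{A \<in> arith_progs N k. u \<in> A}. p ^ card (A - Y))"
      using core[OF u] by (simp add: f_def s_def)
    have "4 * (k * (N * p ^ (k - 1))) * m * w = 4 * k * (w * (m * (N * p ^ (k - 1))))" by simp
    also have "\<dots> \<le> 4 * k * t" using tN by (intro mult_left_mono) auto
    also have "4 * k * t \<le> e * b * w * t"
    proof (intro mult_right_mono)
      have "1 * real k \<le> real k * real k" using k by (intro mult_right_mono) auto
      then show "real (4 * k) \<le> e * b * w" using ebw by (simp add: power2_eq_square)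
    qed (use t in simp)
    finally have "(4 * (k * (N * p ^ (k - 1))) * m) * w \<le> (e * b * t) * w" by (simp add: mult_ac)
    then have "4 * (k * (N * p ^ (k - 1))) * m \<le> e * b * t" using w_ge by simp
    then have "4 * (k * (N * p ^ (k - 1))) \<le> e * b * (t / m)" using m by (simp add: field_simps)
    then show "4 * (real k * real N * p ^ (k - 1)) \<le> f" using f_ge by (simp add: mult_ac)
    have "4 * ((real k)\<^sup>2 * m * p ^ (k - 2)) * m * w = 4 * (real k)\<^sup>2 * (w * ((real m)\<^sup>2 * p ^ (k - 2)))"
      by (simp add: power2_eq_square)
    also have "\<dots> \<le> 4 * (real k)\<^sup>2 * t" using tmm by (intro mult_left_mono) auto
    also have "\<dots> \<le> e * b * w * t" using ebw t by (intro mult_right_mono) auto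
    finally have "(4 * ((real k)\<^sup>2 * m * p ^ (k - 2)) * m) * w \<le> (e * b * t) * w" by (simp add: mult_ac)
    then have "4 * ((real k)\<^sup>2 * m * p ^ (k - 2)) * m \<le> e * b * t" using w_ge by simp
    then have "4 * ((real k)\<^sup>2 * m * p ^ (k - 2)) \<le> e * b * t / m"
      using m by (simp only: pos_le_divide_eq of_nat_0_less_iff)
    then have "4 * ((real k)\<^sup>2 * m * p ^ (k - 2)) \<le> f" using f_ge by simp
    moreover have "(real k)\<^sup>2 * card Y * p ^ (k - 2) \<le> (real k)\<^sup>2 * m * p ^ (k - 2)"
      using sm p by (intro mult_right_mono mult_left_mono) (auto simp: s_def)
    ultimately show "4 * ((real k)\<^sup>2 * real (card Y) * p ^ (k - 2)) \<le> f" by linarith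
  qed
  show ?thesis
  proof (cases "s \<le> p powr (- g) * sqrt t")
    case True
    let ?r = "4 * real k ^ 5 / (e * b) * p powr (1 - 2 * g - real k * b)"
    have "spread N k p ?r D Y"
    proof (rule spread_small[OF p YN k fpos deg D_f])
      show "0 \<le> ?r" using eb by simp
      have "(real s)\<^sup>2 \<le> (p powr (- g) * sqrt t)\<^sup>2" using True by (intro power_mono) auto
      also have "\<dots> = p powr (- 2 * g) * t"
        using t p by (simp add: power_mult_distrib power2_powr)
      finally have s2: "(real s)\<^sup>2 \<le> p powr (- 2 * g) * t" .
      \<comment> \<open>As \<open>s\<close> is at least of order \<open>sqrt t\<close>, the
        assumption \<open>tmm\<close> bounds \<open>m / s\<close> by a constant times
        \<open>p powr (- real k)\<close>, so the penalty costs only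
        \<open>p powr (- (real k * b))\<close>.\<close>
      have ms: "(m / s) powr b \<le> 2 * (real k)\<^sup>2 * p powr (- (real k * b))"
      proof -
        have "(real m)\<^sup>2 * p ^ (k - 2) \<le> t"
        proof -
          have "1 * ((real m)\<^sup>2 * p ^ (k - 2)) \<le> w * ((real m)\<^sup>2 * p ^ (k - 2))"
            using w_ge p by (intro mult_right_mono) auto
          then show ?thesis using tmm by simp
        qed
        also note ts
        finally have "(real m)\<^sup>2 \<le> 2 * (real k)\<^sup>2 * (real s)\<^sup>2 / p ^ (k - 2)"
          using p by (simp only: pos_le_divide_eq zero_less_power)
        then have "(real m)\<^sup>2 / (real s)\<^sup>2 \<le> 2 * (real k)\<^sup>2 * (real s)\<^sup>2 / p ^ (k - 2) / (real s)\<^sup>2"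
          by (intro divide_right_mono) auto
        then have "(m / s)\<^sup>2 \<le> 2 * (real k)\<^sup>2 * (1 / p ^ (k - 2))"
          using s by (simp add: power_divide)
        also have "\<dots> \<le> (2 * (real k)\<^sup>2)\<^sup>2 * (1 / p ^ k)\<^sup>2"
        proof (intro mult_mono)
          have "1 * 1 \<le> real k * real k" using k by (intro mult_mono) auto
          then have "1 \<le> 2 * (real k)\<^sup>2" unfolding power2_eq_square by linarith
          then show "2 * (real k)\<^sup>2 \<le> (2 * (real k)\<^sup>2)\<^sup>2" using self_le_power[of "2 * (real k)\<^sup>2" 2] by simp
          have "p ^ (2 * k) \<le> p ^ (k - 2)" using p by (intro power_decreasing) auto
          then show "1 / p ^ (k - 2) \<le> (1 / p ^ k)\<^sup>2"
            using p by (simp add: power_divide power_mult[symmetric] mult.commute frac_le)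
        qed (use p in auto)
        finally have "(m / s)\<^sup>2 \<le> (2 * (real k)\<^sup>2 * (1 / p ^ k))\<^sup>2" by (simp only: power_mult_distrib)
        then have "m / s \<le> 2 * (real k)\<^sup>2 * (1 / p ^ k)" by (rule power2_le_imp_le) (use p in auto)
        then have "(m / s) powr b \<le> (2 * (real k)\<^sup>2 * (1 / p ^ k)) powr b" using b by (intro powr_mono2) auto
        also have "1 / p ^ k = p powr (- real k)"
          using p by (simp add: powr_minus powr_realpow divide_inverse)
        also have "(2 * (real k)\<^sup>2 * p powr (- real k)) powr b = (2 * (real k)\<^sup>2) powr b * p powr (- (real k * b))"
          by (simp add: powr_mult powr_powr)
        also have "\<dots> \<le> (2 * (real k)\<^sup>2) powr 1 * p powr (- (real k * b))"
        proof (intro mult_right_mono powr_mono b1)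
          have "1 * 1 \<le> real k * real k" using k by (intro mult_mono) auto
          then show "1 \<le> 2 * (real k)\<^sup>2" unfolding power2_eq_square by linarith
        qed auto
        finally show ?thesis by simp
      qed
      \<comment> \<open>The factor \<open>(m / s) powr b * (s / m) powr b = 1\<close> is inserted to
        make \<open>f\<close> appear.\<close>
      have "2 * real k ^ 3 * p * card Y = 2 * real k ^ 3 * p * s * (((m / s) powr b) * (s / m) powr b)"
        using s m by (simp add: s_def powr_mult[symmetric])
      also have "\<dots> = (2 * real k ^ 3 / (e * b) * p * (real s)\<^sup>2 / t * (m / s) powr b) * f"
        using s e(1) b(1) t by (simp add: f_def power2_eq_square)
      also have "\<dots> \<le> (2 * real k ^ 3 / (e * b) * p * (p powr (- 2 * g) * t) / t * (2 * (real k)\<^sup>2 * p powr (- (real k * b)))) * f"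
        using s2 ms eb t p fpos by (intro mult_right_mono mult_mono divide_right_mono mult_left_mono) auto
      also have "\<dots> = (4 * real k ^ 5 / (e * b) * (p powr 1 * p powr (- 2 * g) * p powr (- (real k * b)))) * f"
        using t p by (simp add: eval_nat_numeral)
      also have "p powr 1 * p powr (- 2 * g) * p powr (- (real k * b)) = p powr (1 - 2 * g - real k * b)"
        by (simp only: powr_add[symmetric]) (simp add: algebra_simps)
      finally show "2 * real k ^ 3 * p * card Y \<le> ?r * f" .
    qed
    then show ?thesis using that[of Y] Y Yne by blast
  next
    case False
    then have s_big: "p powr (- g) * sqrt t < s" by simp
    let ?C = "2 * real k / (e * b)"
    have sq: "x \<le> x powr (1 / 2)" if "0 < x" "x \<le> 1" for x :: real
      using powr_mono'[of "1/2" 1 x] that by simp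
    show ?thesis
    proof (cases "\<forall>j. 2 \<le> j \<longrightarrow> j < k \<longrightarrow> p ^ (k - j) * card (aps_meeting N k j Y) \<le> t * crit s ^ (k - j)")
      case True
      have "spread N k p (?C * crit s powr (1 / 2)) D Y"
      proof (rule spread_large[OF p YN k fpos t deg crit_pos[OF s] crit_power_le(3)[OF s sm] _ D_f])
        show "p ^ (k - j) * card (aps_meeting N k j Y) \<le> t * crit s ^ (k - j)" if "2 \<le> j" "j < k" for j
          using True that by blast
        show "0 \<le> ?C * crit s powr (1 / 2)" using eb by simp
        have c: "0 < crit s" "crit s \<le> 1" using crit_pos crit_power_le s sm by auto
        \<comment> \<open>Since \<open>real k * b \<le> 1 / 2\<close>, the penalty consumes at most
          \<open>crit s powr (1 / 2)\<close>, and the other half of \<open>crit s\<close> is left as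
          the ratio.\<close>
        have "(m / s) powr b \<le> (crit s powr (- real (k - 2))) powr b"
          using crit_ratio(2)[OF s sm] b by (intro powr_mono2) auto
        also have "\<dots> = crit s powr (- (real (k - 2) * b))" by (simp add: powr_powr)
        also have "\<dots> \<le> crit s powr (- (1 / 2))"
        proof (intro powr_mono' c)
          have "real (k - 2) * b \<le> real k * b" using b by (intro mult_right_mono) auto
          then show "- (1 / 2) \<le> - (real (k - 2) * b)" using b by linarith
        qed (use c in auto)
        finally have mb: "(m / s) powr b * crit s \<le> crit s powr (- (1 / 2)) * crit s powr 1"
          using c by (simp add: mult_right_mono)
        also have "\<dots> = crit s powr (1 / 2)" by (simp only: powr_add[symmetric]) simp
        finally have mb: "(m / s) powr b * crit s \<le> crit s powr (1 / 2)" .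
        have "2 * real k * t * crit s = 2 * real k * t * crit s * (((m / s) powr b) * (s / m) powr b)"
          using s m by (simp add: powr_mult[symmetric])
        also have "\<dots> = ?C * ((m / s) powr b * crit s) * s * f"
          using s e(1) b(1) t by (simp add: f_def)
        also have "\<dots> \<le> ?C * crit s powr (1 / 2) * s * f"
          using mb eb fpos by (intro mult_right_mono mult_left_mono) auto
        finally show "2 * real k * t * crit s \<le> ?C * crit s powr (1 / 2) * card Y * f" by (simp add: s_def)
      qed
      moreover have "t * p powr (- g * \<theta>) \<le> (real k)\<^sup>2 * (real (card Y))\<^sup>2"
      proof -
        have "- g * \<theta> \<ge> - 2 * g" using theta g mult_left_mono[of \<theta> 2 g] by simp
        then have "t * p powr (- g * \<theta>) \<le> t * p powr (- 2 * g)"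
          using t p by (intro mult_left_mono powr_mono') auto
        also have "\<dots> = (p powr (- g) * sqrt t)\<^sup>2"
          using t p by (simp add: power_mult_distrib power2_powr)
        also have "\<dots> \<le> 1 * (real s)\<^sup>2" using s_big p t by (simp add: power_mono)
        also have "1 * (real s)\<^sup>2 \<le> (real k)\<^sup>2 * (real s)\<^sup>2"
          using k by (intro mult_right_mono one_le_power) auto
        finally show ?thesis by (simp add: s_def)
      qed
      ultimately show ?thesis using that[of Y] Y Yne by (auto simp: s_def)
    next
      case False
      then obtain j where j: "2 \<le> j" "j < k" "t * crit s ^ (k - j) < p ^ (k - j) * card (aps_meeting N k j Y)"
        by force
      define W where "W = (\<lambda>y::nat. (t / ((real k)\<^sup>2 * m * y)) powr (1 / real (k - 2)))"
      have Wpos: "0 < W y" if "1 \<le> y" for y using that t m k by (simp add: W_def)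
      \<comment> \<open>\<open>crit\<close> is \<open>p\<close> divided by the weight of
        \<open>dense_subset\<close>, so failure of sparseness and density are the same
        inequality.\<close>
      have Wcrit: "W y * crit y = p" if y: "1 \<le> y" for y
      proof -
        have "W y * crit y = p * (t / ((real k)\<^sup>2 * m * y) * ((real k)\<^sup>2 * m * y / t)) powr \<theta>"
          unfolding W_def crit_def \<theta>_def powr_mult by (simp only: mult_ac)
        also have "t / ((real k)\<^sup>2 * m * y) * ((real k)\<^sup>2 * m * y / t) = 1"
          using y t m k by simp
        finally show ?thesis by simp
      qed
      \<comment> \<open>\<open>crit\<close> is normalised by the pair bound:
        \<open>t * crit s ^ (k - 2)\<close> equals
        \<open>p ^ (k - 2) * (real k)\<^sup>2 * m * s\<close>, and \<open>s \<le> m\<close>.\<close>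
      have j2: "j \<noteq> 2"
      proof
        assume "j = 2"
        have "real (card (aps_meeting N k 2 Y)) \<le> real (k\<^sup>2 * (card Y)\<^sup>2)"
          using card_aps_meeting_2[OF fY, of N k] by (simp only: of_nat_le_iff)
        then have "p ^ (k - 2) * card (aps_meeting N k 2 Y) \<le> p ^ (k - 2) * ((real k)\<^sup>2 * (real s)\<^sup>2)"
          using p by (intro mult_left_mono) (auto simp: s_def)
        also have "\<dots> = p ^ (k - 2) * ((real k)\<^sup>2 * s) * s" by (simp add: power2_eq_square)
        also have "\<dots> \<le> p ^ (k - 2) * ((real k)\<^sup>2 * s) * m"
          using sm p by (intro mult_left_mono) auto
        also have "\<dots> = t * crit s ^ (k - 2)" using t by (simp add: crit_power[OF s])
        finally show False using j(3) \<open>j = 2\<close> by simp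
      qed
      have dense: "t < card (aps_meeting N k j Y) * W (card Y) ^ (k - j)"
      proof -
        have "t * crit s ^ (k - j) < (W s * crit s) ^ (k - j) * card (aps_meeting N k j Y)"
          using j(3) unfolding Wcrit[OF s] .
        then have "t * crit s ^ (k - j) < (card (aps_meeting N k j Y) * W s ^ (k - j)) * crit s ^ (k - j)"
          by (simp add: power_mult_distrib mult_ac)
        then show ?thesis using crit_pos[OF s] by (simp add: s_def mult_less_cancel_right)
      qed
      have cU: "card Y \<le> m" using sm by (simp add: s_def)
      have j3: "3 \<le> j" using j j2 by simp
      obtain Z i where Z: "Z \<subseteq> Y" and i: "3 \<le> i" "i < k"
        and big: "t < card (aps_meeting N k i Z) * W (card Z) ^ (k - i)"
        and dg: "\<And>u. u \<in> Z \<Longrightarrow>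
          card (aps_meeting N k i Z) \<le> real (k - 2) * card Z * card (aps_at N k i Z u)"
        and desc: "card (aps_meeting N k (i - 1) Z) * W (card Z) \<le> card (aps_meeting N k i Z)"
        by (rule dense_subset[OF fY cU t m subset_refl j3 j(2) W_def dense]) blast
      define z where "z = card Z"
      define n where "n = real (card (aps_meeting N k i Z))"
      have fZ: "finite Z" using Z fY finite_subset by blast
      have zm: "z \<le> m" using card_mono[OF fY Z] sm by (simp add: z_def s_def)
      have "Z \<noteq> {}"
      proof
        assume "Z = {}"
        then have "aps_meeting N k i Z = {}" using i by (simp add: aps_meeting_empty)
        then show False using big t by simp
      qed
      then have z: "1 \<le> z" using fZ card_gt_0_iff[of Z] by (auto simp: z_def)
      define X where "X = t / ((real k)\<^sup>2 * m * z)"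
      have X: "0 < X" using t k m z by (simp add: X_def)
      define \<alpha> where "\<alpha> = \<theta> * real (k - i)"
      have al: "\<theta> \<le> \<alpha>" "\<alpha> \<le> 1 - \<theta>"
      proof -
        have "\<theta> * 1 \<le> \<theta> * real (k - i)" using theta i by (intro mult_left_mono) auto
        then show "\<theta> \<le> \<alpha>" by (simp add: \<alpha>_def)
        have "\<theta> * real (k - i) \<le> \<theta> * (real (k - 2) - 1)"
          using theta i by (intro mult_left_mono) auto
        also have "\<dots> = real (k - 2) * \<theta> - \<theta>" by (simp only: right_diff_distrib mult_1_right mult.commute)
        finally show "\<alpha> \<le> 1 - \<theta>" unfolding \<alpha>_def theta(3) .
      qed
      have Wz: "W z ^ (k - i) = X powr \<alpha>"
      proof -
        have "W z ^ (k - i) = W z powr real (k - i)" using Wpos[OF z] by (rule powr_realpow[symmetric])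
        also have "\<dots> = X powr \<alpha>" by (simp add: W_def X_def \<alpha>_def \<theta>_def powr_powr)
        finally show ?thesis .
      qed
      have nX: "t < n * X powr \<alpha>" using big Wz by (simp add: n_def z_def)
      have "0 < n"
      proof (rule ccontr)
        assume "\<not> 0 < n"
        then have "n = 0" by (simp add: n_def)
        then show False using nX t by simp
      qed
      have deg': "D \<le> card (aps_at N k i Z u)" if u: "u \<in> Z" for u
      proof -
        \<comment> \<open>Density gives \<open>n > t * X powr (- \<alpha>)\<close>, and
          \<open>X \<le> t / z\<close>. So \<open>n / z\<close> exceeds
          \<open>(t / z) powr (1 - \<alpha>)\<close>, where
          \<open>1 - \<alpha> \<ge> \<theta>\<close> and \<open>t / z \<ge> w\<close>.\<close>
        have "w powr \<theta> \<le> n / z"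
        proof -
          have "w \<le> t / z"
          proof -
            have "w * z \<le> w * m" using zm w_ge by (intro mult_left_mono) auto
            then show ?thesis using tm z by (simp add: field_simps)
          qed
          have "w powr \<theta> \<le> (t / z) powr \<theta>" using \<open>w \<le> t / z\<close> w_ge theta by (intro powr_mono2) auto
          also have "\<dots> \<le> (t / z) powr (1 - \<alpha>)"
            using \<open>w \<le> t / z\<close> w_ge al by (intro powr_mono) auto
          also have "\<dots> = (t / z) * (t / z) powr (- \<alpha>)"
            using t z by (simp add: powr_diff powr_minus divide_inverse)
          also have "\<dots> \<le> (t / z) * X powr (- \<alpha>)"
          proof (intro mult_left_mono)
            have "1 * 1 \<le> (real k)\<^sup>2 * m" using k m by (intro mult_mono) auto
            then have "X \<le> t / z" using t z k m unfolding X_def by (intro divide_left_mono) (auto simp: mult_le_cancel_right)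
            then show "(t / z) powr (- \<alpha>) \<le> X powr (- \<alpha>)"
              using X al theta by (intro powr_mono2') auto
          qed (use t z in auto)
          also have "\<dots> \<le> n / z"
            using nX X z by (simp add: powr_minus field_simps)
          finally show ?thesis .
        qed
        moreover have "real k * D \<le> w powr \<theta>"
        proof -
          have "real k * D = ((real k * D) ^ (k - 2)) powr \<theta>"
            using D k theta by (simp add: powr_realpow[symmetric] powr_powr)
          also have "\<dots> \<le> w powr \<theta>" using D k theta by (intro powr_mono2) auto
          finally show ?thesis .
        qed
        ultimately have "real k * D \<le> n / z" by linarith
        then have "real k * D * z \<le> n" using z by (simp add: pos_le_divide_eq)
        also have "n \<le> real (k - 2) * z * card (aps_at N k i Z u)" using dg[OF u] by (simp add: n_def z_def)
        also have "\<dots> \<le> real k * z * card (aps_at N k i Z u)" by (intro mult_right_mono) auto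
        finally have "(real k * z) * D \<le> (real k * z) * card (aps_at N k i Z u)" by (simp only: mult_ac)
        then show ?thesis using k z by simp
      qed
      have cz: "0 < crit z" "crit z \<le> 1" using crit_pos crit_power_le z zm by auto
      \<comment> \<open>The two stability properties of the maximiser compose: descending one level
        costs \<open>crit z / p\<close>, and the count at level \<open>i\<close> is at most
        \<open>(k - 2) * z\<close> times any degree.\<close>
      have "spread N k p (?C * crit z powr (1 / 2)) D Z"
        unfolding spread_def
      proof (intro conjI ballI)
        show "Z \<subseteq> {1..N}" using Z YN by blast
        fix u assume u: "u \<in> Z"
        have "p * card (aps_meeting N k (i - 1) Z) = crit z * (card (aps_meeting N k (i - 1) Z) * W z)"
          using Wcrit[OF z] by (simp add: mult_ac)
        also have "\<dots> \<le> crit z * n"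
          using desc cz by (intro mult_left_mono) (auto simp: z_def n_def)
        also have "\<dots> \<le> crit z * (real (k - 2) * z * card (aps_at N k i Z u))"
          using dg[OF u] cz by (intro mult_left_mono) (auto simp: z_def n_def)
        also have "\<dots> \<le> crit z * (?C * z * card (aps_at N k i Z u))"
        proof (intro mult_left_mono mult_right_mono)
          have "real (k - 2) \<le> 2 * real k / 1" by simp
          also have "\<dots> \<le> ?C" using eb by (intro divide_left_mono) auto
          finally show "real (k - 2) \<le> ?C" .
        qed (use cz in auto)
        also have "\<dots> \<le> crit z powr (1 / 2) * (?C * z * card (aps_at N k i Z u))"
          using sq[OF cz] eb by (intro mult_right_mono) auto
        finally have "p * card (aps_meeting N k (i - 1) Z)
            \<le> ?C * crit z powr (1 / 2) * card Z * card (aps_at N k i Z u)"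
          by (simp add: z_def mult_ac)
        then show "\<exists>i\<in>{3..k}. D \<le> card (aps_at N k i Z u) \<and> p * card (aps_meeting N k (i - 1) Z)
            \<le> ?C * crit z powr (1 / 2) * card Z * card (aps_at N k i Z u)"
          using i deg'[OF u] by (intro bexI[of _ i]) auto
      qed
      moreover have "t * p powr (- g * \<theta>) \<le> (real k)\<^sup>2 * (real (card Z))\<^sup>2"
      proof -
        \<comment> \<open>The quantity to be bounded below. In terms of \<open>V\<close>,
          \<open>X\<close> is \<open>1 / (V * (m / z))\<close>, and density together with the pair
          bound becomes \<open>(m / z) powr \<alpha> < V powr (1 - \<alpha>)\<close>.\<close>
        define V where "V = (real k)\<^sup>2 * (real z)\<^sup>2 / t"
        have V: "0 < V" using k z t by (simp add: V_def)
        have "real (card (aps_meeting N k i Z)) \<le> real (k\<^sup>2 * (card Z)\<^sup>2)"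
          using card_aps_meeting_le[OF fZ, of i N k] i by (simp only: of_nat_le_iff)
        then have "n \<le> V * t" using t by (simp add: n_def V_def z_def)
        then have "t < V * t * X powr \<alpha>" using nX mult_right_mono[of n "V * t" "X powr \<alpha>"] by simp
        then have VX: "1 < V * X powr \<alpha>" using t by simp
        have mz: "1 \<le> real m / z" using z zm by simp
        have XV: "X = inverse V * inverse (m / z)"
          using k z t m by (simp add: X_def V_def power2_eq_square field_simps)
        have "X powr \<alpha> = V powr (- \<alpha>) * (m / z) powr (- \<alpha>)"
          unfolding XV powr_mult inverse_powr powr_minus ..
        then have "V * X powr \<alpha> = (V powr 1 * V powr (- \<alpha>)) * (m / z) powr (- \<alpha>)"
          using V by simp
        also have "V powr 1 * V powr (- \<alpha>) = V powr (1 - \<alpha>)"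
          by (simp only: powr_add[symmetric]) simp
        finally have "V * X powr \<alpha> = V powr (1 - \<alpha>) * (m / z) powr (- \<alpha>)" .
        with VX have lower: "(m / z) powr \<alpha> < V powr (1 - \<alpha>)"
          using m z by (simp add: powr_minus divide_inverse[symmetric] pos_less_divide_eq)
        moreover have "1 \<le> (m / z) powr \<alpha>" using mz al theta by (intro ge_one_powr_ge_zero) auto
        ultimately have "1 < V powr (1 - \<alpha>)" by simp
        have V1: "1 \<le> V"
        proof (rule ccontr)
          assume "\<not> 1 \<le> V"
          then have "V powr (1 - \<alpha>) \<le> 1 powr (1 - \<alpha>)" using V al theta by (intro powr_mono2) auto
          then show False using \<open>1 < V powr (1 - \<alpha>)\<close> by simp
        qed
        \<comment> \<open>The core has more than \<open>p powr (- g) * sqrt t\<close> elements and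
          at most \<open>m\<close>, so \<open>M\<close> is large. Since
          \<open>M \<le> (m / z) * sqrt V\<close>, the inequality \<open>lower\<close> turns this
          into a bound on \<open>V\<close> alone.\<close>
        define M where "M = real m / sqrt t"
        have Mg: "p powr (- g) \<le> M"
          using s_big sm t by (simp add: M_def field_simps)
        have pg: "1 \<le> p powr (- g)" using p g by (simp add: powr_minus one_le_inverse powr_le1)
        have "M \<le> (m / z) * sqrt V"
        proof -
          have "sqrt V = k * z / sqrt t" by (simp add: V_def real_sqrt_mult real_sqrt_divide)
          then have "(m / z) * sqrt V = k * M" using z by (simp add: M_def)
          moreover have "1 * M \<le> k * M" using k t m by (intro mult_right_mono) (auto simp: M_def)
          ultimately show ?thesis by simp
        qed
        have "p powr (- g * \<theta>) = (p powr (- g)) powr \<theta>" by (simp add: powr_powr)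
        also have "\<dots> \<le> M powr \<theta>" using Mg theta by (intro powr_mono2) auto
        also have "\<dots> \<le> M powr \<alpha>" using Mg pg al by (intro powr_mono) auto
        also have "\<dots> \<le> ((m / z) * sqrt V) powr \<alpha>"
          using \<open>M \<le> (m / z) * sqrt V\<close> Mg pg al theta by (intro powr_mono2) auto
        also have "\<dots> = (m / z) powr \<alpha> * V powr (\<alpha> / 2)"
        proof -
          have "sqrt V powr \<alpha> = V powr (\<alpha> / 2)"
            using V by (simp add: powr_half_sqrt[symmetric] powr_powr)
          then show ?thesis by (simp only: powr_mult)
        qed
        also have "\<dots> \<le> V powr (1 - \<alpha>) * V powr (\<alpha> / 2)"
          using lower by (intro mult_right_mono) auto
        also have "\<dots> = V powr (1 - \<alpha> / 2)" by (simp add: powr_add[symmetric])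
        also have "\<dots> \<le> V powr 1" using V1 al theta by (intro powr_mono) auto
        finally have "p powr (- g * \<theta>) \<le> V" using V by simp
        then show ?thesis using t by (simp add: V_def z_def field_simps)
      qed
      ultimately show ?thesis using that[of Z] Z Y \<open>Z \<noteq> {}\<close> by (auto simp: z_def)
    qed
  qed
qed

end

section \<open>Probability bounds\<close>

lemma sum_power_tail_le:
  fixes v a :: real
  assumes S: "finite S" "\<And>s. s \<in> S \<Longrightarrow> a \<le> real s" and v: "0 < v" "v \<le> 1 / 2"
  shows "(\<Sum>s\<in>S. v ^ s) \<le> 2 * v powr a"
proof -
  define n where "n = nat \<lceil>a\<rceil>"
  have n: "n \<le> s" if "s \<in> S" for s using S(2)[OF that] by (simp add: n_def nat_le_iff ceiling_le_iff)
  have inj: "inj_on (\<lambda>s. s - n) S" using n by (intro inj_onI) (metis le_add_diff_inverse)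
  have "(\<Sum>s\<in>S. v ^ s) = (\<Sum>s\<in>S. v ^ n * v ^ (s - n))"
    using n by (intro sum.cong refl) (simp add: power_add[symmetric])
  also have "\<dots> = v ^ n * (\<Sum>j\<in>(\<lambda>s. s - n) ` S. v ^ j)"
    by (simp add: sum_distrib_left sum.reindex[OF inj])
  also have "\<dots> \<le> v ^ n * (\<Sum>j. v ^ j)"
    using v S(1) by (intro mult_left_mono sum_le_suminf summable_geometric) auto
  also have "\<dots> = v ^ n * (1 / (1 - v))" using v by (subst suminf_geometric) auto
  also have "\<dots> \<le> v ^ n * 2" using v by (intro mult_left_mono) (auto simp: field_simps)
  also have "v ^ n \<le> v powr a"
  proof -
    have "v powr real n \<le> v powr a" using v real_nat_ceiling_ge[of a] by (intro powr_mono') (auto simp: n_def)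
    then show ?thesis using v by (simp add: powr_realpow)
  qed
  finally show ?thesis by simp
qed

lemma prob_UN_le:
  assumes "finite S"
  shows "measure_pmf.prob P {R. \<exists>s\<in>S. Q s R} \<le> (\<Sum>s\<in>S. measure_pmf.prob P {R. Q s R})"
proof -
  have "{R. \<exists>s\<in>S. Q s R} = (\<Union>s\<in>S. {R. Q s R})" by auto
  then show ?thesis
    using measure_pmf.finite_measure_subadditive_finite[OF assms, of "\<lambda>s. {R. Q s R}" P] by simp
qed

context sparse_regime
begin

text \<open>With \<open>s \<le> m\<close> and \<open>t\<close> of order at most
  \<open>s\<^sup>2\<close>, the fingerprint price \<open>N * p / s\<close> is at most a constant
  times \<open>p powr (- real k)\<close>; raised to \<open>2 * q\<close> it costs
  \<open>2 * real k * q\<close> in the exponent of \<open>p\<close>.\<close>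

lemma prob_spread_small:
  fixes A0 C x d q D :: real
  assumes q: "0 < q" "q \<le> 1 / 2" and C: "C = 2 * (real k)\<^sup>2 / q ^ k"
    and A0: "0 < A0" "1 \<le> C * A0" and small: "C * A0 * p powr d \<le> 1"
    and D: "0 < D" "4 * real k * (real k)\<^sup>2 / q ^ (2 * k + 1) \<le> D"
    and s: "1 \<le> s" "s \<le> m" "t \<le> 2 * (real k)\<^sup>2 * (real s)\<^sup>2"
    and x: "x \<le> d * (1 - 2 * q) - 2 * real k * q"
  shows "measure_pmf.prob (bernoulli_subset {1..N} p)
      {R. \<exists>Y. spread N k p (A0 * p powr d) D Y \<and> card Y = s \<and> Y \<subseteq> R}
    \<le> (exp 2 * (2 * (real k)\<^sup>2 * (C * A0)) * p powr x) ^ s"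
proof -
  define h where "h = max 1 (N * p / s)"
  have k1: "1 \<le> 2 * (real k)\<^sup>2"
  proof -
    have "1 * 1 \<le> real k * real k" using k by (intro mult_mono) auto
    then show ?thesis unfolding power2_eq_square by linarith
  qed
  have pk: "p powr (- real k) = 1 / p ^ k" using p by (simp add: powr_minus powr_realpow divide_inverse)
  have "h \<le> 2 * (real k)\<^sup>2 * p powr (- real k)"
    unfolding h_def
  proof (rule max.boundedI)
    have "1 \<le> p powr (- real k)" unfolding pk using p by (simp add: power_le_one)
    then show "1 \<le> 2 * (real k)\<^sup>2 * p powr (- real k)" using k1 mult_mono[of 1 "2 * (real k)\<^sup>2" 1 "p powr (- real k)"] by simp
    have "N * p / s \<le> t / (m * s * p ^ (k - 2))" using free_ratio s by simp
    also have "\<dots> \<le> t / (real s * s * p ^ (k - 2))"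
      using s p t by (intro divide_left_mono mult_right_mono) auto
    also have "\<dots> = t / (real s)\<^sup>2 / p ^ (k - 2)" by (simp add: power2_eq_square)
    also have "\<dots> \<le> 2 * (real k)\<^sup>2 / p ^ (k - 2)"
      using s p by (intro divide_right_mono) (auto simp: pos_divide_le_eq)
    also have "\<dots> \<le> 2 * (real k)\<^sup>2 / p ^ k"
      using p by (intro divide_left_mono power_decreasing) auto
    finally show "N * p / s \<le> 2 * (real k)\<^sup>2 * p powr (- real k)" by (simp add: pk)
  qed
  then have "h powr (2 * q) * (C * (A0 * p powr d)) powr (1 - 2 * q) \<le> 2 * (real k)\<^sup>2 * (C * A0) * p powr x"
    using p k1 A0 q x k
    by (intro exponent_bookkeeping[where a = "real k" and d = d]) (auto simp: h_def C mult.assoc)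
  then have "exp 2 * (h powr (2 * q) * (C * (A0 * p powr d)) powr (1 - 2 * q))
      \<le> exp 2 * (2 * (real k)\<^sup>2 * (C * A0) * p powr x)"
    by (intro mult_left_mono) auto
  then have "(exp 2 * h powr (2 * q) * (C * (A0 * p powr d)) powr (1 - 2 * q)) ^ s
      \<le> (exp 2 * (2 * (real k)\<^sup>2 * (C * A0)) * p powr x) ^ s"
    by (intro power_mono) (auto simp: mult.assoc h_def)
  moreover have "measure_pmf.prob (bernoulli_subset {1..N} p)
      {R. \<exists>Y. spread N k p (A0 * p powr d) D Y \<and> card Y = s \<and> Y \<subseteq> R}
    \<le> (exp 2 * h powr (2 * q) * (C * (A0 * p powr d)) powr (1 - 2 * q)) ^ s"
    unfolding h_def C
    using small by (intro prob_contains_spread k p q D) (use A0 p s in \<open>auto simp: C mult.assoc\<close>)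
  ultimately show ?thesis by linarith
qed

text \<open>Everything is measured in powers of \<open>crit s\<close>. The condition
  \<open>real k * q \<le> 1 / 8\<close> ensures that fingerprinting leaves
  \<open>crit s powr (1 / 4)\<close> of the ratio.\<close>

lemma prob_spread_large:
  fixes A1 C q D :: real
  assumes q: "0 < q" "real k * q \<le> 1 / 8" and C: "C = 2 * (real k)\<^sup>2 / q ^ k"
    and A1: "0 < A1" "1 \<le> C * A1" and small: "C * A1 * crit s powr (1 / 2) \<le> 1"
    and D: "0 < D" "4 * real k * (real k)\<^sup>2 / q ^ (2 * k + 1) \<le> D"
    and s: "1 \<le> s" "s \<le> m"
  shows "measure_pmf.prob (bernoulli_subset {1..N} p)
      {R. \<exists>Y. spread N k p (A1 * crit s powr (1 / 2)) D Y \<and> card Y = s \<and> Y \<subseteq> R}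
    \<le> (exp 2 * ((real k)\<^sup>2 * (C * A1)) * crit s powr (1 / 4)) ^ s"
proof -
  define h where "h = max 1 (N * p / s)"
  have c: "0 < crit s" "crit s \<le> 1" using crit_pos crit_power_le s by auto
  have "1 * q \<le> real k * q" using k q by (intro mult_right_mono) auto
  then have q2: "q \<le> 1 / 2" using q by linarith
  have k1: "1 \<le> (real k)\<^sup>2" using k by (intro one_le_power) auto
  have "1 powr (- real (k - 2)) \<le> crit s powr (- real (k - 2))"
    using c by (intro powr_mono2') auto
  then have c1: "1 \<le> crit s powr (- real (k - 2))" by simp
  have "h \<le> (real k)\<^sup>2 * crit s powr (- real (k - 2))"
    unfolding h_def
  proof (rule max.boundedI)
    show "1 \<le> (real k)\<^sup>2 * crit s powr (- real (k - 2))"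
      using k1 c1 mult_mono[of 1 "(real k)\<^sup>2" 1 "crit s powr (- real (k - 2))"] by simp
    show "N * p / s \<le> (real k)\<^sup>2 * crit s powr (- real (k - 2))" using crit_ratio(1)[OF s] .
  qed
  moreover have "1 / 4 \<le> 1 / 2 * (1 - 2 * q) - 2 * real (k - 2) * q"
  proof -
    have "real (k - 2) * q = real k * q - 2 * q" using k by (simp add: of_nat_diff algebra_simps)
    then have e: "2 * real (k - 2) * q = 2 * (real k * q - 2 * q)" by (simp only: mult.assoc)
    have "1 / 2 * (1 - 2 * q) - 2 * (real k * q - 2 * q) = 1 / 2 - 2 * (real k * q) + 3 * q"
      by (simp add: field_simps)
    moreover have "2 * (real k * q) \<le> 1 / 4" using q(2) by simp
    ultimately show ?thesis unfolding e using q(1) by linarith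
  qed
  ultimately have "h powr (2 * q) * (C * (A1 * crit s powr (1 / 2))) powr (1 - 2 * q)
      \<le> (real k)\<^sup>2 * (C * A1) * crit s powr (1 / 4)"
    using c k1 A1 q q2
    by (intro exponent_bookkeeping[where a = "real (k - 2)" and d = "1 / 2"]) (auto simp: h_def C mult.assoc)
  then have "exp 2 * (h powr (2 * q) * (C * (A1 * crit s powr (1 / 2))) powr (1 - 2 * q))
      \<le> exp 2 * ((real k)\<^sup>2 * (C * A1) * crit s powr (1 / 4))"
    by (intro mult_left_mono) auto
  then have "(exp 2 * h powr (2 * q) * (C * (A1 * crit s powr (1 / 2))) powr (1 - 2 * q)) ^ s
      \<le> (exp 2 * ((real k)\<^sup>2 * (C * A1)) * crit s powr (1 / 4)) ^ s"
    by (intro power_mono) (auto simp: mult.assoc h_def)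
  moreover have "measure_pmf.prob (bernoulli_subset {1..N} p)
      {R. \<exists>Y. spread N k p (A1 * crit s powr (1 / 2)) D Y \<and> card Y = s \<and> Y \<subseteq> R}
    \<le> (exp 2 * h powr (2 * q) * (C * (A1 * crit s powr (1 / 2))) powr (1 - 2 * q)) ^ s"
    unfolding h_def C
    using small by (intro prob_contains_spread k p q D) (use A1 c s q2 in \<open>auto simp: C mult.assoc\<close>)
  ultimately show ?thesis by linarith
qed

text \<open>The finite value of \<open>Psi\<close>. \<open>Min\<close> of the empty set is
  unspecified, so the facts below assume that a seed is given.\<close>

definition min_seed :: nat where
  "min_seed = Min (card ` {U. U \<subseteq> {1..N} \<and> t \<le> gain N k p U})"

lemma min_seed_le: "U \<subseteq> {1..N} \<Longrightarrow> t \<le> gain N k p U \<Longrightarrow> min_seed \<le> card U"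
  unfolding min_seed_def by (intro Min_le) auto

lemma min_seed_attained:
  assumes "U \<subseteq> {1..N}" "t \<le> gain N k p U"
  obtains V where "V \<subseteq> {1..N}" "t \<le> gain N k p V" "card V = min_seed"
proof -
  have "min_seed \<in> card ` {U. U \<subseteq> {1..N} \<and> t \<le> gain N k p U}"
    unfolding min_seed_def using assms by (intro Min_in) auto
  then show ?thesis using that by auto
qed

text \<open>An interval of length \<open>sqrt (8 * (real k)\<^sup>2 * t)\<close>, rounded up, is a
  seed by \<open>gain_interval\<close>. If that length exceeds \<open>N\<close>, the whole of
  \<open>{1..N}\<close> serves instead, being a seed because it contains \<open>U\<close>.\<close>

lemma min_seed_interval:
  assumes U: "U \<subseteq> {1..N}" "card U \<le> m" "t \<le> gain N k p U" and p2: "p \<le> 1 / 2"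
    and w32: "32 * real k ^ 4 \<le> w"
  obtains n where "n \<le> N" "4 * k \<le> n" "min_seed \<le> n" "t \<le> 2 * (real k)\<^sup>2 * (real n)\<^sup>2"
    "real n \<le> 4 * k * sqrt t" "t \<le> 2 * (real k)\<^sup>2 * (real min_seed)\<^sup>2"
proof -
  define n where "n = min N (nat \<lceil>sqrt (8 * (real k)\<^sup>2 * t)\<rceil>)"
  let ?x = "sqrt (8 * (real k)\<^sup>2 * t)"
  have fU: "finite U" using U(1) finite_subset by blast
  have "32 * real k ^ 4 \<le> t" using w32 w_le_t by linarith
  have t1: "1 \<le> t" using w_ge w_le_t by linarith
  have k2: "0 < (real k)\<^sup>2" using k by simp
  have x: "?x = real k * sqrt 8 * sqrt t" by (simp add: real_sqrt_mult)
  have "t \<le> 2 * (real k)\<^sup>2 * (real (card U))\<^sup>2"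
    using gain_large_imp_card[OF fU U(2)] U(3) t by simp
  also have "\<dots> \<le> 2 * (real k)\<^sup>2 * (real N)\<^sup>2"
    using card_mono[of "{1..N}" U] U(1) by (intro mult_left_mono power_mono) auto
  finally have tN: "t \<le> 2 * (real k)\<^sup>2 * (real N)\<^sup>2" .
  have nx: "?x \<le> real (nat \<lceil>?x\<rceil>)" by linarith
  have tn: "t \<le> 2 * (real k)\<^sup>2 * (real n)\<^sup>2"
  proof (cases "N \<le> nat \<lceil>?x\<rceil>")
    case True
    then show ?thesis using tN by (simp add: n_def)
  next
    case False
    have "1 * t \<le> 8 * (real k)\<^sup>2 * t" using k t by (intro mult_right_mono) (auto simp: power2_eq_square intro!: mult_ge1_I)
    also have "\<dots> = ?x\<^sup>2" using t by simp
    also have "\<dots> \<le> (real n)\<^sup>2" using nx t False by (intro power_mono) (auto simp: n_def)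
    also have "1 * (real n)\<^sup>2 \<le> (2 * (real k)\<^sup>2) * (real n)\<^sup>2"
      using k by (intro mult_right_mono) (auto simp: power2_eq_square intro!: mult_ge1_I)
    finally show ?thesis by simp
  qed
  have "32 * real k ^ 4 \<le> 2 * (real k)\<^sup>2 * (real n)\<^sup>2" using tn \<open>32 * real k ^ 4 \<le> t\<close> by linarith
  moreover have "32 * real k ^ 4 = (2 * (real k)\<^sup>2) * (4 * real k)\<^sup>2"
    by (simp add: eval_nat_numeral)
  ultimately have "(2 * (real k)\<^sup>2) * (4 * real k)\<^sup>2 \<le> (2 * (real k)\<^sup>2) * (real n)\<^sup>2" by linarith
  then have "(4 * real k)\<^sup>2 \<le> (real n)\<^sup>2"
    using k2 by (subst (asm) mult_le_cancel_left_pos) auto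
  then have "4 * real k \<le> real n" by (rule power2_le_imp_le) simp
  then have n4: "4 * k \<le> n" by linarith
  have nN: "n \<le> N" by (simp add: n_def)
  have "0 \<le> ?x" using t by simp
  then have "real (nat \<lceil>?x\<rceil>) \<le> ?x + 1" by linarith
  then have "real n \<le> ?x + 1" by (simp add: n_def min_def)
  also have "\<dots> \<le> real k * 3 * sqrt t + real k * sqrt t"
  proof (intro add_mono)
    have "sqrt 8 \<le> sqrt (3\<^sup>2)" by (subst real_sqrt_le_iff) simp
    then have "sqrt 8 \<le> 3" by simp
    then show "?x \<le> real k * 3 * sqrt t" unfolding x using t by (intro mult_right_mono mult_left_mono) auto
    show "1 \<le> real k * sqrt t" using k t1 mult_mono[of 1 "real k" 1 "sqrt t"] by simp
  qed
  finally have n_le: "real n \<le> 4 * k * sqrt t" by simp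
  have ms_n: "min_seed \<le> n"
  proof (cases "N \<le> nat \<lceil>?x\<rceil>")
    case True
    have "t \<le> gain N k p {1..N}" using gain_mono[OF p U(1), of N k] U(3) by linarith
    then have "min_seed \<le> N" using min_seed_le[of "{1..N}"] by simp
    then show ?thesis using True by (simp add: n_def)
  next
    case False
    have "8 * (real k)\<^sup>2 * t = ?x\<^sup>2" using t by simp
    also have "\<dots> \<le> (real n)\<^sup>2" using nx t False by (intro power_mono) (auto simp: n_def)
    finally have "t \<le> (real n)\<^sup>2 / (8 * (real k)\<^sup>2)" using k2 by (simp add: field_simps)
    also have "\<dots> \<le> gain N k p {1..n}" using k by (intro gain_interval p p2 nN n4) auto
    finally show ?thesis using min_seed_le[of "{1..n}"] nN by simp
  qed
  obtain V where V: "V \<subseteq> {1..N}" "t \<le> gain N k p V" "card V = min_seed"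
    using min_seed_attained[OF U(1,3)] by blast
  have "card V \<le> m" using V(3) min_seed_le[OF U(1,3)] U(2) by simp
  then have "t \<le> 2 * (real k)\<^sup>2 * (real min_seed)\<^sup>2"
    using gain_large_imp_card[of V] V t finite_subset[OF V(1)] by simp
  then show ?thesis using that[OF nN n4 ms_n tn n_le] by blast
qed

text \<open>Otherwise \<open>seed_completion\<close> inside an interval of length
  \<open>n \<ge> min_seed\<close> would add at most \<open>\<delta> * min_seed\<close> points and
  regain at least \<open>e * t\<close>, giving a seed smaller than \<open>min_seed\<close>.\<close>

lemma core_card:
  fixes \<delta> e :: real
  assumes U: "U \<subseteq> {1..N}" "card U \<le> m" "t \<le> gain N k p U" and p2: "p \<le> 1 / 2"
    and w32: "32 * real k ^ 4 \<le> w" and \<delta>: "0 < \<delta>" "\<delta> < 1" and w16: "16 * real k ^ 4 / \<delta>\<^sup>2 \<le> w"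
    and r: "0 < r" "16 * real k ^ 3 / \<delta> \<le> real r" and e: "e \<le> \<delta> / (16 * real k ^ 4 * 2 ^ r)"
    and Y: "Y \<subseteq> {1..N}" "(1 - e) * t \<le> gain N k p Y"
  shows "(1 - \<delta>) * min_seed \<le> card Y"
proof (rule ccontr)
  assume "\<not> ?thesis"
  then have lt: "card Y < (1 - \<delta>) * min_seed" by simp
  obtain n where n: "n \<le> N" "4 * k \<le> n" "min_seed \<le> n" "t \<le> 2 * (real k)\<^sup>2 * (real n)\<^sup>2"
    "real n \<le> 4 * k * sqrt t" "t \<le> 2 * (real k)\<^sup>2 * (real min_seed)\<^sup>2"
    by (rule min_seed_interval[OF U p2 w32])
  have k0: "0 < real k" using k by simp
  have sq: "sqrt t \<le> 2 * real k * min_seed"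
  proof -
    have "0 \<le> (real k)\<^sup>2 * (real min_seed)\<^sup>2" by simp
    then have "t \<le> 4 * ((real k)\<^sup>2 * (real min_seed)\<^sup>2)"
      using n(6) unfolding mult.assoc by linarith
    then have "t \<le> (2 * real k * min_seed)\<^sup>2" by (simp add: power_mult_distrib)
    then show ?thesis by (intro real_le_lsqrt) auto
  qed
  obtain V where V: "V \<subseteq> {1..N}" "card V \<le> card Y + k * (n div r + 1)"
    "gain N k p Y + (real n - card Y) * n / (8 * (real k)\<^sup>2 * 2 ^ r) \<le> gain N k p V"
    using seed_completion[OF p(1) p2 _ n(1,2) Y(1) r(1)] k by auto
  have "\<delta> * n \<le> real n - card Y"
  proof -
    have "(1 - \<delta>) * min_seed \<le> (1 - \<delta>) * n" using n(3) \<delta> by (intro mult_left_mono) auto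
    then show ?thesis using lt by (simp add: algebra_simps)
  qed
  then have "\<delta> * n * n / (8 * (real k)\<^sup>2 * 2 ^ r) \<le> (real n - card Y) * n / (8 * (real k)\<^sup>2 * 2 ^ r)"
    by (intro divide_right_mono mult_right_mono) auto
  moreover have "e * t \<le> \<delta> * n * n / (8 * (real k)\<^sup>2 * 2 ^ r)"
  proof -
    have "e * t \<le> \<delta> / (16 * real k ^ 4 * 2 ^ r) * t" using e t by (intro mult_right_mono) auto
    also have "\<dots> \<le> \<delta> / (16 * real k ^ 4 * 2 ^ r) * (2 * (real k)\<^sup>2 * (real n)\<^sup>2)"
      using n(4) \<delta> by (intro mult_left_mono) auto
    also have "\<dots> = \<delta> * n * n / (8 * (real k)\<^sup>2 * 2 ^ r)"
      using k0 by (simp add: eval_nat_numeral field_simps)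
    finally show ?thesis .
  qed
  ultimately have "t \<le> gain N k p V" using V(3) Y(2) by (simp add: algebra_simps)
  then have "min_seed \<le> card V" using V(1) by (intro min_seed_le)
  then have "real min_seed \<le> real (card Y + k * (n div r + 1))" using V(2) by linarith
  also have "\<dots> = real (card Y) + (k * real (n div r) + k)" by (simp add: algebra_simps)
  also have "\<dots> < (1 - \<delta>) * min_seed + (k * real (n div r) + k)" using lt by simp
  finally have main: "\<delta> * min_seed < k * real (n div r) + k" by (simp add: algebra_simps)
  \<comment> \<open>The bound on \<open>r\<close> is made for this:
    \<open>n \<le> 8 * (real k)\<^sup>2 * min_seed\<close> turns the added fraction of the interval
    into \<open>\<delta> * min_seed / 2\<close>.\<close>
  have "k * real (n div r) \<le> k * (real n / r)"
    by (intro mult_left_mono of_nat_div_le_of_nat) auto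
  also have "\<dots> \<le> k * ((8 * (real k)\<^sup>2 * min_seed) / (16 * real k ^ 3 / \<delta>))"
  proof (intro mult_left_mono frac_le r(2))
    have "real n \<le> 4 * k * (2 * real k * min_seed)"
      using n(5) sq by (meson mult_left_mono of_nat_0_le_iff order_trans)
    then show "real n \<le> 8 * (real k)\<^sup>2 * min_seed" by (simp add: power2_eq_square)
  qed (use k0 \<delta> in auto)
  also have "\<dots> = \<delta> * min_seed / 2" using k0 by (simp add: eval_nat_numeral)
  finally have 1: "k * real (n div r) \<le> \<delta> * min_seed / 2" .
  \<comment> \<open>The rounding term \<open>k\<close> of the completion is absorbed because
    \<open>w16\<close> forces \<open>min_seed\<close> to be large.\<close>
  have "(4 * (real k)\<^sup>2 / \<delta>)\<^sup>2 \<le> t"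
    using w16 w_le_t by (simp add: power_divide power_mult_distrib eval_nat_numeral)
  then have "4 * (real k)\<^sup>2 / \<delta> \<le> sqrt t" by (rule real_le_rsqrt)
  then have "4 * (real k)\<^sup>2 / \<delta> \<le> 2 * real k * min_seed" using sq by linarith
  then have "real k * (4 * real k) \<le> real k * (2 * \<delta> * min_seed)"
    using \<delta> by (simp add: field_simps power2_eq_square)
  then have "4 * real k \<le> 2 * \<delta> * min_seed" using k0 by (simp only: mult_le_cancel_left_pos)
  then have "real k \<le> \<delta> * min_seed / 2" by simp
  then show False using main 1 by linarith
qed

end

section \<open>Choice of constants and the bound for all seeds\<close>

lemma small_power:
  fixes K c :: real
  assumes "0 < K" "0 < c"
  obtains x0 where "0 < x0" "\<And>x. 0 < x \<Longrightarrow> x \<le> x0 \<Longrightarrow> K * x powr c \<le> 1"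
proof -
  define x0 where "x0 = (1 / K) powr (1 / c)"
  show ?thesis
  proof (rule that[of x0])
    show "0 < x0" using assms by (simp add: x0_def)
    fix x assume x: "0 < x" "x \<le> x0"
    have "x powr c \<le> x0 powr c" using x assms by (intro powr_mono2) auto
    also have "\<dots> = 1 / K" using assms by (simp add: x0_def powr_powr)
    finally show "K * x powr c \<le> 1" using assms by (simp add: field_simps)
  qed
qed

text \<open>The single parameter \<open>q\<close> acts as sampling rate, as penalty exponent
  \<open>b\<close> and as size exponent \<open>g\<close>. The hypotheses on \<open>w\<close>,
  \<open>x0\<close> and \<open>p\<close> are the numerical requirements of the argument.\<close>

lemma (in sparse_regime) prob_seed_le_aux:
  fixes \<eta> \<delta> q e D C A0 A1 x0 :: real and r :: nat
  assumes U0: "U0 \<subseteq> {1..N}" "card U0 \<le> m" "t \<le> gain N k p U0"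
    and \<eta>: "0 < \<eta>" "\<eta> < 1" and q: "q = \<eta> / (24 * real k)" and \<delta>: "\<delta> = \<eta> / 4"
    and r: "0 < r" "16 * real k ^ 3 / \<delta> \<le> real r" and e: "e = \<delta> / (16 * real k ^ 4 * 2 ^ r)"
    and C: "C = 2 * (real k)\<^sup>2 / q ^ k" and D: "D = 4 * real k * (real k)\<^sup>2 / q ^ (2 * k + 1)"
    and A0: "A0 = 4 * real k ^ 5 / (e * q)" and A1: "A1 = 2 * real k / (e * q)"
    and w1: "32 * real k ^ 4 \<le> w" "16 * real k ^ 4 / \<delta>\<^sup>2 \<le> w" "2 * real k * D / (e * q) \<le> w"
      "(real k * D) ^ (k - 2) \<le> w" "4 * (real k)\<^sup>2 / (e * q) \<le> w"
    and x0: "0 < x0" "exp 2 * ((real k)\<^sup>2 * (C * A1)) * x0 powr (1 / 4) \<le> 1 / 2" "(real k)\<^sup>2 / w \<le> x0 ^ (k - 2)"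
    and p1: "p \<le> 1 / 4" "exp 2 * (2 * (real k)\<^sup>2 * (C * A0)) * p powr (real k * q) \<le> 1"
      "C * A0 * p powr (1 / 2) \<le> 1" "p powr (\<eta> / 2) \<le> 1 / 4"
      "2 * ln 2 + 4 * real k * ln (1 / p) \<le> p powr (- q * \<theta> / 2) * ln 2 / k"
  shows "measure_pmf.prob (bernoulli_subset {1..N} p)
      {R. \<exists>U. U \<subseteq> {1..N} \<and> t \<le> gain N k p U \<and> card U \<le> m \<and> U \<subseteq> R}
    \<le> p powr ((1 - \<eta>) * min_seed)"
proof -
  let ?P = "bernoulli_subset {1..N} p"
  have k3: "3 \<le> real k" using k by simp
  have kq: "real k * q = \<eta> / 24" using k by (simp add: q)
  have q0: "0 < q" using \<eta> k by (simp add: q)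
  have qk: "3 * q \<le> real k * q" using k3 q0 by (intro mult_right_mono) auto
  have q1: "q \<le> 1 / 72" using qk kq \<eta> by linarith
  have \<delta>0: "0 < \<delta>" "\<delta> < 1" using \<eta> by (auto simp: \<delta>)
  have k4: "1 \<le> real k ^ 4" "1 \<le> real k ^ 5" "1 \<le> (real k)\<^sup>2" using k3 by (auto intro: one_le_power)
  have e0: "0 < e" using \<delta>0 k by (simp add: e)
  have e1: "e \<le> 1 / 4"
  proof -
    have "1 * 1 \<le> real k ^ 4 * 2 ^ r" using k4 by (intro mult_mono) auto
    then have "\<delta> / (16 * real k ^ 4 * 2 ^ r) \<le> 1 / 16" using \<delta>0 by (intro frac_le) auto
    then have "e \<le> 1 / 16" by (simp only: e)
    then show ?thesis by simp
  qed
  have eq0: "0 < e * q" "e * q \<le> 1" using e0 q0 e1 q1 by (auto intro: mult_le_one)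
  have C1: "1 \<le> C"
  proof -
    have "q ^ k \<le> 1" using q0 q1 by (intro power_le_one) auto
    then have "2 * (real k)\<^sup>2 / 1 \<le> C" unfolding C using q0 k4 by (intro divide_left_mono) auto
    then show ?thesis using k4 by linarith
  qed
  have D0: "0 < D" using k q0 by (simp add: D)
  have A0': "1 \<le> A0"
  proof -
    have "4 * real k ^ 5 / 1 \<le> A0" unfolding A0 using eq0 by (intro divide_left_mono) auto
    then show ?thesis using k4 by linarith
  qed
  have A1': "1 \<le> A1"
  proof -
    have "2 * real k / 1 \<le> A1" unfolding A1 using eq0 by (intro divide_left_mono) auto
    then show ?thesis using k3 by linarith
  qed
  have CA: "1 \<le> C * A0" "1 \<le> C * A1"
    using C1 A0' A1' mult_mono[of 1 C 1 A0] mult_mono[of 1 C 1 A1] by auto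
  have p2: "p \<le> 1 / 2" using p1(1) by simp
  define M where "M = real min_seed"
  define d where "d = 1 - 2 * q - real k * q"
  define E0 where "E0 = (\<lambda>s R. \<exists>Y. spread N k p (A0 * p powr d) D Y \<and> card Y = s \<and> Y \<subseteq> R)"
  define E1 where "E1 = (\<lambda>s R. \<exists>Y. spread N k p (A1 * crit s powr (1 / 2)) D Y \<and> card Y = s \<and> Y \<subseteq> R)"
  \<comment> \<open>The sizes possible in the two alternatives: nearly \<open>min_seed\<close> or
    more, and far above \<open>sqrt t\<close>.\<close>
  define S0 where "S0 = {s \<in> {1..m}. (1 - \<delta>) * M \<le> s \<and> t \<le> 2 * (real k)\<^sup>2 * (real s)\<^sup>2}"
  define S1 where "S1 = {s \<in> {1..m}. t * p powr (- q * \<theta>) \<le> (real k)\<^sup>2 * (real s)\<^sup>2}"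
  have fS: "finite S0" "finite S1" by (auto simp: S0_def S1_def)
  have incl: "(\<exists>s\<in>S0. E0 s R) \<or> (\<exists>s\<in>S1. E1 s R)"
    if U: "U \<subseteq> {1..N}" "t \<le> gain N k p U" "card U \<le> m" "U \<subseteq> R" for U R
  proof -
    have kb: "real k * q \<le> 1 / 2" using kq \<eta> by simp
    obtain Y where Y: "Y \<subseteq> U" "Y \<noteq> {}" and alt:
      "((1 - e) * t \<le> gain N k p Y \<and>
          spread N k p (4 * real k ^ 5 / (e * q) * p powr (1 - 2 * q - real k * q)) D Y) \<or>
       (t * p powr (- q * \<theta>) \<le> (real k)\<^sup>2 * (real (card Y))\<^sup>2 \<and>
          spread N k p (2 * real k / (e * q) * crit (card Y) powr (1 / 2)) D Y)"
      by (rule spread_in_seed[OF U(1,3,2) e0 e1 q0 kb q0 D0 w1(3,4,5)]) blast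
    have fU: "finite U" using U(1) finite_subset by blast
    have fY: "finite Y" using Y(1) fU finite_subset by blast
    have cY: "card Y \<in> {1..m}"
      using card_mono[OF fU Y(1)] U(3) Y(2) fY card_gt_0_iff[of Y] by auto
    have YR: "Y \<subseteq> R" and YN: "Y \<subseteq> {1..N}" using Y U by auto
    from alt show ?thesis
    proof
      assume a: "(1 - e) * t \<le> gain N k p Y \<and>
          spread N k p (4 * real k ^ 5 / (e * q) * p powr (1 - 2 * q - real k * q)) D Y"
      then have gY: "(1 - e) * t \<le> gain N k p Y" by simp
      have "(3 / 4) * t \<le> (1 - e) * t" using e1 t by (intro mult_right_mono) auto
      then have "t \<le> 2 * (real k)\<^sup>2 * (real (card Y))\<^sup>2"
        using gain_large_imp_card[OF fY] cY gY by simp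
      moreover have "(1 - \<delta>) * M \<le> card Y"
        unfolding M_def by (rule core_card[OF U0 p2 w1(1) \<delta>0 w1(2) r _ YN gY]) (simp add: e)
      ultimately have "card Y \<in> S0" using cY by (simp add: S0_def)
      moreover have "E0 (card Y) R" using a YR by (auto simp: E0_def A0 d_def)
      ultimately show ?thesis by blast
    next
      assume a: "t * p powr (- q * \<theta>) \<le> (real k)\<^sup>2 * (real (card Y))\<^sup>2 \<and>
          spread N k p (2 * real k / (e * q) * crit (card Y) powr (1 / 2)) D Y"
      then have "card Y \<in> S1" using cY by (simp add: S1_def)
      moreover have "E1 (card Y) R" using a YR by (auto simp: E1_def A1)
      ultimately show ?thesis by blast
    qed
  qed
  obtain n where n: "min_seed \<le> n" "real n \<le> 4 * k * sqrt t" "t \<le> 2 * (real k)\<^sup>2 * (real min_seed)\<^sup>2"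
    using min_seed_interval[OF U0 p2 w1(1)] by metis
  have M1: "1 \<le> M"
  proof -
    have "min_seed \<noteq> 0"
    proof
      assume "min_seed = 0"
      then show False using n(3) t by simp
    qed
    then show ?thesis by (simp add: M_def)
  qed
  have sum0: "(\<Sum>s\<in>S0. measure_pmf.prob ?P {R. E0 s R}) \<le> 1 / 2 * p powr ((1 - \<eta>) * M)"
  proof -
    define v where "v = p powr (1 - \<eta> / 4)"
    have d2: "1 / 2 \<le> d" using qk kq q0 \<eta> by (simp add: d_def)
    have v: "0 < v" "v \<le> 1 / 2"
    proof -
      show "0 < v" using p by (simp add: v_def)
      have "v \<le> p powr (1 / 2)" unfolding v_def using p \<eta> by (intro powr_mono') auto
      also have "\<dots> \<le> (1 / 4) powr (1 / 2)" using p p1(1) by (intro powr_mono2) auto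
      also have "\<dots> = 1 / 2" by (simp add: powr_half_sqrt real_sqrt_divide)
      finally show "v \<le> 1 / 2" .
    qed
    have "measure_pmf.prob ?P {R. E0 s R} \<le> v ^ s" if s: "s \<in> S0" for s
    proof -
      \<comment> \<open>The exponent loses at most \<open>4 * q + 3 * real k * q\<close>; a further
        \<open>real k * q\<close> is set aside to absorb the constant in front. With
        \<open>real k * q = \<eta> / 24\<close> the total stays below
        \<open>\<eta> / 4\<close>.\<close>
      have "measure_pmf.prob ?P {R. E0 s R}
          \<le> (exp 2 * (2 * (real k)\<^sup>2 * (C * A0)) * p powr (1 - \<eta> / 4 + real k * q)) ^ s"
        unfolding E0_def
      proof (rule prob_spread_small[OF q0 _ C _ CA(1) _ D0])
        have "p powr d \<le> p powr (1 / 2)" using p d2 by (intro powr_mono') auto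
        then have "C * A0 * p powr d \<le> C * A0 * p powr (1 / 2)"
          using CA by (intro mult_left_mono) auto
        then show "C * A0 * p powr d \<le> 1" using p1(3) by linarith
        have "d * (1 - 2 * q) = 1 - 4 * q - real k * q + 2 * q * (2 * q + real k * q)"
          by (simp add: d_def algebra_simps)
        moreover have "0 \<le> 2 * q * (2 * q + real k * q)" using q0 by simp
        ultimately have "1 - 4 * q - real k * q - 2 * (real k * q) \<le> d * (1 - 2 * q) - 2 * (real k * q)" by linarith
        moreover have "1 - \<eta> / 4 + real k * q \<le> 1 - 4 * q - real k * q - 2 * (real k * q)"
          using kq qk q0 by linarith
        ultimately show "1 - \<eta> / 4 + real k * q \<le> d * (1 - 2 * q) - 2 * real k * q" by (simp add: mult.assoc)
      qed (use q1 A0' s D in \<open>auto simp: S0_def\<close>)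
      also have "\<dots> \<le> v ^ s"
      proof (intro power_mono)
        have "exp 2 * (2 * (real k)\<^sup>2 * (C * A0)) * p powr (1 - \<eta> / 4 + real k * q)
            = (exp 2 * (2 * (real k)\<^sup>2 * (C * A0)) * p powr (real k * q)) * v"
          by (simp add: v_def powr_add)
        also have "\<dots> \<le> 1 * v" using p1(2) v by (intro mult_right_mono) auto
        finally show "exp 2 * (2 * (real k)\<^sup>2 * (C * A0)) * p powr (1 - \<eta> / 4 + real k * q) \<le> v" by simp
      qed (use CA k4 in auto)
      finally show ?thesis .
    qed
    then have "(\<Sum>s\<in>S0. measure_pmf.prob ?P {R. E0 s R}) \<le> (\<Sum>s\<in>S0. v ^ s)" by (rule sum_mono)
    also have "\<dots> \<le> 2 * v powr ((1 - \<delta>) * M)"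
      using v fS by (intro sum_power_tail_le) (auto simp: S0_def)
    also have "v powr ((1 - \<delta>) * M) = p powr ((1 - \<eta> / 4) * ((1 - \<delta>) * M))"
      by (simp add: v_def powr_powr)
    \<comment> \<open>The losses in base and size leave a surplus of
      \<open>\<eta> / 2 * M \<ge> \<eta> / 2\<close>; the resulting
      \<open>p powr (\<eta> / 2)\<close> pays for the factor 2 of the geometric series and for the
      halving.\<close>
    also have "\<dots> \<le> p powr ((1 - \<eta>) * M + \<eta> / 2)"
    proof (intro powr_mono')
      have "(1 - \<eta> / 4) * ((1 - \<delta>) * M) = (1 - \<eta> / 2) * M + \<eta>\<^sup>2 / 16 * M"
        by (simp add: \<delta> power2_eq_square field_simps)
      moreover have "0 \<le> \<eta>\<^sup>2 / 16 * M" using M1 by simp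
      moreover have "(1 - \<eta> / 2) * M = (1 - \<eta>) * M + \<eta> / 2 * M" by (simp add: algebra_simps)
      moreover have "\<eta> / 2 * 1 \<le> \<eta> / 2 * M" using M1 \<eta> by (intro mult_left_mono) auto
      ultimately show "(1 - \<eta>) * M + \<eta> / 2 \<le> (1 - \<eta> / 4) * ((1 - \<delta>) * M)" by linarith
    qed (use p in auto)
    also have "\<dots> = p powr ((1 - \<eta>) * M) * p powr (\<eta> / 2)" by (rule powr_add)
    also have "\<dots> \<le> p powr ((1 - \<eta>) * M) * (1 / 4)" using p1(4) by (intro mult_left_mono) auto
    finally show ?thesis by simp
  qed
  have sum1: "(\<Sum>s\<in>S1. measure_pmf.prob ?P {R. E1 s R}) \<le> 1 / 2 * p powr ((1 - \<eta>) * M)"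
  proof -
    define a where "a = sqrt t * p powr (- q * \<theta> / 2) / k"
    have "measure_pmf.prob ?P {R. E1 s R} \<le> (1 / 2) ^ s" if s: "s \<in> S1" for s
    proof -
      have s': "1 \<le> s" "s \<le> m" using s by (auto simp: S1_def)
      have c: "0 < crit s" "crit s \<le> 1" using crit_pos crit_power_le s' by auto
      have "crit s ^ (k - 2) \<le> x0 ^ (k - 2)" using crit_power_le(1)[OF s'] x0(3) by linarith
      then have "crit s \<le> x0" using x0(1) k by (simp add: power_mono_iff c less_imp_le)
      then have "crit s powr (1 / 4) \<le> x0 powr (1 / 4)" using c by (intro powr_mono2) auto
      then have "exp 2 * ((real k)\<^sup>2 * (C * A1)) * crit s powr (1 / 4)
          \<le> exp 2 * ((real k)\<^sup>2 * (C * A1)) * x0 powr (1 / 4)"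
        using CA by (intro mult_left_mono) auto
      then have base: "exp 2 * ((real k)\<^sup>2 * (C * A1)) * crit s powr (1 / 4) \<le> 1 / 2"
        using x0(2) by linarith
      have "measure_pmf.prob ?P {R. E1 s R} \<le> (exp 2 * ((real k)\<^sup>2 * (C * A1)) * crit s powr (1 / 4)) ^ s"
        unfolding E1_def
      proof (rule prob_spread_large[OF q0 _ C _ CA(2) _ D0])
        have "C * A1 * crit s powr (1 / 2) \<le> C * A1 * crit s powr (1 / 4)"
          using c CA by (intro mult_left_mono powr_mono') auto
        also have "\<dots> = 1 * (C * A1 * crit s powr (1 / 4))" by simp
        also have "\<dots> \<le> (exp 2 * (real k)\<^sup>2) * (C * A1 * crit s powr (1 / 4))"
        proof (intro mult_right_mono)
          have "1 * 1 \<le> exp (2::real) * (real k)\<^sup>2" using k4 by (intro mult_mono) auto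
          then show "1 \<le> exp (2::real) * (real k)\<^sup>2" by simp
        qed (use CA in auto)
        also have "\<dots> \<le> 1 / 2" using base by (simp add: mult.assoc)
        finally show "C * A1 * crit s powr (1 / 2) \<le> 1" by simp
      qed (use kq \<eta> A1' s' D in auto)
      also have "\<dots> \<le> (1 / 2) ^ s" using base CA k4 by (intro power_mono) auto
      finally show ?thesis .
    qed
    then have "(\<Sum>s\<in>S1. measure_pmf.prob ?P {R. E1 s R}) \<le> (\<Sum>s\<in>S1. (1 / 2) ^ s)" by (rule sum_mono)
    also have "\<dots> \<le> 2 * (1 / 2) powr a"
    proof (rule sum_power_tail_le[OF fS(2)])
      fix s assume s: "s \<in> S1"
      have "(sqrt t * p powr (- q * \<theta> / 2))\<^sup>2 = t * p powr (- q * \<theta>)"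
        using t p by (simp add: power_mult_distrib power2_powr)
      also have "\<dots> \<le> (real k * s)\<^sup>2" using s by (simp add: S1_def power_mult_distrib)
      finally have "sqrt t * p powr (- q * \<theta> / 2) \<le> real k * s" by (rule power2_le_imp_le) simp
      then show "a \<le> real s" using k by (simp add: a_def field_simps)
    qed auto
    \<comment> \<open>\<open>M\<close> is at most \<open>4 * real k * sqrt t\<close>, while
      \<open>a\<close> exceeds \<open>sqrt t\<close> by a negative power of \<open>p\<close>, which
      beats \<open>ln (1 / p)\<close>.\<close>
    also have "\<dots> \<le> 2 * (1 / 4 * p powr M)"
    proof -
      have t1: "1 \<le> sqrt t" using w_ge w_le_t by simp
      have lp: "0 \<le> ln (1 / p)" using p by simp
      have "M \<le> 4 * real k * sqrt t" using n(1,2) unfolding M_def by linarith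
      then have "M * ln (1 / p) \<le> 4 * real k * sqrt t * ln (1 / p)" using lp by (intro mult_right_mono)
      moreover have "2 * ln 2 * 1 \<le> 2 * ln 2 * sqrt t" using t1 by (intro mult_left_mono) auto
      moreover have "sqrt t * (2 * ln 2 + 4 * real k * ln (1 / p))
          = 2 * ln 2 * sqrt t + 4 * real k * sqrt t * ln (1 / p)"
        by (simp add: algebra_simps)
      ultimately have "2 * ln 2 + M * ln (1 / p) \<le> sqrt t * (2 * ln 2 + 4 * real k * ln (1 / p))"
        by linarith
      also have "\<dots> \<le> sqrt t * (p powr (- q * \<theta> / 2) * ln 2 / k)"
        using p1(5) t by (intro mult_left_mono) auto
      also have "\<dots> = a * ln 2" by (simp add: a_def)
      finally have "- (a * ln 2) \<le> - (2 * ln 2) + M * ln p" using p by (simp add: ln_div)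
      then have "exp (- (a * ln 2)) \<le> exp (- (2 * ln 2)) * exp (M * ln p)" by (simp add: exp_add[symmetric])
      moreover have "exp (- (a * ln 2)) = (1 / 2) powr a" by (simp add: powr_def ln_div)
      moreover have "exp (- (2 * ln 2)) = (1 / 4 :: real)"
      proof -
        have "exp (2 * ln 2) = exp (ln 2) * exp (ln (2::real))" by (simp only: exp_add[symmetric]) simp
        then show ?thesis by (simp add: exp_minus)
      qed
      moreover have "exp (M * ln p) = p powr M" using p by (simp add: powr_def)
      ultimately show ?thesis by simp
    qed
    also have "p powr M \<le> p powr ((1 - \<eta>) * M)"
    proof (intro powr_mono')
      have "(1 - \<eta>) * M \<le> 1 * M" using \<eta> M1 by (intro mult_right_mono) auto
      then show "(1 - \<eta>) * M \<le> M" by simp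
    qed (use p in auto)
    finally show ?thesis by simp
  qed
  have "measure_pmf.prob ?P {R. \<exists>U. U \<subseteq> {1..N} \<and> t \<le> gain N k p U \<and> card U \<le> m \<and> U \<subseteq> R}
      \<le> measure_pmf.prob ?P ({R. \<exists>s\<in>S0. E0 s R} \<union> {R. \<exists>s\<in>S1. E1 s R})"
    using incl by (intro measure_pmf.finite_measure_mono) auto
  also have "\<dots> \<le> measure_pmf.prob ?P {R. \<exists>s\<in>S0. E0 s R} + measure_pmf.prob ?P {R. \<exists>s\<in>S1. E1 s R}"
    by (intro measure_Un_le) auto
  also have "\<dots> \<le> (\<Sum>s\<in>S0. measure_pmf.prob ?P {R. E0 s R}) + (\<Sum>s\<in>S1. measure_pmf.prob ?P {R. E1 s R})"
    by (intro add_mono prob_UN_le fS)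
  also have "\<dots> \<le> p powr ((1 - \<eta>) * M)" using sum0 sum1 by linarith
  finally show ?thesis by (simp add: M_def)
qed

text \<open>The constant \<open>w\<close> depends on \<open>k\<close> and \<open>\<eta>\<close>
  only, so it can be fixed before \<open>N\<close>. The smallness of \<open>p\<close> is a
  consequence of the existence of the seed \<open>U0\<close>.\<close>

lemma prob_seed_le:
  fixes \<eta> :: real
  assumes k: "3 \<le> k" and \<eta>: "0 < \<eta>" "\<eta> < 1"
  obtains w where "4 * (real k)\<^sup>2 \<le> w" "\<And>N m p t U0. sparse_regime N k m p t w \<Longrightarrow> U0 \<subseteq> {1..N} \<Longrightarrow> card U0 \<le> m \<Longrightarrow>
    t \<le> gain N k p U0 \<Longrightarrow>
    measure_pmf.prob (bernoulli_subset {1..N} p)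
      {R. \<exists>U. U \<subseteq> {1..N} \<and> t \<le> gain N k p U \<and> card U \<le> m \<and> U \<subseteq> R}
    \<le> p powr ((1 - \<eta>) * Min (card ` {U. U \<subseteq> {1..N} \<and> t \<le> gain N k p U}))"
proof -
  define q where "q = \<eta> / (24 * real k)"
  define \<delta> where "\<delta> = \<eta> / 4"
  define r where "r = nat \<lceil>16 * real k ^ 3 / \<delta>\<rceil>"
  define e where "e = \<delta> / (16 * real k ^ 4 * 2 ^ r)"
  define C where "C = 2 * (real k)\<^sup>2 / q ^ k"
  define D where "D = 4 * real k * (real k)\<^sup>2 / q ^ (2 * k + 1)"
  define A0 where "A0 = 4 * real k ^ 5 / (e * q)"
  define A1 where "A1 = 2 * real k / (e * q)"
  define h where "h = 1 / real (k - 2)"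
  define c where "c = q * h / 4"
  have \<delta>: "0 < \<delta>" and q: "0 < q" using \<eta> k by (auto simp: \<delta>_def q_def)
  have r: "0 < r" "16 * real k ^ 3 / \<delta> \<le> real r"
  proof -
    show "16 * real k ^ 3 / \<delta> \<le> real r" unfolding r_def by (rule real_nat_ceiling_ge)
    moreover have "0 < 16 * real k ^ 3 / \<delta>" using k \<delta> by simp
    ultimately show "0 < r" by linarith
  qed
  have e: "0 < e" using \<delta> k by (simp add: e_def)
  have pos: "0 < C" "0 < D" "0 < A0" "0 < A1" "0 < h" "0 < c"
    using k q e by (auto simp: C_def D_def A0_def A1_def h_def c_def)
  have kk: "0 < real k" using k by simp
  obtain x0 where x0: "0 < x0"
    "\<And>x. 0 < x \<Longrightarrow> x \<le> x0 \<Longrightarrow> (2 * exp 2 * ((real k)\<^sup>2 * (C * A1))) * x powr (1 / 4) \<le> 1"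
    using small_power[of "2 * exp 2 * ((real k)\<^sup>2 * (C * A1))" "1 / 4"] pos kk by auto
  obtain p1 where p1: "0 < p1"
    "\<And>x. 0 < x \<Longrightarrow> x \<le> p1 \<Longrightarrow> (exp 2 * (2 * (real k)\<^sup>2 * (C * A0))) * x powr (real k * q) \<le> 1"
    using small_power[of "exp 2 * (2 * (real k)\<^sup>2 * (C * A0))" "real k * q"] pos kk q by auto
  obtain p2 where p2: "0 < p2" "\<And>x. 0 < x \<Longrightarrow> x \<le> p2 \<Longrightarrow> (C * A0) * x powr (1 / 2) \<le> 1"
    using small_power[of "C * A0" "1 / 2"] pos by auto
  obtain p3 where p3: "0 < p3" "\<And>x. 0 < x \<Longrightarrow> x \<le> p3 \<Longrightarrow> 4 * x powr (\<eta> / 2) \<le> 1"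
    using small_power[of 4 "\<eta> / 2"] \<eta> by auto
  define L where "L = (2 * ln 2 + 4 * real k / c) * k / ln 2"
  have L: "0 < L" using pos kk by (simp add: L_def add_pos_pos)
  obtain p4 where p4: "0 < p4" "\<And>x. 0 < x \<Longrightarrow> x \<le> p4 \<Longrightarrow> L * x powr c \<le> 1"
    using small_power[of L c] pos L by auto
  define p0 where "p0 = Min {1 / 4, p1, p2, p3, p4}"
  have p0: "0 < p0" using p1(1) p2(1) p3(1) p4(1) by (simp add: p0_def)
  define w where "w = Max {4 * (real k)\<^sup>2, 32 * real k ^ 4, 16 * real k ^ 4 / \<delta>\<^sup>2, 2 * real k * D / (e * q),
    (real k * D) ^ (k - 2), 4 * (real k)\<^sup>2 / (e * q), (real k)\<^sup>2 / x0 ^ (k - 2),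
    2 * (real k)\<^sup>2 / p0 ^ (k - 2)}"
  have w_lb: "4 * (real k)\<^sup>2 \<le> w" "32 * real k ^ 4 \<le> w" "16 * real k ^ 4 / \<delta>\<^sup>2 \<le> w" "2 * real k * D / (e * q) \<le> w"
    "(real k * D) ^ (k - 2) \<le> w" "4 * (real k)\<^sup>2 / (e * q) \<le> w" "(real k)\<^sup>2 / x0 ^ (k - 2) \<le> w"
    "2 * (real k)\<^sup>2 / p0 ^ (k - 2) \<le> w"
    unfolding w_def by (rule Max_ge; simp)+
  have w0: "0 < w"
  proof -
    have "0 < 4 * (real k)\<^sup>2" using kk by simp
    then show ?thesis using w_lb(1) by linarith
  qed
  show ?thesis
  proof (rule that[OF w_lb(1)])
    fix N m p t U0
    assume reg: "sparse_regime N k m p t w" and U0: "U0 \<subseteq> {1..N}" "card U0 \<le> m" "t \<le> gain N k p U0"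
    interpret sparse_regime N k m p t w by (rule reg)
    \<comment> \<open>A seed with at most \<open>m\<close> elements forces
      \<open>t \<le> 2 * (real k)\<^sup>2 * (real m)\<^sup>2\<close>; against \<open>tmm\<close>
      this gives \<open>w * p ^ (k - 2) \<le> 2 * (real k)\<^sup>2\<close>.\<close>
    have pp0: "p \<le> p0"
    proof -
      have "t \<le> 2 * (real k)\<^sup>2 * (real (card U0))\<^sup>2"
        using gain_large_imp_card[of U0] U0 t finite_subset[OF U0(1)] by simp
      also have "\<dots> \<le> 2 * (real k)\<^sup>2 * (real m)\<^sup>2"
        using U0(2) by (intro mult_left_mono power_mono) auto
      finally have "w * ((real m)\<^sup>2 * p ^ (k - 2)) \<le> 2 * (real k)\<^sup>2 * (real m)\<^sup>2"
        using tmm by linarith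
      then have "(w * p ^ (k - 2)) * (real m)\<^sup>2 \<le> (2 * (real k)\<^sup>2) * (real m)\<^sup>2" by (simp add: mult_ac)
      then have "w * p ^ (k - 2) \<le> 2 * (real k)\<^sup>2" using m by (simp only: mult_le_cancel_right) auto
      also have "\<dots> \<le> w * p0 ^ (k - 2)" using w_lb(8) p0 by (simp add: field_simps)
      finally have "p ^ (k - 2) \<le> p0 ^ (k - 2)" using w0 by simp
      then show ?thesis using k p p0 by (simp add: power_mono_iff)
    qed
    then have ple: "p \<le> 1 / 4" "p \<le> p1" "p \<le> p2" "p \<le> p3" "p \<le> p4" by (simp_all add: p0_def)
    have log_bound: "2 * ln 2 + 4 * real k * ln (1 / p) \<le> p powr (- q * h / 2) * ln 2 / k"
    proof -
      \<comment> \<open>The required power of \<open>1 / p\<close> is \<open>y * y\<close>: one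
        factor bounds the logarithm up to \<open>1 / c\<close>, the other absorbs the constant
        \<open>L\<close>.\<close>
      define y where "y = p powr (- c)"
      have y: "1 \<le> y" using p pos by (simp add: y_def powr_minus one_le_inverse powr_le1)
      have "L * (1 / y) \<le> 1" using p4(2)[OF p(1) ple(5)] by (simp add: y_def powr_minus divide_inverse)
      then have Ly: "L \<le> y" using y by (simp add: field_simps)
      have "ln (1 / p) \<le> (1 / p) powr c / c" using p pos by (intro ln_powr_bound) auto
      also have "(1 / p) powr c = y" using p by (simp add: y_def powr_minus divide_inverse inverse_powr)
      finally have "4 * real k * ln (1 / p) \<le> 4 * real k * (y / c)" by (intro mult_left_mono) auto
      moreover have "2 * ln 2 * 1 \<le> 2 * ln 2 * y" using y by (intro mult_left_mono) auto
      moreover have "(2 * ln 2 + 4 * real k / c) * y = 2 * ln 2 * y + 4 * real k * (y / c)"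
        by (simp add: algebra_simps)
      ultimately have "2 * ln 2 + 4 * real k * ln (1 / p) \<le> (2 * ln 2 + 4 * real k / c) * y"
        by linarith
      also have "\<dots> = L * y * ln 2 / k" using kk by (simp add: L_def)
      also have "\<dots> \<le> y * y * ln 2 / k" using Ly y by (intro divide_right_mono mult_right_mono) auto
      also have "y * y = p powr (- q * h / 2)"
        by (simp add: y_def powr_add[symmetric] c_def mult.commute)
      finally show ?thesis .
    qed
    show "measure_pmf.prob (bernoulli_subset {1..N} p)
        {R. \<exists>U. U \<subseteq> {1..N} \<and> t \<le> gain N k p U \<and> card U \<le> m \<and> U \<subseteq> R}
      \<le> p powr ((1 - \<eta>) * Min (card ` {U. U \<subseteq> {1..N} \<and> t \<le> gain N k p U}))"
      unfolding min_seed_def[symmetric]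
    proof (rule prob_seed_le_aux[OF U0 \<eta> q_def \<delta>_def r e_def C_def D_def A0_def A1_def w_lb(2-6) x0(1) _ _ ple(1)])
      show "exp 2 * ((real k)\<^sup>2 * (C * A1)) * x0 powr (1 / 4) \<le> 1 / 2" using x0(2)[of x0] x0(1) by simp
      show "(real k)\<^sup>2 / w \<le> x0 ^ (k - 2)" using w_lb(7) w0 x0(1) by (simp add: field_simps)
      show "exp 2 * (2 * (real k)\<^sup>2 * (C * A0)) * p powr (real k * q) \<le> 1" by (rule p1(2)[OF p(1) ple(2)])
      show "C * A0 * p powr (1 / 2) \<le> 1" by (rule p2(2)[OF p(1) ple(3)])
      show "p powr (\<eta> / 2) \<le> 1 / 4" using p3(2)[OF p(1) ple(4)] by simp
      show "2 * ln 2 + 4 * real k * ln (1 / p) \<le> p powr (- q * \<theta> / 2) * ln 2 / k"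
        using log_bound by (simp only: \<theta>_def h_def)
    qed
  qed
qed

section \<open>From bounds at fixed \<open>N\<close> to the asymptotic statement\<close>

theorem theorem1p2:
  fixes k :: nat and p t :: "nat \<Rightarrow> real" and m :: "nat \<Rightarrow> nat"
  assumes "k \<ge> 3"
    and "\<And>N. N \<ge> 1 \<Longrightarrow> 0 < p N \<and> p N < 1"
    and "\<And>N. N \<ge> 1 \<Longrightarrow> t N > 0"
    and "\<And>N. N \<ge> 1 \<Longrightarrow> m N > 0"
    and "(\<lambda>N. real (m N) * max 1 (real N * p N ^ (k - 1)) / t N) \<longlonglongrightarrow> 0"
    and "(\<lambda>N. real (m N) ^ 2 * p N ^ (k - 2)
               * real N powr (real (k - 2) * (real (m N) / t N) powr (1 / real (k - 1)))
             / t N) \<longlonglongrightarrow> 0"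
  shows "\<forall>\<epsilon>::real. \<epsilon> > 0 \<longrightarrow>
    (\<forall>\<^sub>F N in sequentially.
       log_prob (measure_pmf.prob (random_subset N (p N))
                   {R. \<exists>U \<in> seeds N (p N) k (t N). card U \<le> m N \<and> U \<subseteq> R})
       \<le> ereal (1 - \<epsilon>) * ereal_of_enat (Psi N (p N) k (t N)) * ereal (ln (p N)))"
proof (intro allI impI)
  fix \<epsilon> :: real
  assume "\<epsilon> > 0"
  let ?prob = "\<lambda>N. measure_pmf.prob (random_subset N (p N))
                   {R. \<exists>U \<in> seeds N (p N) k (t N). card U \<le> m N \<and> U \<subseteq> R}"
  show "\<forall>\<^sub>F N in sequentially. log_prob (?prob N)
       \<le> ereal (1 - \<epsilon>) * ereal_of_enat (Psi N (p N) k (t N)) * ereal (ln (p N))"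
  proof (cases "\<epsilon> < 1")
    \<comment> \<open>For \<open>\<epsilon> \<ge> 1\<close> the right-hand side is nonnegative, also
      when \<open>Psi\<close> is infinite.\<close>
    case False
    show ?thesis
    proof (rule eventually_sequentiallyI[of 1])
      fix N :: nat assume N: "1 \<le> N"
      have "log_prob (?prob N) \<le> 0"
        using measure_pmf.prob_le_1[of "random_subset N (p N)"] by (auto simp: log_prob_def measure_nonneg less_le)
      moreover have "ereal (1 - \<epsilon>) * ereal_of_enat (Psi N (p N) k (t N)) \<le> 0"
        using False by (simp add: ereal_mult_le_0_iff)
      then have "0 \<le> ereal (1 - \<epsilon>) * ereal_of_enat (Psi N (p N) k (t N)) * ereal (ln (p N))"
        using assms(2)[OF N] by (simp add: ereal_zero_le_0_iff)
      ultimately show "log_prob (?prob N)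
          \<le> ereal (1 - \<epsilon>) * ereal_of_enat (Psi N (p N) k (t N)) * ereal (ln (p N))" by (rule order_trans)
    qed
  next
    case True
    obtain w where w: "4 * (real k)\<^sup>2 \<le> w" and bound: "\<And>N m p t U0. sparse_regime N k m p t w \<Longrightarrow> U0 \<subseteq> {1..N} \<Longrightarrow>
        card U0 \<le> m \<Longrightarrow> t \<le> gain N k p U0 \<Longrightarrow>
      measure_pmf.prob (bernoulli_subset {1..N} p)
        {R. \<exists>U. U \<subseteq> {1..N} \<and> t \<le> gain N k p U \<and> card U \<le> m \<and> U \<subseteq> R}
      \<le> p powr ((1 - \<epsilon>) * Min (card ` {U. U \<subseteq> {1..N} \<and> t \<le> gain N k p U}))"
      by (rule prob_seed_le[OF assms(1) \<open>\<epsilon> > 0\<close> True]) blast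
    have "0 < 4 * (real k)\<^sup>2" using assms(1) by simp
    then have w0: "0 < w" using w by linarith
    have "\<forall>\<^sub>F N in sequentially. real (m N) * max 1 (real N * p N ^ (k - 1)) / t N < 1 / w"
      using assms(5) w0 by (intro order_tendstoD(2)) auto
    moreover have "\<forall>\<^sub>F N in sequentially. real (m N) ^ 2 * p N ^ (k - 2)
               * real N powr (real (k - 2) * (real (m N) / t N) powr (1 / real (k - 1))) / t N < 1 / w"
      using assms(6) w0 by (intro order_tendstoD(2)) auto
    moreover have "\<forall>\<^sub>F N in sequentially. 1 \<le> N" by (rule eventually_ge_at_top)
    ultimately show ?thesis
    proof eventually_elim
      case (elim N)
      have p: "0 < p N" "p N < 1" and t: "0 < t N" and m: "0 < m N" using assms(2-4) elim(3) by auto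
      have 1: "w * (m N * max 1 (N * p N ^ (k - 1))) \<le> t N"
        using elim(1) t w0 by (simp add: field_simps)
      have reg: "sparse_regime N k (m N) (p N) (t N) w"
      proof
        have "w * (real (m N) * 1) \<le> w * (m N * max 1 (N * p N ^ (k - 1)))"
          using w0 by (intro mult_left_mono) auto
        then show "w * m N \<le> t N" using 1 by simp
        have "w * (m N * (N * p N ^ (k - 1))) \<le> w * (m N * max 1 (N * p N ^ (k - 1)))"
          using w0 by (intro mult_left_mono) auto
        then show "w * (m N * (N * p N ^ (k - 1))) \<le> t N" using 1 by simp
        define F where "F = real N powr (real (k - 2) * (real (m N) / t N) powr (1 / real (k - 1)))"
        have "1 \<le> F" unfolding F_def using elim(3) by (intro ge_one_powr_ge_zero) auto
        then have "w * ((real (m N))\<^sup>2 * p N ^ (k - 2) * 1) \<le> w * ((real (m N))\<^sup>2 * p N ^ (k - 2) * F)"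
          using w0 p by (intro mult_left_mono) auto
        also have "\<dots> \<le> t N" using elim(2) t w0 unfolding F_def[symmetric] by (simp add: field_simps)
        finally show "w * ((real (m N))\<^sup>2 * p N ^ (k - 2)) \<le> t N" by simp
      qed (use assms(1) p t m w in auto)
      have S: "seeds N (p N) k (t N) = {U. U \<subseteq> {1..N} \<and> t N \<le> gain N k (p N) U}"
        by (rule seeds_eq[OF p])
      let ?E = "{R. \<exists>U. U \<subseteq> {1..N} \<and> t N \<le> gain N k (p N) U \<and> card U \<le> m N \<and> U \<subseteq> R}"
      have E: "{R. \<exists>U \<in> seeds N (p N) k (t N). card U \<le> m N \<and> U \<subseteq> R} = ?E"
        unfolding S by auto
      show ?case
      proof (cases "\<exists>U \<in> seeds N (p N) k (t N). card U \<le> m N")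
        \<comment> \<open>The event is empty and its logarithm is minus infinity; this includes the
          case of infinite \<open>Psi\<close>.\<close>
        case False
        then have "{R. \<exists>U \<in> seeds N (p N) k (t N). card U \<le> m N \<and> U \<subseteq> R} = {}" by auto
        then have "?prob N = 0" by (simp only: measure_empty)
        then show ?thesis by (simp only: log_prob_def) simp
      next
        case True
        then obtain U0 where U0: "U0 \<in> seeds N (p N) k (t N)" "card U0 \<le> m N" by blast
        define M where "M = Min (card ` seeds N (p N) k (t N))"
        have Psi: "ereal_of_enat (Psi N (p N) k (t N)) = ereal (real M)"
          using U0(1) by (auto simp: Psi_def M_def)
        have le: "?prob N \<le> p N powr ((1 - \<epsilon>) * M)"
          unfolding E unfolding random_subset_eq M_def S
          by (rule bound[OF reg _ U0(2)]) (use U0(1) in \<open>auto simp: S\<close>)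
        show ?thesis
        proof (cases "?prob N = 0")
          case True
          then show ?thesis by (simp add: log_prob_def)
        next
          case False
          then have "0 < ?prob N" by (simp add: less_le measure_nonneg)
          then have "ln (?prob N) \<le> ln (p N powr ((1 - \<epsilon>) * M))" by (rule ln_mono[OF le])
          also have "\<dots> = (1 - \<epsilon>) * M * ln (p N)" using p by (simp add: ln_powr)
          finally show ?thesis using False by (simp add: log_prob_def Psi)
        qed
      qed
    qed
  qed
qed

end
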